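(* Let $v\in H^{-1}_{loc}(\mathbb{R})$ be $\pi$-periodic, written as $v=C+Q'$ with $C\in\mathbb{C}$ and $Q\in L^2_{loc}(\mathbb{R})$ $\pi$-periodic with $\int_0^\pi Q\,dx=0$. Let $L(v)$ be the operator in $L^2(\mathbb{R})$ with domain $$D(L(v))=\{y\in H^1(\mathbb{R}):\ y'-Qy\in L^2(\mathbb{R})\cap W^1_{1,loc}(\mathbb{R}),\ \ell_Q(y)\in L^2(\mathbb{R})\},$$ $$L(v)y=\ell_Q(y):=-(y'-Qy)'-Qy'+Cy.$$ Then: (a) $D(L(v))$ is dense in $L^2(\mathbb{R})$; (b) $L(v)$ is closed and $(L(v))^*=L(\overline{v})$ (in particular, if $v$ is real-valued, $L(v)$ is self-adjoint); (c) the spectrum $Sp(L(v))$ is continuous, and $$Sp(L(v))=\{\lambda\in\mathbb{C}:\ \exists\,\theta\in[0,2\pi)\ \text{with}\ \Delta(\lambda)=2\cos\theta\}.$$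
   Context: $H^{-1}_{loc}(\mathbb{R})$: distributions $v$ such that for every $T>0$ there is $C(T)$ with $|\langle v,\varphi\rangle|\le C(T)(\int_{-T}^T|\varphi|^2+|\varphi'|^2)^{1/2}$ for all smooth $\varphi$ supported in $[-T,T]$; $v$ is $\pi$-periodic if $\langle v,\varphi(x)\rangle=\langle v,\varphi(x-\pi)\rangle$ for all test functions. Every such $v$ has a unique representation $v=C+Q'$ as stated. $\overline{v}=\overline{C}+\overline{Q}'$. $W^1_{1,loc}(\mathbb{R})$ denotes locally absolutely continuous functions. Lyapunov function: for $\lambda\in\mathbb{C}$ let $(y_1(x;\lambda),u_1(x;\lambda))$ and $(y_2(x;\lambda),u_2(x;\lambda))$ be the (locally absolutely continuous) solutions of $y'=Qy+u$, $u'=(C-\lambda-Q^2)y-Qu$ with $(y_1,u_1)(0)=(1,0)$, $(y_2,u_2)(0)=(0,1)$, and set $\Delta(\lambda)=y_1(\pi;\lambda)+u_2(\pi;\lambda)$ (an entire function of $\lambda$). *)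

theory Defs
  imports "HOL-Analysis.Analysis"
begin

text \<open>Elements of L2(R) are represented by complex-valued functions on the reals;
  all notions below are invariant under modification on null sets.\<close>

definition L2 :: "(real \<Rightarrow> complex) \<Rightarrow> bool" where
  "L2 f \<longleftrightarrow> f \<in> borel_measurable lborel \<and> integrable lborel (\<lambda>x. (cmod (f x))\<^sup>2)"

definition l2norm :: "(real \<Rightarrow> complex) \<Rightarrow> real" where
  "l2norm f = sqrt (integral\<^sup>L lborel (\<lambda>x. (cmod (f x))\<^sup>2))"

definition l2inner :: "(real \<Rightarrow> complex) \<Rightarrow> (real \<Rightarrow> complex) \<Rightarrow> complex" where
  "l2inner f g = integral\<^sup>L lborel (\<lambda>x. f x * cnj (g x))"

definition loc_ac_deriv :: "(real \<Rightarrow> complex) \<Rightarrow> (real \<Rightarrow> complex) \<Rightarrow> bool" where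
  "loc_ac_deriv y y' \<longleftrightarrow> (\<forall>a b. a \<le> b \<longrightarrow>
      y' absolutely_integrable_on {a..b} \<and> (y' has_integral (y b - y a)) {a..b})"

text \<open>Graph of the operator L(v), v = C + Q', in L2(R) x L2(R).\<close>
definition hill_graph :: "complex \<Rightarrow> (real \<Rightarrow> complex)
    \<Rightarrow> ((real \<Rightarrow> complex) \<times> (real \<Rightarrow> complex)) set" where
  "hill_graph C Q = {(y, f). L2 y \<and> L2 f \<and>
     (\<exists>yr y' u u'. (AE x in lborel. yr x = y x) \<and>
        loc_ac_deriv yr y' \<and> L2 y' \<and>
        loc_ac_deriv u u' \<and> (AE x in lborel. u x = y' x - Q x * yr x) \<and> L2 u \<and>
        (AE x in lborel. f x = - u' x - Q x * y' x + C * yr x))}"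

definition op_domain :: "((real \<Rightarrow> complex) \<times> (real \<Rightarrow> complex)) set \<Rightarrow> (real \<Rightarrow> complex) set" where
  "op_domain G = fst ` G"

definition dense_domain :: "((real \<Rightarrow> complex) \<times> (real \<Rightarrow> complex)) set \<Rightarrow> bool" where
  "dense_domain G \<longleftrightarrow> (\<forall>f. L2 f \<longrightarrow> (\<forall>\<epsilon>>0. \<exists>y\<in>op_domain G. l2norm (\<lambda>x. y x - f x) < \<epsilon>))"

definition closed_op :: "((real \<Rightarrow> complex) \<times> (real \<Rightarrow> complex)) set \<Rightarrow> bool" where
  "closed_op G \<longleftrightarrow> (\<forall>ys fs y f. (\<forall>n. (ys n, fs n) \<in> G) \<and> L2 y \<and> L2 f \<and>
      (\<lambda>n. l2norm (\<lambda>x. ys n x - y x)) \<longlonglongrightarrow> 0 \<and>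
      (\<lambda>n. l2norm (\<lambda>x. fs n x - f x)) \<longlonglongrightarrow> 0 \<longrightarrow> (y, f) \<in> G)"

definition adjoint_graph :: "((real \<Rightarrow> complex) \<times> (real \<Rightarrow> complex)) set
    \<Rightarrow> ((real \<Rightarrow> complex) \<times> (real \<Rightarrow> complex)) set" where
  "adjoint_graph G = {(z, h). L2 z \<and> L2 h \<and> (\<forall>(y, f)\<in>G. l2inner f z = l2inner y h)}"

definition op_spectrum :: "((real \<Rightarrow> complex) \<times> (real \<Rightarrow> complex)) set \<Rightarrow> complex set" where
  "op_spectrum G = {lam. \<not> ((\<forall>f. L2 f \<longrightarrow> (\<exists>(y, g)\<in>G. AE x in lborel. g x - lam * y x = f x)) \<and>
      (\<exists>M. \<forall>(y, g)\<in>G. l2norm y \<le> M * l2norm (\<lambda>x. g x - lam * y x)))}"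

definition continuous_spectrum :: "((real \<Rightarrow> complex) \<times> (real \<Rightarrow> complex)) set \<Rightarrow> bool" where
  "continuous_spectrum G \<longleftrightarrow> (\<forall>lam\<in>op_spectrum G.
     (\<forall>(y, g)\<in>G. (AE x in lborel. g x = lam * y x) \<longrightarrow> (AE x in lborel. y x = 0)) \<and>
     (\<forall>f. L2 f \<longrightarrow> (\<forall>\<epsilon>>0. \<exists>(y, g)\<in>G. l2norm (\<lambda>x. g x - lam * y x - f x) < \<epsilon>)))"

definition hill_solution :: "complex \<Rightarrow> (real \<Rightarrow> complex) \<Rightarrow> complex
    \<Rightarrow> (real \<Rightarrow> complex) \<Rightarrow> (real \<Rightarrow> complex) \<Rightarrow> complex \<Rightarrow> complex \<Rightarrow> bool" where
  "hill_solution C Q lam y u y0 u0 \<longleftrightarrow>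
     loc_ac_deriv y (\<lambda>x. Q x * y x + u x) \<and>
     loc_ac_deriv u (\<lambda>x. (C - lam - (Q x)\<^sup>2) * y x - Q x * u x) \<and>
     y 0 = y0 \<and> u 0 = u0"

definition lyapunov :: "complex \<Rightarrow> (real \<Rightarrow> complex) \<Rightarrow> complex \<Rightarrow> complex" where
  "lyapunov C Q lam = (THE d. \<exists>y1 u1 y2 u2. hill_solution C Q lam y1 u1 1 0 \<and>
      hill_solution C Q lam y2 u2 0 1 \<and> d = y1 pi + u2 pi)"

end

theory Submission
  imports Defs
begin

text \<open>The eigenvalue equation is the first order system \<open>y' = Q y + u\<close>, \<open>u' = (c - Q\<^sup>2) y - Q u\<close> with
  \<open>c = C - \<lambda>\<close>. Its matrix is locally integrable and traceless, so Picard iteration gives solutions, and constancy of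
  the Wronskian gives uniqueness and the identity \<open>y(x + 2\<pi>) - \<Delta> y(x + \<pi>) + y(x) = 0\<close>. If \<open>\<mu>, 1/\<mu>\<close> are the
  multipliers, so that \<open>\<mu> + 1/\<mu> = \<Delta>\<close>, then \<open>d(x) = y(x + \<pi>) - \<mu> y(x)\<close> satisfies \<open>d(x + \<pi>) = d(x)/\<mu>\<close>; applying
  this twice shows that no nonzero solution is square integrable, and for unimodular \<open>\<mu>\<close> not even on a half line.

  If \<open>\<mu>\<close> is not unimodular, Green's function decays exponentially and defines a bounded inverse. If \<open>\<mu>\<close> is
  unimodular, a right-hand side supported in \<open>[0, \<pi>]\<close> has only preimages supported there, hence must be orthogonal to all
  solutions, so the operator is not onto. An energy estimate over one period provides some \<open>\<lambda>\<close> of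
  the first kind. There the operators with data \<open>C, Q\<close> and \<open>cnj C, cnj Q\<close> are onto, and by Lagrange's identity this
  identifies the adjoint. Density of the domain and of the ranges, and closedness, follow.\<close>

section \<open>Primitives of locally integrable functions\<close>

text \<open>Because \<open>Q'\<close> is only a distribution, \<open>y'\<close> need not be
  continuous and \<open>y''\<close> is in general not a function. What remains locally absolutely
  continuous is the pair of \<open>y\<close> and the quasi-derivative \<open>u = y' - Q y\<close>,
  and all Wronskians are formed from such pairs. As \<open>C\<close> and \<open>Q\<close> may be
  complex, the operator need not be symmetric, and no non-real number lies outside the spectrum for
  free. This is why an energy estimate has to produce such a point before the adjoint can be
  identified. A further obstacle is that the domain asks for \<open>Q y + u\<close> in L2 although
  \<open>Q\<close> is unbounded. Green's function is therefore estimated in L2 with the weight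
  \<open>1 + |Q|^2\<close>, which local square integrability and periodicity of \<open>Q\<close>
  permit. \<open>ac_deriv\<close> fixes a Borel representative of the derivative and uses Lebesgue
  integrals over \<open>lborel\<close>, so that Fubini's theorem on the plane applies directly. This
  yields the product rule and the vanishing of boundary terms at infinity.\<close>

definition ac_deriv :: "(real \<Rightarrow> 'a::{real_normed_field,euclidean_space}) \<Rightarrow> (real \<Rightarrow> 'a) \<Rightarrow> bool" where
  "ac_deriv f g \<longleftrightarrow> g \<in> borel_measurable borel \<and>
     (\<forall>a b. a \<le> b \<longrightarrow> set_integrable lborel {a..b} g \<and> f b - f a = (LINT x:{a..b}|lborel. g x))"

lemma ac_derivI:
  assumes "g \<in> borel_measurable borel"
    and "\<And>a b. a \<le> b \<Longrightarrow> set_integrable lborel {a..b} g"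
    and "\<And>a b. a \<le> b \<Longrightarrow> f b - f a = (LINT x:{a..b}|lborel. g x)"
  shows "ac_deriv f g"
  using assms by (auto simp: ac_deriv_def)

lemma ac_deriv_borel: "ac_deriv f g \<Longrightarrow> g \<in> borel_measurable borel"
  by (simp add: ac_deriv_def)

lemma ac_deriv_integrable: "ac_deriv f g \<Longrightarrow> set_integrable lborel {a..b} g"
  by (cases "a \<le> b") (auto simp: ac_deriv_def)

lemma ac_deriv_integral: "ac_deriv f g \<Longrightarrow> a \<le> b \<Longrightarrow> (LINT x:{a..b}|lborel. g x) = f b - f a"
  by (simp add: ac_deriv_def)

text \<open>Periodicity of \<open>Q\<close> and the equations in the graph hold only almost
  everywhere, so derivatives are constantly changed on null sets. Borel measurability does not
  survive such a change and is assumed of \<open>h\<close>.\<close>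

lemma ac_deriv_cong_AE:
  assumes "ac_deriv f g" "AE x in lborel. g x = h x" "h \<in> borel_measurable borel"
  shows "ac_deriv f h"
proof (rule ac_derivI)
  fix a b :: real
  have m: "g \<in> borel_measurable borel" using assms(1) by (rule ac_deriv_borel)
  have ae: "AE x in lborel. x \<in> {a..b} \<longrightarrow> g x = h x" using assms(2) by auto
  show "set_integrable lborel {a..b} h"
    using set_integrable_cong_AE[of g lborel h "{a..b}"] m assms ae ac_deriv_integrable[OF assms(1)] by auto
  assume "a \<le> b"
  have "(LINT x:{a..b}|lborel. g x) = (LINT x:{a..b}|lborel. h x)"
    by (rule set_lebesgue_integral_cong_AE) (use m assms ae in auto)
  with ac_deriv_integral[OF assms(1) \<open>a \<le> b\<close>] show "f b - f a = (LINT x:{a..b}|lborel. h x)" by simp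
qed (fact assms)

lemma ac_deriv_has_integral:
  assumes "ac_deriv f g" "a \<le> b"
  shows "(g has_integral (f b - f a)) {a..b}"
  using set_borel_integral_eq_integral[OF ac_deriv_integrable[OF assms(1), of a b]]
    ac_deriv_integral[OF assms] integrable_integral[of g "{a..b}"] by simp

lemma continuous_of_has_integral:
  fixes f g :: "real \<Rightarrow> 'a::euclidean_space"
  assumes "\<And>a b. a \<le> b \<Longrightarrow> (g has_integral (f b - f a)) {a..b}"
  shows "continuous_on A f"
proof -
  have "isCont f x" for x
  proof -
    let ?a = "x - 1" and ?b = "x + 1"
    have i: "g integrable_on {?a..?b}"
      using assms[of ?a ?b] by auto
    have "continuous_on {?a..?b} (\<lambda>t. f ?a + integral {?a..t} g)"
      by (intro continuous_intros indefinite_integral_continuous_1 i)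
    moreover have "f ?a + integral {?a..t} g = f t" if "t \<in> {?a..?b}" for t
      using integral_unique[OF assms[of ?a t]] that by auto
    ultimately have "continuous_on {?a..?b} f"
      by (rule continuous_on_eq)
    then show ?thesis
      by (rule continuous_on_interior) (auto simp: interior_atLeastAtMost_real)
  qed
  then show ?thesis by (auto intro: continuous_at_imp_continuous_on)
qed

lemma ac_deriv_continuous: "ac_deriv f g \<Longrightarrow> continuous_on A f"
  by (rule continuous_of_has_integral) (rule ac_deriv_has_integral)

lemma loc_ac_deriv_continuous: "loc_ac_deriv f g \<Longrightarrow> continuous_on A f"
  by (rule continuous_of_has_integral) (auto simp: loc_ac_deriv_def)

lemma ac_deriv_measurable: "ac_deriv f g \<Longrightarrow> f \<in> borel_measurable borel"
  by (rule borel_measurable_continuous_onI[OF ac_deriv_continuous])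

section \<open>Calculus of locally absolutely continuous functions\<close>

lemma ac_deriv_add:
  assumes "ac_deriv f f'" "ac_deriv g g'"
  shows "ac_deriv (\<lambda>x. f x + g x) (\<lambda>x. f' x + g' x)"
  using assms unfolding ac_deriv_def
  by (auto simp: set_integral_add algebra_simps)

lemma ac_deriv_cmult:
  assumes "ac_deriv f f'"
  shows "ac_deriv (\<lambda>x. c * f x) (\<lambda>x. c * f' x)"
  using assms unfolding ac_deriv_def
  by (auto simp: algebra_simps set_integral_mult_right simp flip: right_diff_distrib)

lemma ac_deriv_const: "ac_deriv (\<lambda>x. c) (\<lambda>x. 0)"
  by (auto simp: ac_deriv_def set_integrable_def)

lemma ac_deriv_diff:
  assumes "ac_deriv f f'" "ac_deriv g g'"
  shows "ac_deriv (\<lambda>x. f x - g x) (\<lambda>x. f' x - g' x)"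
  using ac_deriv_add[OF assms(1) ac_deriv_cmult[OF assms(2), of "-1"]] by simp

lemma ac_deriv_cnj:
  assumes "ac_deriv f f'"
  shows "ac_deriv (\<lambda>x. cnj (f x)) (\<lambda>x. cnj (f' x))"
proof (rule ac_derivI)
  show "(\<lambda>x. cnj (f' x)) \<in> borel_measurable borel"
    using ac_deriv_borel[OF assms] by (intro borel_measurable_continuous_on[of cnj] continuous_intros)
  fix a b :: real
  have eq: "(\<lambda>x. indicator {a..b} x *\<^sub>R cnj (f' x)) = (\<lambda>x. cnj (indicator {a..b} x *\<^sub>R f' x))"
    by auto
  show "set_integrable lborel {a..b} (\<lambda>x. cnj (f' x))"
    using ac_deriv_integrable[OF assms, of a b] unfolding set_integrable_def eq complex_integrable_cnj .
  show "cnj (f b) - cnj (f a) = (LINT x:{a..b}|lborel. cnj (f' x))" if "a \<le> b"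
    unfolding ac_deriv_integral[OF assms that, symmetric] complex_cnj_diff[symmetric]
    unfolding set_lebesgue_integral_def eq by (rule Bochner_Integration.integral_cnj[symmetric])
qed

lemma indicator_shift_Icc: "indicator {a..b} (x :: real) = (indicator {a+c..b+c} (c + x) :: real)"
  by (auto simp: indicator_def)

lemma ac_deriv_shift:
  assumes "ac_deriv f f'"
  shows "ac_deriv (\<lambda>x. f (x + c)) (\<lambda>x. f' (x + c))"
proof (rule ac_derivI)
  show "(\<lambda>x. f' (x + c)) \<in> borel_measurable borel"
    using ac_deriv_borel[OF assms] by measurable
  fix a b :: real
  have eq: "(\<lambda>x. indicator {a..b} x *\<^sub>R f' (x + c)) = (\<lambda>x. (\<lambda>x. indicator {a+c..b+c} x *\<^sub>R f' x) (c + 1 * x))"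
    by (auto simp: indicator_shift_Icc[of a b _ c] add.commute)
  show "set_integrable lborel {a..b} (\<lambda>x. f' (x + c))"
    using ac_deriv_integrable[OF assms, of "a+c" "b+c"] unfolding set_integrable_def eq
    by (subst lborel_integrable_real_affine_iff) auto
  show "f (b + c) - f (a + c) = (LINT x:{a..b}|lborel. f' (x + c))" if "a \<le> b"
  proof -
    have "f (b + c) - f (a + c) = (LINT x|lborel. indicator {a+c..b+c} x *\<^sub>R f' x)"
      using ac_deriv_integral[OF assms, of "a+c" "b+c"] that unfolding set_lebesgue_integral_def by simp
    also have "\<dots> = \<bar>1\<bar> *\<^sub>R (LINT x|lborel. (\<lambda>x. indicator {a+c..b+c} x *\<^sub>R f' x) (c + 1 * x))"
      by (rule lborel_integral_real_affine) simp
    finally show ?thesis unfolding set_lebesgue_integral_def eq by simp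
  qed
qed

text \<open>Bridge from gauge integrals and Lebesgue measurable derivatives to Borel ones:
  integrability and integrals are compared in the completion of \<open>lborel\<close>, where
  \<open>g\<close> and \<open>h\<close> cannot be distinguished.\<close>

lemma loc_ac_deriv_imp_ac_deriv:
  assumes "loc_ac_deriv f g" "AE x in lborel. g x = h x" "h \<in> borel_measurable borel"
  shows "ac_deriv f h"
proof (rule ac_derivI)
  fix a b :: real
  have ae: "AE x in lebesgue. g x = h x"
    using assms(2) by (rule AE_completion)
  have i: "set_integrable lborel {a..b} h \<and> (a \<le> b \<longrightarrow> f b - f a = (LINT x:{a..b}|lborel. h x))" if "a \<le> b"
  proof -
    have g: "set_integrable lebesgue {a..b} g" "(g has_integral (f b - f a)) {a..b}"
      using assms(1) that unfolding loc_ac_deriv_def by auto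
    have gm: "(\<lambda>x. indicator {a..b} x *\<^sub>R g x) \<in> borel_measurable lebesgue"
      using g(1) unfolding set_integrable_def by (rule borel_measurable_integrable)
    have hm: "(\<lambda>x. indicator {a..b} x *\<^sub>R h x) \<in> borel_measurable lborel"
      using assms(3) by measurable
    have hi: "integrable lebesgue (\<lambda>x. indicator {a..b} x *\<^sub>R h x)"
      using g(1) unfolding set_integrable_def
      by (rule integrable_cong_AE_imp) (use ae measurable_completion[OF hm] in auto)
    then have h: "set_integrable lborel {a..b} h"
      unfolding set_integrable_def using integrable_completion[OF hm] by auto
    have "(LINT x:{a..b}|lborel. h x) = (LINT x:{a..b}|lebesgue. h x)"
      unfolding set_lebesgue_integral_def using integral_completion[OF hm] by simp
    also have "\<dots> = (LINT x:{a..b}|lebesgue. g x)"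
      unfolding set_lebesgue_integral_def
      by (rule integral_cong_AE) (use ae gm measurable_completion[OF hm] in auto)
    also have "\<dots> = f b - f a"
      using set_lebesgue_integral_eq_integral(2)[OF g(1)] integral_unique[OF g(2)] by simp
    finally show ?thesis using h by simp
  qed
  show "set_integrable lborel {a..b} h"
    using i by (cases "a \<le> b") auto
  show "a \<le> b \<Longrightarrow> f b - f a = (LINT x:{a..b}|lborel. h x)"
    using i by auto
qed (fact assms)

lemma ac_deriv_imp_loc_ac_deriv:
  assumes "ac_deriv f g"
  shows "loc_ac_deriv f g"
  unfolding loc_ac_deriv_def
proof (intro allI impI conjI)
  fix a b :: real assume ab: "a \<le> b"
  have "set_integrable lborel {a..b} g" by (rule ac_deriv_integrable[OF assms])
  then show "g absolutely_integrable_on {a..b}"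
    unfolding set_integrable_def
    using integrable_completion[of "\<lambda>x. indicator {a..b} x *\<^sub>R g x" lborel] by auto
  show "(g has_integral (f b - f a)) {a..b}" by (rule ac_deriv_has_integral[OF assms ab])
qed

lemma loc_ac_deriv_iff: "g \<in> borel_measurable borel \<Longrightarrow> loc_ac_deriv f g \<longleftrightarrow> ac_deriv f g"
  using loc_ac_deriv_imp_ac_deriv[of f g g] ac_deriv_imp_loc_ac_deriv[of f g] by auto

lemma ac_deriv_eqI: "ac_deriv f g \<Longrightarrow> (\<And>x. g x = h x) \<Longrightarrow> ac_deriv f h"
  by (metis ext)

lemma ac_deriv_zero_const:
  assumes "ac_deriv f (\<lambda>x. 0)"
  shows "f x = f y"
  using ac_deriv_integral[OF assms, of x y] ac_deriv_integral[OF assms, of y x] by (cases "x \<le> y") auto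

lemma integrable_pair_mult:
  fixes F G :: "real \<Rightarrow> 'a::{real_normed_field,euclidean_space}"
  assumes F: "integrable lborel F" and G: "integrable lborel G"
  shows "integrable (lborel \<Otimes>\<^sub>M lborel) (\<lambda>(s,t). F s * G t)"
proof (rule lborel_pair.Fubini_integrable)
  have [measurable]: "F \<in> borel_measurable borel" "G \<in> borel_measurable borel"
    using borel_measurable_integrable[OF F] borel_measurable_integrable[OF G] by auto
  show "(\<lambda>(s,t). F s * G t) \<in> borel_measurable (lborel \<Otimes>\<^sub>M lborel)" by measurable
  have "(LINT y|lborel. norm (case (x, y) of (s, t) \<Rightarrow> F s * G t)) = norm (F x) * (LINT y|lborel. norm (G y))" for x
    by (simp add: norm_mult)
  then show "integrable lborel (\<lambda>x. LINT y|lborel. norm (case (x, y) of (s, t) \<Rightarrow> F s * G t))"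
    using F by simp
  show "AE x in lborel. integrable lborel (\<lambda>y. case (x, y) of (s, t) \<Rightarrow> F s * G t)"
    using G by simp
qed

lemma set_integrable_mult_continuous:
  fixes f :: "real \<Rightarrow> 'a::{real_normed_field,euclidean_space}"
  assumes "continuous_on {a..b} f" "f \<in> borel_measurable borel" "set_integrable lborel {a..b} g"
  shows "set_integrable lborel {a..b} (\<lambda>x. f x * g x)"
proof -
  have "bounded (f ` {a..b})"
    by (intro compact_imp_bounded compact_continuous_image assms) auto
  then obtain B where B: "\<And>x. x \<in> {a..b} \<Longrightarrow> norm (f x) \<le> B"
    unfolding bounded_iff by blast
  have m: "(\<lambda>x. indicator {a..b} x *\<^sub>R g x) \<in> borel_measurable lborel"
    using assms(3) unfolding set_integrable_def by auto
  have fm: "f \<in> borel_measurable lborel" using assms(2) by simp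
  have eq: "(\<lambda>x. indicator {a..b} x *\<^sub>R (f x * g x)) = (\<lambda>x. f x * (indicator {a..b} x *\<^sub>R g x))"
    by auto
  have "integrable lborel (\<lambda>x. f x * (indicator {a..b} x *\<^sub>R g x))"
  proof (rule Bochner_Integration.integrable_bound)
    show "integrable lborel (\<lambda>x. B * norm (indicator {a..b} x *\<^sub>R g x))"
      using assms(3) unfolding set_integrable_def by (intro integrable_mult_right integrable_norm)
    show "(\<lambda>x. f x * (indicator {a..b} x *\<^sub>R g x)) \<in> borel_measurable lborel"
      using m fm by (rule borel_measurable_times[rotated])
    show "AE x in lborel. norm (f x * (indicator {a..b} x *\<^sub>R g x)) \<le> norm (B * norm (indicator {a..b} x *\<^sub>R g x))"
    proof (rule AE_I2)
      fix x
      show "norm (f x * (indicator {a..b} x *\<^sub>R g x)) \<le> norm (B * norm (indicator {a..b} x *\<^sub>R g x))"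
        using mult_right_mono[OF B[of x], of "norm (g x)"] abs_ge_self[of "B * norm (g x)"]
        by (cases "x \<in> {a..b}") (auto simp: norm_mult)
    qed
  qed
  then show ?thesis unfolding set_integrable_def eq .
qed

lemma set_integral_Ico_eq_Icc:
  fixes g :: "real \<Rightarrow> 'a::{banach, second_countable_topology}"
  shows "(LINT x:{a..<b}|lborel. g x) = (LINT x:{a..b}|lborel. g x)"
  unfolding set_lebesgue_integral_def
  by (rule integral_discrete_difference[where X="{b}"]) (auto simp: indicator_def)

text \<open>Fubini on the square, split along the diagonal.\<close>
lemma ac_deriv_mult:
  assumes f: "ac_deriv f f'" and g: "ac_deriv g g'"
  shows "ac_deriv (\<lambda>x. f x * g x) (\<lambda>x. f' x * g x + f x * g' x)"
proof (rule ac_derivI)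
  note [measurable] = ac_deriv_borel[OF f] ac_deriv_borel[OF g] ac_deriv_measurable[OF f] ac_deriv_measurable[OF g]
  show "(\<lambda>x. f' x * g x + f x * g' x) \<in> borel_measurable borel" by measurable
  fix a b :: real
  have i1: "set_integrable lborel {a..b} (\<lambda>x. f' x * g x)"
    using set_integrable_mult_continuous[OF ac_deriv_continuous[OF g] ac_deriv_measurable[OF g] ac_deriv_integrable[OF f]]
    by (simp add: mult.commute)
  have i2: "set_integrable lborel {a..b} (\<lambda>x. f x * g' x)"
    using set_integrable_mult_continuous[OF ac_deriv_continuous[OF f] ac_deriv_measurable[OF f] ac_deriv_integrable[OF g]] .
  show "set_integrable lborel {a..b} (\<lambda>x. f' x * g x + f x * g' x)"
    using i1 i2 by simp
  let ?M = "lborel \<Otimes>\<^sub>M (lborel :: real measure) :: (real \<times> real) measure"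
  assume ab: "a \<le> b"
  define F where "F = (\<lambda>x. indicator {a..b} x *\<^sub>R f' x)"
  define G where "G = (\<lambda>x. indicator {a..b} x *\<^sub>R g' x)"
  have F: "integrable lborel F" and G: "integrable lborel G"
    using ac_deriv_integrable[OF f, of a b] ac_deriv_integrable[OF g, of a b]
    unfolding F_def G_def set_integrable_def by auto
  have [measurable]: "F \<in> borel_measurable borel" "G \<in> borel_measurable borel"
    unfolding F_def G_def by measurable
  have FG: "integrable ?M (\<lambda>(s,t). F s * G t)"
    by (rule integrable_pair_mult[OF F G])
  \<comment> \<open>The diagonal is assigned to the lower triangle, so sections of the upper one are
    half-open intervals.\<close>
  let ?L = "\<lambda>(s,t). indicator {p. snd p \<le> fst p} (s,t) *\<^sub>R (F s * G t)"
  let ?U = "\<lambda>(s,t). indicator {p. fst p < snd p} (s,t) *\<^sub>R (F s * G t)"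
  have S1: "{p. snd p \<le> fst p} \<in> sets ?M"
    unfolding lborel_prod sets_lborel by (intro borel_closed closed_Collect_le continuous_intros)
  have S2: "{p. fst p < snd p} \<in> sets ?M"
    unfolding lborel_prod sets_lborel by (intro borel_open open_Collect_less continuous_intros)
  have iL: "integrable ?M ?L"
    using integrable_mult_indicator[OF S1 FG] by (simp add: case_prod_unfold)
  have iU: "integrable ?M ?U"
    using integrable_mult_indicator[OF S2 FG] by (simp add: case_prod_unfold)
  have inL: "(LINT t|lborel. ?L (s,t)) = indicator {a..b} s *\<^sub>R (f' s * (g s - g a))" for s
  proof (cases "s \<in> {a..b}")
    case True
    have "(LINT t|lborel. ?L (s,t)) = (LINT t|lborel. f' s * (indicator {a..s} t *\<^sub>R g' t))"
      using True by (intro Bochner_Integration.integral_cong) (auto simp: F_def G_def indicator_def)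
    also have "\<dots> = f' s * (g s - g a)"
      using ac_deriv_integral[OF g, of a s] True unfolding set_lebesgue_integral_def
      by (subst integral_mult_right_zero) auto
    finally show ?thesis using True by simp
  qed (simp add: F_def)
  have inU: "(LINT s|lborel. ?U (s,t)) = indicator {a..b} t *\<^sub>R ((f t - f a) * g' t)" for t
  proof (cases "t \<in> {a..b}")
    case True
    have "(LINT s|lborel. ?U (s,t)) = (LINT s|lborel. (indicator {a..<t} s *\<^sub>R f' s) * g' t)"
      using True by (intro Bochner_Integration.integral_cong) (auto simp: F_def G_def indicator_def)
    also have "\<dots> = (f t - f a) * g' t"
      using ac_deriv_integral[OF f, of a t] True set_integral_Ico_eq_Icc[of a t f'] unfolding set_lebesgue_integral_def
      by (subst integral_mult_left_zero) auto
    finally show ?thesis using True by simp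
  qed (simp add: G_def)
  have L: "(LINT p|?M. ?L p) = (LINT s:{a..b}|lborel. f' s * (g s - g a))"
    unfolding set_lebesgue_integral_def inL[symmetric] by (rule lborel_pair.integral_fst'[OF iL, symmetric])
  have U: "(LINT p|?M. ?U p) = (LINT t:{a..b}|lborel. (f t - f a) * g' t)"
    unfolding set_lebesgue_integral_def inU[symmetric]
    using lborel_pair.integral_snd[of "\<lambda>s t. indicator {p. fst p < snd p} (s,t) *\<^sub>R (F s * G t)", OF iU]
    unfolding case_prod_conv by (rule sym)
  have "(f b - f a) * (g b - g a) = (LINT s|lborel. F s) * (LINT t|lborel. G t)"
    using ac_deriv_integral[OF f ab] ac_deriv_integral[OF g ab] unfolding F_def G_def set_lebesgue_integral_def by simp
  also have "\<dots> = (LINT s|lborel. LINT t|lborel. F s * G t)"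
    by simp
  also have "\<dots> = (LINT p|?M. (case p of (s,t) \<Rightarrow> F s * G t))"
    using lborel_pair.integral_fst'[OF FG] unfolding case_prod_conv .
  also have "\<dots> = (LINT p|?M. ?L p + ?U p)"
    by (rule arg_cong[where f="integral\<^sup>L _"]) (auto simp: fun_eq_iff indicator_def)
  also have "\<dots> = (LINT p|?M. ?L p) + (LINT p|?M. ?U p)"
    by (rule Bochner_Integration.integral_add[OF iL iU])
  finally have main: "(f b - f a) * (g b - g a) =
      (LINT s:{a..b}|lborel. f' s * (g s - g a)) + (LINT t:{a..b}|lborel. (f t - f a) * g' t)"
    unfolding L U .
  have e1: "(LINT s:{a..b}|lborel. f' s * (g s - g a)) = (LINT s:{a..b}|lborel. f' s * g s) - (f b - f a) * g a"
    using ac_deriv_integrable[OF f, of a b] ac_deriv_integral[OF f ab] i1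
    by (simp add: right_diff_distrib set_integral_diff)
  have e2: "(LINT t:{a..b}|lborel. (f t - f a) * g' t) = (LINT t:{a..b}|lborel. f t * g' t) - f a * (g b - g a)"
    using ac_deriv_integrable[OF g, of a b] ac_deriv_integral[OF g ab] i2
    by (simp add: left_diff_distrib set_integral_diff)
  have e3: "(LINT x:{a..b}|lborel. f' x * g x + f x * g' x) = (LINT s:{a..b}|lborel. f' s * g s) + (LINT t:{a..b}|lborel. f t * g' t)"
    using i1 i2 by (rule set_integral_add(2))
  show "f b * g b - f a * g a = (LINT x:{a..b}|lborel. f' x * g x + f x * g' x)"
    using main unfolding e1 e2 e3 by (simp add: algebra_simps)
qed

section \<open>Vanishing almost everywhere\<close>

lemma AE_lborel_affine:
  assumes "AE x in lborel. P (x::real)" and c: "c \<noteq> 0"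
  shows "AE x in lborel. P (t + c * x)"
proof -
  obtain N where N: "N \<in> null_sets lborel" "{x. \<not> P x} \<subseteq> N"
    using assms unfolding eventually_ae_filter by auto
  then have [measurable]: "N \<in> sets borel" by auto
  have "0 = (\<integral>\<^sup>+x. indicator N x \<partial>lborel)" using N by (simp add: null_sets_def)
  also have "\<dots> = ennreal \<bar>c\<bar> * (\<integral>\<^sup>+x. indicator N (t + c * x) \<partial>lborel)"
    by (rule nn_integral_real_affine[OF _ c]) measurable
  finally have "(\<integral>\<^sup>+x. indicator N (t + c * x) \<partial>lborel) = 0" using c by auto
  then have "AE x in lborel. indicator N (t + c * x) = (0::ennreal)"
    by (subst (asm) nn_integral_0_iff_AE) auto
  then show ?thesis by eventually_elim (use N in \<open>auto simp: indicator_def split: if_splits\<close>)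
qed

text \<open>The part of \<open>S\<close> where the functions differ is open and of measure zero,
  hence empty.\<close>

lemma continuous_AE_eq_imp_eq:
  fixes f g :: "real \<Rightarrow> 'a::{real_normed_vector,second_countable_topology}"
  assumes c: "continuous_on UNIV f" "continuous_on UNIV g" and S: "open S"
    and "AE x in lborel. x \<in> S \<longrightarrow> f x = g x"
    and "x \<in> S"
  shows "f x = g x"
proof (rule ccontr)
  assume ne: "f x \<noteq> g x"
  let ?U = "{x \<in> S. f x \<noteq> g x}"
  have "?U = S \<inter> {x. f x \<noteq> g x}" by auto
  moreover have "open {x. f x \<noteq> g x}" by (intro open_Collect_neq c)
  ultimately have o: "open ?U" using S by auto
  have "AE x in lborel. x \<notin> ?U" using assms(4) by auto
  then have "?U \<in> null_sets lborel" using o by (simp add: AE_iff_null_sets)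
  then have "negligible ?U" by (simp add: negligible_iff_null_sets null_sets_completionI)
  moreover have "?U \<noteq> {}" using ne \<open>x \<in> S\<close> by auto
  ultimately show False using open_not_negligible[OF o] by auto
qed

text \<open>Closed intervals form an intersection-stable generator of the Borel sets, so the
  vanishing of integrals spreads to all Borel sets by Dynkin's argument. Cutting \<open>g\<close>
  off to \<open>[-n, n]\<close> makes it integrable on the whole line, as the complement step
  requires.\<close>

lemma integral_Icc_zero_imp_AE_zero:
  fixes g :: "real \<Rightarrow> 'a::{banach,second_countable_topology}"
  assumes i: "\<And>a b. a \<le> b \<Longrightarrow> set_integrable lborel {a..b} g"
    and z: "\<And>a b. a \<le> b \<Longrightarrow> (LINT x:{a..b}|lborel. g x) = 0"
  shows "AE x in lborel. g x = 0"
proof -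
  have "AE x in lborel. x \<in> {-real n..real n} \<longrightarrow> g x = 0" for n
  proof -
    let ?K = "{-real n..real n}" and ?J = "range (\<lambda>(a, b). {a..b::real})"
    let ?h = "\<lambda>x. indicator ?K x *\<^sub>R g x"
    have iK: "set_integrable lborel ?K g" using i[of "-real n" "real n"] by simp
    have "(LINT x:A|lborel. ?h x) = 0" if "A \<in> sets lborel" for A
    proof -
      have gen: "sets lborel = sigma_sets UNIV ?J"
        using arg_cong[where f=sets, OF borel_eq_atLeastAtMost] by simp
      have int: "integrable lborel ?h"
        using iK unfolding set_integrable_def .
      have int': "set_integrable lborel A ?h" if "A \<in> sets lborel" for A
        unfolding set_integrable_def by (rule integrable_mult_indicator[OF that int])
      have "Int_stable ?J" by (auto simp: Int_stable_def)
      moreover have "?J \<subseteq> Pow UNIV" by auto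
      moreover have "A \<in> sigma_sets UNIV ?J" using that gen by simp
      ultimately show ?thesis
      proof (induction rule: sigma_sets_induct_disjoint)
        case (basic A)
        then obtain a b where A: "A = {a..b}" by auto
        let ?a = "max a (-real n)" and ?b = "min b (real n)"
        have "(LINT x:A|lborel. ?h x) = (LINT x:{?a..?b}|lborel. g x)"
          unfolding set_lebesgue_integral_def A by (rule arg_cong[where f="integral\<^sup>L _"]) (auto simp: indicator_def fun_eq_iff)
        also have "\<dots> = 0" by (cases "?a \<le> ?b") (use z in \<open>auto simp: set_lebesgue_integral_def\<close>)
        finally show ?case .
      next
        case empty then show ?case by (simp add: set_lebesgue_integral_def)
      next
        case (compl A)
        have A: "A \<in> sets lborel" using compl(1) gen by simp
        have "(LINT x:UNIV - A|lborel. ?h x) + (LINT x:A|lborel. ?h x)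
          = (LINT x:(UNIV - A) \<union> A|lborel. ?h x)"
          by (rule set_integral_Un[symmetric])
            (use A int' in auto)
        also have "(UNIV - A) \<union> A = UNIV" by auto
        also have "(LINT x:UNIV|lborel. ?h x) = (LINT x:?K|lborel. g x)"
          by (simp add: set_lebesgue_integral_def)
        also have "\<dots> = 0" using z[of "-real n" "real n"] by simp
        finally show ?case using compl by simp
      next
        case (union A)
        have A: "A i \<in> sets lborel" for i using union(2) gen by auto
        have "(LINT x:(\<Union>i. A i)|lborel. ?h x) = (\<Sum>i. (LINT x:A i|lborel. ?h x))"
          by (rule lebesgue_integral_countable_add)
            (use A int' union(1) in \<open>auto simp: disjoint_family_on_def\<close>)
        then show ?case using union(3) by simp
      qed
    qed
    then have "AE x in lborel. ?h x = 0"
      using sigma_finite_measure.density_zero[OF sigma_finite_lborel] iK unfolding set_integrable_def by blast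
    then show ?thesis by eventually_elim auto
  qed
  then have "AE x in lborel. \<forall>n. x \<in> {-real n..real n} \<longrightarrow> g x = 0" unfolding AE_all_countable by blast
  then show ?thesis
  proof eventually_elim
    case (elim x)
    obtain n where "\<bar>x\<bar> \<le> real n" using real_arch_simple by blast
    then show ?case using elim by (auto simp: abs_le_iff)
  qed
qed

lemma ac_deriv_const_imp_AE_zero:
  assumes "ac_deriv (\<lambda>x. c) g"
  shows "AE x in lborel. g x = 0"
  by (rule integral_Icc_zero_imp_AE_zero)
    (use ac_deriv_integrable[OF assms] ac_deriv_integral[OF assms] in auto)

text \<open>Integrate \<open>B (x + 1) - B x = \<integral>\<^sub>x\<^sup>x\<^sup>+\<^sup>1 k\<close> over the line: the left side gives 0 by translation invariance,
  the right side gives the integral of \<open>k\<close> by Fubini.\<close>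
lemma integral_ac_deriv_eq_zero:
  fixes B k :: "real \<Rightarrow> 'a::{real_normed_field,euclidean_space}"
  assumes B: "ac_deriv B k" and iB: "integrable lborel B" and ik: "integrable lborel k"
  shows "(LINT x|lborel. k x) = 0"
proof -
  have [measurable]: "k \<in> borel_measurable borel" using ik by auto
  let ?H = "\<lambda>x t. indicator {x..x+1} t *\<^sub>R k t"
  have S: "{p. fst p \<le> snd p \<and> snd p \<le> fst p + 1} \<in> sets (borel :: (real \<times> real) measure)"
    by (intro borel_closed closed_Collect_conj closed_Collect_le continuous_intros)
  have eq: "(\<lambda>(x,t). ?H x t) = (\<lambda>p. indicator {p. fst p \<le> snd p \<and> snd p \<le> fst p + 1} p *\<^sub>R k (snd p))"
    by (auto simp: indicator_def fun_eq_iff)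
  have ind: "(indicator {x..x+1} t :: real) = indicator {t-1..t} x" for x t :: real
    by (auto simp: indicator_def)
  have m: "(\<lambda>(x,t). ?H x t) \<in> borel_measurable (lborel \<Otimes>\<^sub>M lborel)"
  proof -
    have [measurable]: "{p. fst p \<le> snd p \<and> snd p \<le> fst p + 1} \<in> sets (lborel \<Otimes>\<^sub>M (lborel::real measure))"
      using S unfolding lborel_prod sets_lborel .
    show ?thesis unfolding eq by measurable
  qed
  have H: "integrable (lborel \<Otimes>\<^sub>M lborel) (\<lambda>(x,t). ?H x t)"
  \<comment> \<open>Integrability is checked with \<open>x\<close> as the inner variable: for fixed
    \<open>t\<close> the section is an interval of length 1, so the inner integral of the norm is
    exactly \<open>norm (k t)\<close>.\<close>
  proof (subst lborel_pair.integrable_product_swap_iff[symmetric], rule lborel_pair.Fubini_integrable)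
    show "(\<lambda>(x, y). (case (y, x) of (x, t) \<Rightarrow> ?H x t)) \<in> borel_measurable (lborel \<Otimes>\<^sub>M lborel)"
      using measurable_pair_swap[OF m] by simp
    have *: "(LINT y|lborel. norm (case (t, y) of (x, y) \<Rightarrow> case (y, x) of (x, t) \<Rightarrow> ?H x t)) = norm (k t)" for t
    proof -
      have "(LINT y|lborel. norm (case (t, y) of (x, y) \<Rightarrow> case (y, x) of (x, t) \<Rightarrow> ?H x t)) = (LINT y|lborel. indicator {t-1..t} y *\<^sub>R norm (k t))"
        by (rule Bochner_Integration.integral_cong) (auto simp: ind indicator_def)
      also have "\<dots> = norm (k t)" by simp
      finally show ?thesis .
    qed
    show "integrable lborel (\<lambda>x. LINT y|lborel. norm (case (x, y) of (x, y) \<Rightarrow> case (y, x) of (x, t) \<Rightarrow> ?H x t))"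
      unfolding * by (rule integrable_norm[OF ik])
    show "AE x in lborel. integrable lborel (\<lambda>y. case (x, y) of (x, y) \<Rightarrow> case (y, x) of (x, t) \<Rightarrow> ?H x t)"
      unfolding case_prod_conv ind by (intro AE_I2 integrable_scaleR_left integrable_real_indicator) auto
  qed
  have iB1: "integrable lborel (\<lambda>x. B (x + 1))"
    using lborel_integrable_real_affine[OF iB, of 1 1] by (simp add: add.commute)
  have "(LINT x|lborel. B (x + 1)) = (LINT x|lborel. B x)"
    using lborel_integral_real_affine[of 1 B 1] by (simp add: add.commute)
  then have "0 = (LINT x|lborel. B (x + 1) - B x)"
    using iB iB1 by simp
  also have "\<dots> = (LINT x|lborel. LINT t|lborel. ?H x t)"
    using ac_deriv_integral[OF B, of x "x+1" for x] by (simp add: set_lebesgue_integral_def)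
  also have "\<dots> = (LINT t|lborel. LINT x|lborel. ?H x t)"
    by (rule lborel_pair.Fubini_integral[OF H, symmetric])
  also have "\<dots> = (LINT t|lborel. k t)"
    unfolding ind by simp
  finally show ?thesis by simp
qed

section \<open>Square integrable functions\<close>

lemma L2_measurable: "L2 f \<Longrightarrow> f \<in> borel_measurable borel"
  by (simp add: L2_def)

lemma L2_integrable: "L2 f \<Longrightarrow> integrable lborel (\<lambda>x. (cmod (f x))\<^sup>2)"
  by (simp add: L2_def)

lemma cmod_add_sq_le: "(cmod (a + b))\<^sup>2 \<le> 2 * (cmod a)\<^sup>2 + 2 * (cmod b)\<^sup>2"
proof -
  have "(cmod (a + b))\<^sup>2 \<le> (cmod a + cmod b)\<^sup>2"
    by (intro power_mono norm_triangle_ineq) auto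
  also have "\<dots> \<le> 2 * (cmod a)\<^sup>2 + 2 * (cmod b)\<^sup>2"
    using zero_le_power2[of "cmod a - cmod b"] by (simp add: power2_eq_square algebra_simps)
  finally show ?thesis .
qed

lemma L2_cmult: "L2 f \<Longrightarrow> L2 (\<lambda>x. c * f x)"
  unfolding L2_def by (auto simp: norm_mult power_mult_distrib)

lemma L2_bound:
  assumes "f \<in> borel_measurable borel" "integrable lborel g" "\<And>x. (cmod (f x))\<^sup>2 \<le> g x"
  shows "L2 f"
  unfolding L2_def
proof
  show "f \<in> borel_measurable lborel" using assms(1) by simp
  have [measurable]: "f \<in> borel_measurable borel" by fact
  show "integrable lborel (\<lambda>x. (cmod (f x))\<^sup>2)"
    by (rule Bochner_Integration.integrable_bound[OF assms(2)])
      (use assms(3) in \<open>auto intro: order_trans[OF _ abs_ge_self]\<close>)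
qed

lemma L2_add: "L2 f \<Longrightarrow> L2 g \<Longrightarrow> L2 (\<lambda>x. f x + g x)"
  by (rule L2_bound[where g="\<lambda>x. 2 * (cmod (f x))\<^sup>2 + 2 * (cmod (g x))\<^sup>2"])
    (auto simp: L2_def cmod_add_sq_le)

lemma L2_diff: "L2 f \<Longrightarrow> L2 g \<Longrightarrow> L2 (\<lambda>x. f x - g x)"
  using L2_add[of f "\<lambda>x. -1 * g x"] L2_cmult[of g "-1"] by simp

lemma L2_cnj: "L2 f \<Longrightarrow> L2 (\<lambda>x. cnj (f x))"
  unfolding L2_def by (auto intro: borel_measurable_continuous_on[of cnj] continuous_intros)

lemma L2_zero: "L2 (\<lambda>x. 0)"
  by (simp add: L2_def)

lemma L2_cong_AE: "L2 f \<Longrightarrow> AE x in lborel. f x = g x \<Longrightarrow> g \<in> borel_measurable borel \<Longrightarrow> L2 g"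
  unfolding L2_def by (auto intro: integrable_cong_AE_imp elim!: eventually_mono)

lemma L2_shift: "L2 f \<Longrightarrow> L2 (\<lambda>x. f (x + c))"
  unfolding L2_def
  using lborel_integrable_real_affine[of "\<lambda>x. (cmod (f x))\<^sup>2" 1 c] by (auto simp: add.commute)

lemma L2_mult_integrable:
  assumes "L2 f" "L2 g"
  shows "integrable lborel (\<lambda>x. f x * g x)"
proof (rule Bochner_Integration.integrable_bound)
  show "integrable lborel (\<lambda>x. (cmod (f x))\<^sup>2 + (cmod (g x))\<^sup>2)"
    using assms by (auto simp: L2_def)
  show "(\<lambda>x. f x * g x) \<in> borel_measurable lborel"
    using assms by (auto simp: L2_def)
  have "cmod a * cmod b \<le> (cmod a)\<^sup>2 + (cmod b)\<^sup>2" for a b :: complex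
    using sum_squares_bound[of "cmod a" "cmod b"] mult_nonneg_nonneg[OF norm_ge_zero norm_ge_zero, of a b] by linarith
  then show "AE x in lborel. norm (f x * g x) \<le> norm ((cmod (f x))\<^sup>2 + (cmod (g x))\<^sup>2)"
    by (auto simp: norm_mult)
qed

lemma L2_inner_integrable: "L2 f \<Longrightarrow> L2 g \<Longrightarrow> integrable lborel (\<lambda>x. f x * cnj (g x))"
  by (intro L2_mult_integrable L2_cnj)

lemma l2norm_sq: "(l2norm f)\<^sup>2 = (LINT x|lborel. (cmod (f x))\<^sup>2)"
  unfolding l2norm_def by (simp add: integral_nonneg_AE)

lemma l2norm_nonneg: "0 \<le> l2norm f"
  unfolding l2norm_def by (simp add: integral_nonneg_AE)

lemma l2norm_cong_AE:
  assumes "AE x in lborel. f x = g x" "f \<in> borel_measurable borel" "g \<in> borel_measurable borel"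
  shows "l2norm f = l2norm g"
  unfolding l2norm_def
  by (rule arg_cong[where f=sqrt], rule integral_cong_AE) (use assms in auto)

lemma l2norm_eq_zero:
  assumes "L2 f" "l2norm f = 0"
  shows "AE x in lborel. f x = 0"
proof -
  have "(LINT x|lborel. (cmod (f x))\<^sup>2) = 0" using l2norm_sq[of f] assms(2) by simp
  then have "AE x in lborel. (cmod (f x))\<^sup>2 = 0"
    using integral_nonneg_eq_0_iff_AE[OF L2_integrable[OF assms(1)]] by simp
  then show ?thesis by simp
qed

lemma l2inner_cong_AE:
  assumes "AE x in lborel. f x = f' x" "AE x in lborel. g x = g' x"
    "L2 f" "L2 f'" "L2 g" "L2 g'"
  shows "l2inner f g = l2inner f' g'"
  unfolding l2inner_def
  by (rule integral_cong_AE)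
    (use assms borel_measurable_integrable[OF L2_inner_integrable[of f g]] borel_measurable_integrable[OF L2_inner_integrable[of f' g']]
      in \<open>auto elim: eventually_elim2\<close>)

lemma l2inner_diff_left: "L2 f \<Longrightarrow> L2 g \<Longrightarrow> L2 h \<Longrightarrow> l2inner (\<lambda>x. f x - g x) h = l2inner f h - l2inner g h"
  unfolding l2inner_def using L2_inner_integrable[of f h] L2_inner_integrable[of g h]
  by (simp add: left_diff_distrib)

lemma l2inner_cmult_left: "l2inner (\<lambda>x. c * f x) h = c * l2inner f h"
  unfolding l2inner_def by (simp add: mult.assoc)

lemma l2inner_commute: "l2inner g f = cnj (l2inner f g)"
  unfolding l2inner_def Bochner_Integration.integral_cnj[symmetric] by (simp add: mult.commute)

lemma l2inner_diff_right: "L2 f \<Longrightarrow> L2 g \<Longrightarrow> L2 h \<Longrightarrow> l2inner h (\<lambda>x. f x - g x) = l2inner h f - l2inner h g"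
  by (metis complex_cnj_diff l2inner_commute l2inner_diff_left)

lemma l2inner_cmult_right: "l2inner h (\<lambda>x. c * f x) = cnj c * l2inner h f"
  by (metis complex_cnj_mult l2inner_commute l2inner_cmult_left)

lemma l2inner_self: "l2inner f f = of_real ((l2norm f)\<^sup>2)"
  unfolding l2norm_sq l2inner_def integral_complex_of_real[symmetric]
  by (simp only: complex_norm_square)

lemma l2norm_add_sq:
  assumes "L2 f" "L2 g"
  shows "(l2norm (\<lambda>x. f x + g x))\<^sup>2 = (l2norm f)\<^sup>2 + 2 * Re (l2inner f g) + (l2norm g)\<^sup>2"
proof -
  define R where "R x = Re (f x * cnj (g x))" for x
  have *: "(cmod (f x + g x))\<^sup>2 = (cmod (f x))\<^sup>2 + 2 * R x + (cmod (g x))\<^sup>2" for x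
    unfolding cmod_power2 R_def by (simp add: power2_eq_square algebra_simps)
  have R: "integrable lborel R" "(LINT x|lborel. R x) = Re (l2inner f g)"
    unfolding R_def l2inner_def using L2_inner_integrable[OF assms] by (rule integrable_Re, rule integral_Re)
  show ?thesis
    using R(1) L2_integrable[OF assms(1)] L2_integrable[OF assms(2)]
    unfolding l2norm_sq * R(2)[symmetric] by simp
qed

lemma l2_Cauchy_Schwarz:
  assumes "L2 f" "L2 g"
  shows "cmod (l2inner f g) \<le> l2norm f * l2norm g"
proof -
  have "cmod (l2inner f g) \<le> (LINT x|lborel. cmod (f x * cnj (g x)))"
    unfolding l2inner_def by (rule integral_norm_bound)
  also have "\<dots> = (LINT x|lborel. cmod (f x) * cmod (g x))" by (simp add: norm_mult)
  finally have 1: "cmod (l2inner f g) \<le> (LINT x|lborel. cmod (f x) * cmod (g x))" .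
  have i: "integrable lborel (\<lambda>x. cmod (f x) * cmod (g x))"
    using integrable_norm[OF L2_inner_integrable[OF assms]] by (simp add: norm_mult)
  have "ennreal ((LINT x|lborel. cmod (f x) * cmod (g x))\<^sup>2) = (\<integral>\<^sup>+x. ennreal (cmod (f x)) * ennreal (cmod (g x)) \<partial>lborel)\<^sup>2"
    using nn_integral_eq_integral[OF i] by (simp add: ennreal_mult' flip: ennreal_power)
  also have "\<dots> \<le> (\<integral>\<^sup>+x. (ennreal (cmod (f x)))\<^sup>2 \<partial>lborel) * (\<integral>\<^sup>+x. (ennreal (cmod (g x)))\<^sup>2 \<partial>lborel)"
    by (rule Cauchy_Schwarz_nn_integral) (use assms in \<open>auto simp: L2_def\<close>)
  also have "\<dots> = ennreal ((l2norm f)\<^sup>2) * ennreal ((l2norm g)\<^sup>2)"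
    unfolding l2norm_sq
    using nn_integral_eq_integral[OF L2_integrable[OF assms(1)]] nn_integral_eq_integral[OF L2_integrable[OF assms(2)]]
    by (simp add: ennreal_power)
  also have "\<dots> = ennreal ((l2norm f * l2norm g)\<^sup>2)"
    by (simp add: ennreal_mult' power_mult_distrib)
  finally have "(LINT x|lborel. cmod (f x) * cmod (g x))\<^sup>2 \<le> (l2norm f * l2norm g)\<^sup>2"
    by (simp add: ennreal_le_iff)
  then have "(LINT x|lborel. cmod (f x) * cmod (g x)) \<le> l2norm f * l2norm g"
    by (rule power2_le_imp_le) (simp add: l2norm_nonneg)
  with 1 show ?thesis by simp
qed

lemma l2inner_tendsto:
  assumes "\<And>n. L2 (fs n)" "L2 f" "L2 h" "(\<lambda>n. l2norm (\<lambda>x. fs n x - f x)) \<longlonglongrightarrow> 0"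
  shows "(\<lambda>n. l2inner (fs n) h) \<longlonglongrightarrow> l2inner f h"
proof (rule LIM_zero_cancel, rule Lim_null_comparison)
  show "\<forall>\<^sub>F n in sequentially. norm (l2inner (fs n) h - l2inner f h) \<le> l2norm (\<lambda>x. fs n x - f x) * l2norm h"
    using l2_Cauchy_Schwarz[OF L2_diff[OF assms(1,2)] assms(3)] l2inner_diff_left[OF assms(1,2,3)] by simp
  show "(\<lambda>n. l2norm (\<lambda>x. fs n x - f x) * l2norm h) \<longlonglongrightarrow> 0"
    using tendsto_mult_right[OF assms(4), of "l2norm h"] by simp
qed

section \<open>Completeness and a criterion for density\<close>

lemma AE_summable_of_summable_integral:
  fixes h :: "nat \<Rightarrow> real \<Rightarrow> real"
  assumes h: "\<And>n. integrable lborel (h n)" "\<And>n x. 0 \<le> h n x"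
    and s: "summable (\<lambda>n. LINT x|lborel. h n x)"
  shows "AE x in lborel. summable (\<lambda>n. h n x)"
proof -
  have [measurable]: "h n \<in> borel_measurable borel" for n using h(1)[of n] by auto
  have "(\<integral>\<^sup>+x. (\<Sum>n. ennreal (h n x)) \<partial>lborel) = (\<Sum>n. \<integral>\<^sup>+x. ennreal (h n x) \<partial>lborel)"
    by (rule nn_integral_suminf) auto
  also have "\<dots> = (\<Sum>n. ennreal (LINT x|lborel. h n x))"
    using h by (intro suminf_cong nn_integral_eq_integral) auto
  also have "\<dots> \<noteq> \<infinity>"
    by (subst suminf_ennreal2[OF _ s]) (use h(2) in \<open>simp_all add: integral_nonneg_AE\<close>)
  finally have "AE x in lborel. (\<Sum>n. ennreal (h n x)) \<noteq> \<infinity>"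
    by (intro nn_integral_PInf_AE) auto
  then show ?thesis
  proof eventually_elim
    case (elim x)
    then show ?case using summable_suminf_not_top[of "\<lambda>n. h n x"] h(2) by simp
  qed
qed

text \<open>Riesz--Fischer: \<open>2\<bar>s\<^sub>n\<^sub>+\<^sub>1 - s\<^sub>n\<bar> \<le> 2\<^sup>-\<^sup>n + 2\<^sup>n\<bar>s\<^sub>n\<^sub>+\<^sub>1 - s\<^sub>n\<bar>\<^sup>2\<close> reduces almost everywhere convergence of a rapidly
  Cauchy sequence to convergence of a series of integrals.\<close>
lemma L2_rapidly_Cauchy_limit:
  fixes s :: "nat \<Rightarrow> real \<Rightarrow> complex"
  assumes s: "\<And>n. L2 (s n)"
    and C: "\<And>m n. (l2norm (\<lambda>x. s m x - s n x))\<^sup>2 \<le> K * ((1/8)^m + (1/8)^n)"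
  obtains p where "L2 p" "(\<lambda>n. l2norm (\<lambda>x. s n x - p x)) \<longlonglongrightarrow> 0"
proof -
  define d where "d n x = s (Suc n) x - s n x" for n x
  \<comment> \<open>Squared distances decay like \<open>8^-n\<close>, so the weight
    \<open>2^n\<close> still leaves integrals of order \<open>4^-n\<close>.\<close>
  define h where "h n x = 2^n * (cmod (d n x))\<^sup>2" for n x
  have sm[measurable]: "s n \<in> borel_measurable borel" for n using s L2_measurable by auto
  have d: "L2 (d n)" for n unfolding d_def by (intro L2_diff s)
  have hi: "integrable lborel (h n)" for n
    unfolding h_def using L2_integrable[OF d[of n]] by simp
  have K0: "0 \<le> K" using C[of 0 0] by (simp add: l2norm_def)
  have hI: "(LINT x|lborel. h n x) \<le> 2 * K * (1/4)^n" for n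
  proof -
    have "(LINT x|lborel. h n x) = 2^n * (l2norm (d n))\<^sup>2" unfolding h_def l2norm_sq by simp
    also have "\<dots> \<le> 2^n * (K * ((1/8)^Suc n + (1/8)^n))"
      using C[of "Suc n" n] unfolding d_def by (intro mult_left_mono) auto
    also have "\<dots> \<le> 2^n * (K * (2 * (1/8)^n))"
      using K0 by (intro mult_left_mono) auto
    also have "\<dots> = 2 * K * (2^n * (1/8)^n)" by simp
    also have "2^n * (1/8)^n = (1/4::real)^n" by (subst power_mult_distrib[symmetric]) simp
    finally show ?thesis .
  qed
  have "summable (\<lambda>n. 2 * K * (1/4)^n)" by (intro summable_mult summable_geometric) simp
  then have "summable (\<lambda>n. LINT x|lborel. h n x)"
    by (rule summable_comparison_test'[where N=0]) (use hI in \<open>auto simp: h_def integral_nonneg_AE\<close>)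
  then have "AE x in lborel. summable (\<lambda>n. h n x)"
    by (intro AE_summable_of_summable_integral hi) (auto simp: h_def)
  then have conv: "AE x in lborel. convergent (\<lambda>n. s n x)"
  proof eventually_elim
    case (elim x)
    have sg: "summable (\<lambda>n. (1/2::real)^n)" by (intro summable_geometric) simp
    have "cmod (d n x) \<le> (1/2)^n + h n x" for n
    proof -
      have "(2^n * cmod (d n x))\<^sup>2 = 2^n * h n x" by (simp add: h_def power2_eq_square)
      moreover have "0 \<le> 2^n * cmod (d n x)" by simp
      ultimately have "2^n * cmod (d n x) \<le> 2^n * h n x + 1"
        using sum_squares_bound[of "2^n * cmod (d n x)" 1] unfolding mult_1_right power_one by linarith
      also have "\<dots> = 2^n * ((1/2)^n + h n x)" by (simp add: distrib_left power_divide)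
      finally show ?thesis by simp
    qed
    then have "summable (\<lambda>n. d n x)"
      using summable_comparison_test'[OF summable_add[OF sg elim], of 0 "\<lambda>n. d n x"] by auto
    then have "convergent (\<lambda>n. \<Sum>i<n. d i x)" by (simp add: summable_iff_convergent)
    moreover have "(\<Sum>i<n. d i x) = s n x - s 0 x" for n
      unfolding d_def by (rule sum_lessThan_telescope)
    ultimately have "convergent (\<lambda>n. s n x - s 0 x + s 0 x)"
      by (intro convergent_add convergent_const) simp
    then show ?case by simp
  qed
  define p where "p x = lim (\<lambda>n. s n x)" for x
  have pm[measurable]: "p \<in> borel_measurable borel"
    unfolding p_def by (rule borel_measurable_lim_metric) simp
  have lim: "AE x in lborel. (\<lambda>n. s n x) \<longlonglongrightarrow> p x"
    using conv by eventually_elim (simp add: p_def convergent_LIMSEQ_iff)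
  \<comment> \<open>Fatou's lemma in the second index: the almost everywhere limit inherits the
    bound for \<open>s n - s m\<close> as \<open>m\<close> tends to infinity.\<close>
  have fatou: "(\<integral>\<^sup>+x. ennreal ((cmod (s n x - p x))\<^sup>2) \<partial>lborel) \<le> ennreal (2 * K * (1/8)^n)" for n
  proof -
    let ?e = "\<lambda>m x. ennreal ((cmod (s n x - s m x))\<^sup>2)" and ?p = "\<lambda>x. ennreal ((cmod (s n x - p x))\<^sup>2)"
    have "(\<integral>\<^sup>+x. ?p x \<partial>lborel)
        = (\<integral>\<^sup>+x. liminf (\<lambda>m. ?e m x) \<partial>lborel)"
    proof (rule nn_integral_cong_AE)
      show "AE x in lborel. ?p x = liminf (\<lambda>m. ?e m x)"
        using lim
      proof eventually_elim
        case (elim x)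
        have "(\<lambda>m. ?e m x) \<longlonglongrightarrow> ?p x"
          by (intro tendsto_intros elim)
        then show ?case by (rule lim_imp_Liminf[OF sequentially_bot, symmetric])
      qed
    qed
    also have "\<dots> \<le> liminf (\<lambda>m. \<integral>\<^sup>+x. ?e m x \<partial>lborel)"
      by (rule nn_integral_liminf) auto
    also have "\<dots> \<le> liminf (\<lambda>m. ennreal (2 * K * (1/8)^n))"
    proof (rule Liminf_mono, rule eventually_sequentiallyI[of n])
      fix m assume "n \<le> m"
      then have "(1/8::real)^m \<le> (1/8)^n" by (intro power_decreasing) auto
      then have "K * ((1/8)^n + (1/8)^m) \<le> K * (2 * (1/8)^n)" using K0 by (intro mult_left_mono) auto
      then have "(l2norm (\<lambda>x. s n x - s m x))\<^sup>2 \<le> 2 * K * (1/8)^n" using C[of n m] by simp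
      then show "(\<integral>\<^sup>+x. ?e m x \<partial>lborel) \<le> ennreal (2 * K * (1/8)^n)"
        using nn_integral_eq_integral[OF L2_integrable[OF L2_diff[OF s s]], of n m]
        by (simp add: l2norm_sq ennreal_leI)
    qed
    also have "\<dots> = ennreal (2 * K * (1/8)^n)" by (simp add: Liminf_const)
    finally show ?thesis .
  qed
  have dp: "L2 (\<lambda>x. s n x - p x)" for n
    unfolding L2_def
  proof
    show "integrable lborel (\<lambda>x. (cmod (s n x - p x))\<^sup>2)"
    proof (rule integrableI_bounded)
      show "(\<integral>\<^sup>+x. ennreal (norm ((cmod (s n x - p x))\<^sup>2)) \<partial>lborel) < \<infinity>"
        using order.strict_trans1[OF fatou[of n]] by simp
    qed auto
  qed simp
  have p: "L2 p" using L2_diff[OF s[of 0] dp[of 0]] by simp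
  have "(l2norm (\<lambda>x. s n x - p x))\<^sup>2 \<le> 2 * K * (1/8)^n" for n
    using fatou[of n] nn_integral_eq_integral[OF L2_integrable[OF dp[of n]]] K0
    unfolding l2norm_sq by (simp add: ennreal_le_iff)
  moreover have "(\<lambda>n. 2 * K * (1/8)^n) \<longlonglongrightarrow> 0"
    by (intro tendsto_mult_right_zero LIMSEQ_realpow_zero) auto
  ultimately have "(\<lambda>n. (l2norm (\<lambda>x. s n x - p x))\<^sup>2) \<longlonglongrightarrow> 0"
    by (intro Lim_null_comparison[of "\<lambda>n. (l2norm (\<lambda>x. s n x - p x))\<^sup>2"]) auto
  then have "(\<lambda>n. sqrt ((l2norm (\<lambda>x. s n x - p x))\<^sup>2)) \<longlonglongrightarrow> sqrt 0" by (rule tendsto_real_sqrt)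
  then have "(\<lambda>n. l2norm (\<lambda>x. s n x - p x)) \<longlonglongrightarrow> 0" by (simp add: l2norm_nonneg)
  with p show ?thesis by (rule that)
qed

lemma l2norm_cmult: "l2norm (\<lambda>x. c * f x) = cmod c * l2norm f"
  unfolding l2norm_def by (simp add: norm_mult power_mult_distrib real_sqrt_mult)

lemma l2norm_parallelogram:
  assumes "L2 f" "L2 g"
  shows "(l2norm (\<lambda>x. f x + g x))\<^sup>2 + (l2norm (\<lambda>x. f x - g x))\<^sup>2 = 2 * (l2norm f)\<^sup>2 + 2 * (l2norm g)\<^sup>2"
  using l2norm_add_sq[OF assms] l2norm_add_sq[OF assms(1) L2_cmult[OF assms(2), of "-1"]]
  by (simp add: l2inner_cmult_right l2norm_cmult l2norm_cmult[of "-1", simplified] l2inner_cmult_right[of _ "-1", simplified])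

text \<open>The projection theorem for a subspace that need not be closed: a minimising sequence for
  the distance to \<open>f\<close> converges in L2, the residual of its limit is orthogonal to
  \<open>S\<close>, and so the residual vanishes.\<close>

lemma l2_dense_of_trivial_orthogonal:
  assumes L2: "\<And>s. s \<in> S \<Longrightarrow> L2 s" and ne: "S \<noteq> {}"
    and add: "\<And>s t. s \<in> S \<Longrightarrow> t \<in> S \<Longrightarrow> (\<lambda>x. s x + t x) \<in> S"
    and cmult: "\<And>c s. s \<in> S \<Longrightarrow> (\<lambda>x. c * s x) \<in> S"
    and orth: "\<And>g. L2 g \<Longrightarrow> (\<And>s. s \<in> S \<Longrightarrow> l2inner s g = 0) \<Longrightarrow> AE x in lborel. g x = 0"
    and f: "L2 f" and "0 < e"
  shows "\<exists>s\<in>S. l2norm (\<lambda>x. s x - f x) < e"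
proof -
   let ?d = "\<lambda>s x. s x - f x"
 define D where "D s = (l2norm (\<lambda>x. s x - f x))\<^sup>2" for s
  define d where "d = Inf (D ` S)"
  have bdd: "bdd_below (D ` S)" by (rule bdd_belowI[of _ 0]) (auto simp: D_def)
  have dle: "d \<le> D s" if "s \<in> S" for s
    unfolding d_def by (rule cInf_lower) (use that bdd in auto)
  have "\<exists>s\<in>S. D s < d + (1/8)^n" for n :: nat
    using cInf_lessD[of "D ` S" "d + (1/8)^n"] ne unfolding d_def by auto
  \<comment> \<open>The rate \<open>8^-n\<close> is the one that the completeness lemma asks
    for.\<close>
  then obtain s where s: "\<And>n. s n \<in> S" "\<And>n. D (s n) < d + (1/8)^n" by metis
  note L2s = L2[OF s(1)]
  \<comment> \<open>Parallelogram law applied to \<open>a - f\<close> and \<open>b - f\<close>; the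
    midpoint of \<open>a\<close> and \<open>b\<close> lies in \<open>S\<close>, so its squared
    distance to \<open>f\<close> is at least \<open>d\<close>.\<close>
  have par: "(l2norm (\<lambda>x. a x - b x))\<^sup>2 \<le> 2 * (D a - d) + 2 * (D b - d)" if "a \<in> S" "b \<in> S" for a b
  proof -
    have m: "(\<lambda>x. (1/2) * (a x + b x)) \<in> S" by (intro cmult add that)
    have *: "(\<lambda>x. (a x - f x) + (b x - f x)) = (\<lambda>x. 2 * ((1/2) * (a x + b x) - f x))" by (auto simp: field_simps)
    have "(l2norm (\<lambda>x. (a x - f x) + (b x - f x)))\<^sup>2 = 4 * D (\<lambda>x. (1/2) * (a x + b x))"
      unfolding * l2norm_cmult D_def by (simp add: power_mult_distrib)
    moreover have "(\<lambda>x. (a x - f x) - (b x - f x)) = (\<lambda>x. a x - b x)" by auto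
    ultimately show ?thesis
      using l2norm_parallelogram[OF L2_diff[OF L2 f] L2_diff[OF L2 f], OF that] dle[OF m]
      unfolding D_def by simp
  qed
  have "(l2norm (\<lambda>x. s m x - s n x))\<^sup>2 \<le> 2 * ((1/8)^m + (1/8)^n)" for m n
    using par[OF s(1) s(1), of m n] s(2)[of m] s(2)[of n] unfolding distrib_left by (smt (verit))
  then obtain p where p: "L2 p" "(\<lambda>n. l2norm (\<lambda>x. s n x - p x)) \<longlonglongrightarrow> 0"
    using L2_rapidly_Cauchy_limit[of s 2] L2s by auto
  have orthp: "l2inner t (?d p) = 0" if t: "t \<in> S" for t
  proof -
    \<comment> \<open>Adding 1 to the squared norm keeps the divisor positive even if
      \<open>t\<close> vanishes almost everywhere.\<close>
    define N where "N = (l2norm t)\<^sup>2 + 1"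
    have N: "1 \<le> N" "(l2norm t)\<^sup>2 \<le> N" by (simp_all add: N_def)
    have bound: "(cmod (l2inner (?d (s n)) t))\<^sup>2 \<le> N * (1/8)^n" for n
    proof -
      let ?c = "l2inner (?d (s n)) t"
      \<comment> \<open>This is the best coefficient for correcting \<open>s n\<close> along
        \<open>t\<close>, with the squared norm of \<open>t\<close> replaced by \<open>N\<close>.
        The correction still lowers the squared distance by at least \<open>(cmod ?c)^2 / N\<close>,
        which cannot exceed the slack \<open>8^-n\<close>.\<close>
      let ?k = "- of_real (1 / N) * ?c"
      have "(\<lambda>x. s n x + ?k * t x) \<in> S" by (intro add cmult s t)
      from dle[OF this] have "d \<le> (l2norm (\<lambda>x. (s n x - f x) + ?k * t x))\<^sup>2"
        unfolding D_def by (simp add: algebra_simps)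
      also have "\<dots> = D (s n) + 2 * Re (l2inner (?d (s n)) (\<lambda>x. ?k * t x)) + (cmod ?k * l2norm t)\<^sup>2"
        unfolding D_def l2norm_cmult[symmetric] by (rule l2norm_add_sq) (intro L2_diff L2s f L2_cmult L2 t)+
      also have "l2inner (?d (s n)) (\<lambda>x. ?k * t x) = cnj ?k * ?c" by (rule l2inner_cmult_right)
      also have "cnj ?k * ?c = of_real (- ((cmod ?c)\<^sup>2 / N))"
        using complex_norm_square[of ?c] by (simp add: mult.commute)
      also have "Re (of_real (- ((cmod ?c)\<^sup>2 / N))) = - ((cmod ?c)\<^sup>2 / N)" by simp
      also have "(cmod ?k * l2norm t)\<^sup>2 = (cmod ?c)\<^sup>2 / N * ((l2norm t)\<^sup>2 / N)"
        using N by (simp add: norm_mult norm_divide power_mult_distrib power_divide power2_eq_square)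
      also have "\<dots> \<le> (cmod ?c)\<^sup>2 / N * 1"
        using N by (intro mult_left_mono) (auto simp: divide_le_eq)
      finally have "(cmod ?c)\<^sup>2 / N \<le> (1/8)^n" using s(2)[of n] by simp
      then show ?thesis using N by (simp add: divide_le_eq mult.commute)
    qed
    have "(\<lambda>n. N * (1/8)^n) \<longlonglongrightarrow> 0"
      by (intro tendsto_mult_right_zero LIMSEQ_realpow_zero) auto
    then have "(\<lambda>n. (cmod (l2inner (?d (s n)) t))\<^sup>2) \<longlonglongrightarrow> 0"
      by (rule Lim_null_comparison[rotated]) (use bound in auto)
    then have "(\<lambda>n. sqrt ((cmod (l2inner (?d (s n)) t))\<^sup>2)) \<longlonglongrightarrow> sqrt 0" by (rule tendsto_real_sqrt)
    then have "(\<lambda>n. l2inner (?d (s n)) t) \<longlonglongrightarrow> 0" by (simp add: tendsto_norm_zero_iff)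
    moreover have "(\<lambda>n. l2inner (?d (s n)) t) \<longlonglongrightarrow> l2inner (?d p) t"
      by (rule l2inner_tendsto[OF L2_diff[OF L2s f] L2_diff[OF p(1) f] L2[OF t]]) (use p(2) in simp)
    ultimately have "l2inner (?d p) t = 0" by (rule LIMSEQ_unique[rotated])
    then show ?thesis using l2inner_commute[of t "?d p"] by simp
  qed
  have pf: "AE x in lborel. p x - f x = 0"
    by (rule orth[OF L2_diff[OF p(1) f] orthp])
  have "l2norm (\<lambda>x. s n x - p x) = l2norm (?d (s n))" for n
    by (rule l2norm_cong_AE)
      (use pf L2_measurable[OF L2s[of n]] L2_measurable[OF p(1)] L2_measurable[OF f] in \<open>auto elim: eventually_mono\<close>)
  with p(2) have "(\<lambda>n. l2norm (?d (s n))) \<longlonglongrightarrow> 0" by simp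
  from order_tendstoD(2)[OF this \<open>0 < e\<close>] obtain n where "l2norm (?d (s n)) < e"
    by (auto simp: eventually_sequentially)
  then show ?thesis using s(1) by blast
qed

section \<open>Linear systems with locally integrable coefficients\<close>

definition primitive :: "(real \<Rightarrow> 'a::{real_normed_field,euclidean_space}) \<Rightarrow> real \<Rightarrow> 'a" where
  "primitive g x = (if 0 \<le> x then LINT t:{0..x}|lborel. g t else - (LINT t:{x..0}|lborel. g t))"

lemma primitive_0 [simp]: "primitive g 0 = 0"
proof -
  have "(LINT t:{0..0}|lborel. g t) = 0"
    unfolding set_lebesgue_integral_def
    by (rule integral_eq_zero_AE) (use AE_lborel_singleton[of "0::real"] in eventually_elim, auto)
  then show ?thesis by (simp add: primitive_def)
qed

lemma set_integral_Icc_combine: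
  fixes g :: "real \<Rightarrow> 'a::euclidean_space"
  assumes "\<And>a b. set_integrable lborel {a..b} g" "a \<le> c" "c \<le> b"
  shows "(LINT x:{a..b}|lborel. g x) = (LINT x:{a..c}|lborel. g x) + (LINT x:{c..b}|lborel. g x)"
  using Henstock_Kurzweil_Integration.integral_combine[OF assms(2,3) set_borel_integral_eq_integral(1)[OF assms(1)]]
  unfolding set_borel_integral_eq_integral(2)[OF assms(1)] by simp

lemma ac_deriv_primitive:
  assumes "g \<in> borel_measurable borel" and i: "\<And>a b. set_integrable lborel {a..b} g"
  shows "ac_deriv (primitive g) g"
proof (rule ac_derivI)
  fix a b :: real assume ab: "a \<le> b"
  show "primitive g b - primitive g a = (LINT x:{a..b}|lborel. g x)"
    using set_integral_Icc_combine[OF i, of 0 a b] set_integral_Icc_combine[OF i, of a 0 b]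
      set_integral_Icc_combine[OF i, of a b 0] ab
    by (auto simp: primitive_def algebra_simps)
qed (use assms in auto)

lemma norm_primitive: "norm (primitive g x) = norm (LINT t:{min 0 x..max 0 x}|lborel. g t)"
  by (auto simp: primitive_def min_def max_def)

section \<open>Picard iteration with factorial bounds\<close>

lemma ac_deriv_power:
  assumes "ac_deriv f f'"
  shows "ac_deriv (\<lambda>x. f x ^ Suc n) (\<lambda>x. of_nat (Suc n) * (f' x * f x ^ n))"
proof (induction n)
  case (Suc n)
  have eq: "f' x * f x ^ Suc n + f x * (of_nat (Suc n) * (f' x * f x ^ n)) = of_nat (Suc (Suc n)) * (f' x * f x ^ Suc n)" for x
    by (simp add: algebra_simps)
  from ac_deriv_mult[OF assms Suc] show ?case unfolding eq by simp
qed (use assms in simp)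

text \<open>Substitution rule: on each side of 0 the integrand is, up to sign, the derivative of a
  power of the primitive divided by \<open>Suc n\<close>. It supplies the factorials in the Picard
  estimate when the coefficients are merely integrable.\<close>

lemma integral_primitive_power:
  fixes g :: "real \<Rightarrow> real"
  assumes "g \<in> borel_measurable borel" and i: "\<And>a b. set_integrable lborel {a..b} g" and g0: "\<And>x. 0 \<le> g x"
  shows "(LINT t:{min 0 x..max 0 x}|lborel. g t * \<bar>primitive g t\<bar> ^ n) = \<bar>primitive g x\<bar> ^ Suc n / real (Suc n)"
proof -
  let ?a = "primitive g"
  have a: "ac_deriv ?a g" by (rule ac_deriv_primitive) (use assms in auto)
  have pos: "0 \<le> ?a t" if "0 \<le> t" for t
    using that by (auto simp: primitive_def set_lebesgue_integral_def intro!: integral_nonneg_AE AE_I2 g0 mult_nonneg_nonneg)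
  have neg: "?a t \<le> 0" if "t \<le> 0" for t
  proof (cases "t = 0")
    case False
    then show ?thesis using that by (auto simp: primitive_def set_lebesgue_integral_def intro!: integral_nonneg_AE AE_I2 g0 mult_nonneg_nonneg)
  qed simp
  show ?thesis
  proof (cases "0 \<le> x")
    case True
    have "(LINT t:{0..x}|lborel. real (Suc n) * (g t * \<bar>?a t\<bar> ^ n)) = (LINT t:{0..x}|lborel. real (Suc n) * (g t * ?a t ^ n))"
      by (rule set_lebesgue_integral_cong) (auto simp: pos)
    also have "\<dots> = ?a x ^ Suc n"
      using ac_deriv_integral[OF ac_deriv_power[OF a, of n] True] by simp
    finally have "real (Suc n) * (LINT t:{0..x}|lborel. g t * \<bar>?a t\<bar> ^ n) = ?a x ^ Suc n"
      by simp
    then show ?thesis using True pos[OF True] by (simp add: min_def max_def field_simps del: of_nat_Suc)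
  next
    case False
    then have x: "x \<le> 0" by simp
    have b: "ac_deriv (\<lambda>t. - ?a t) (\<lambda>t. - g t)" using ac_deriv_cmult[OF a, of "-1"] by simp
    have "(LINT t:{x..0}|lborel. real (Suc n) * (g t * \<bar>?a t\<bar> ^ n)) = (LINT t:{x..0}|lborel. - (real (Suc n) * (- g t * (- ?a t) ^ n)))"
      by (rule set_lebesgue_integral_cong) (auto simp: neg)
    also have "\<dots> = (- ?a x) ^ Suc n"
      using ac_deriv_integral[OF ac_deriv_cmult[OF ac_deriv_power[OF b, of n], of "-1"] x] by simp
    finally have "real (Suc n) * (LINT t:{x..0}|lborel. g t * \<bar>?a t\<bar> ^ n) = (- ?a x) ^ Suc n"
      by simp
    then show ?thesis using x False neg[OF x] by (simp add: min_def max_def field_simps del: of_nat_Suc)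
  qed
qed

context
  fixes p q r s :: "real \<Rightarrow> complex" and y0 u0 :: complex
  assumes meas[measurable]: "p \<in> borel_measurable borel" "q \<in> borel_measurable borel"
      "r \<in> borel_measurable borel" "s \<in> borel_measurable borel"
    and int: "\<And>a b. set_integrable lborel {a..b} p" "\<And>a b. set_integrable lborel {a..b} q"
      "\<And>a b. set_integrable lborel {a..b} r" "\<And>a b. set_integrable lborel {a..b} s"
begin

text \<open>These are the increments of the Picard iteration, not the iterates; the solution is
  their sum.\<close>

fun picard_term :: "nat \<Rightarrow> (real \<Rightarrow> complex) \<times> (real \<Rightarrow> complex)" where
  "picard_term 0 = ((\<lambda>x. y0), (\<lambda>x. u0))"
| "picard_term (Suc n) =
    (primitive (\<lambda>x. p x * fst (picard_term n) x + q x * snd (picard_term n) x),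
     primitive (\<lambda>x. r x * fst (picard_term n) x + s x * snd (picard_term n) x))"

private abbreviation "rhs1 n \<equiv> \<lambda>x. p x * fst (picard_term n) x + q x * snd (picard_term n) x"
private abbreviation "rhs2 n \<equiv> \<lambda>x. r x * fst (picard_term n) x + s x * snd (picard_term n) x"

private definition coeff_size :: "real \<Rightarrow> real" where
  "coeff_size x = cmod (p x) + cmod (q x) + cmod (r x) + cmod (s x)"

private lemma coeff_size:
  "coeff_size \<in> borel_measurable borel" "0 \<le> coeff_size x" "set_integrable lborel {a..b} coeff_size"
  unfolding coeff_size_def using set_integrable_norm[OF int(1)] set_integrable_norm[OF int(2)]
    set_integrable_norm[OF int(3)] set_integrable_norm[OF int(4)] by auto

private lemma picard_step_bound:
  "cmod (p x * y + q x * u) + cmod (r x * y + s x * u) \<le> coeff_size x * (cmod y + cmod u)"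
proof -
  have "cmod (p x * y + q x * u) \<le> cmod (p x) * cmod y + cmod (q x) * cmod u"
    "cmod (r x * y + s x * u) \<le> cmod (r x) * cmod y + cmod (s x) * cmod u"
    using norm_triangle_ineq[of "p x * y" "q x * u"] norm_triangle_ineq[of "r x * y" "s x * u"] by (simp_all add: norm_mult)
  moreover have "0 \<le> cmod (p x) * cmod u" "0 \<le> cmod (q x) * cmod y" "0 \<le> cmod (r x) * cmod u" "0 \<le> cmod (s x) * cmod y" by auto
  ultimately show ?thesis unfolding coeff_size_def distrib_left distrib_right by linarith
qed

private lemma picard_term_continuous:
  "continuous_on UNIV (fst (picard_term n)) \<and> continuous_on UNIV (snd (picard_term n))"
  (is "?C n")
  and picard_term_integrable:
  "set_integrable lborel {a..b} (rhs1 n) \<and>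
   set_integrable lborel {a..b} (rhs2 n)"
  and picard_term_measurable:
  "(rhs1 n) \<in> borel_measurable borel \<and>
   (rhs2 n) \<in> borel_measurable borel"
proof -
  have *: "(\<forall>a b. set_integrable lborel {a..b} (rhs1 n) \<and>
   set_integrable lborel {a..b} (rhs2 n)) \<and>
   (rhs1 n) \<in> borel_measurable borel \<and>
   (rhs2 n) \<in> borel_measurable borel"
    if c: "continuous_on UNIV (fst (picard_term n))" "continuous_on UNIV (snd (picard_term n))" for n
  proof -
    have [measurable]: "fst (picard_term n) \<in> borel_measurable borel" "snd (picard_term n) \<in> borel_measurable borel"
      using c by (auto intro: borel_measurable_continuous_onI)
    have i: "set_integrable lborel {a..b} (\<lambda>x. h x * g x)"
      if "continuous_on UNIV g" "set_integrable lborel {a..b} h" for a b and g h :: "real \<Rightarrow> complex"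
      using set_integrable_mult_continuous[OF continuous_on_subset[OF that(1)] borel_measurable_continuous_onI[OF that(1)] that(2)]
      by (simp add: mult.commute)
    show ?thesis
      using i[OF c(1) int(1)] i[OF c(2) int(2)] i[OF c(1) int(3)] i[OF c(2) int(4)] by (auto intro: set_integral_add)
  qed
  have C: "?C n" for n
  proof (induction n)
    case (Suc n)
    with *[of n] show ?case
      by (auto intro!: ac_deriv_continuous[OF ac_deriv_primitive])
  qed (auto intro: continuous_intros)
  then show "?C n" .
  show "set_integrable lborel {a..b} (rhs1 n) \<and>
   set_integrable lborel {a..b} (rhs2 n)"
    using C[of n] *[of n] by auto
  show "(rhs1 n) \<in> borel_measurable borel \<and>
   (rhs2 n) \<in> borel_measurable borel"
    using C[of n] *[of n] by auto
qed

private lemma set_integrable_coeff_size_power: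
  "set_integrable lborel {a..b} (\<lambda>t. coeff_size t * \<bar>primitive coeff_size t\<bar> ^ n)"
proof -
  have c: "continuous_on UNIV (\<lambda>t. \<bar>primitive coeff_size t\<bar> ^ n)"
    by (intro continuous_intros ac_deriv_continuous[OF ac_deriv_primitive]) (use coeff_size in auto)
  show ?thesis
    using set_integrable_mult_continuous[OF continuous_on_subset[OF c] borel_measurable_continuous_onI[OF c] coeff_size(3)]
    by (simp add: mult.commute)
qed

text \<open>The usual bound \<open>K |x|^n / n!\<close> with \<open>x\<close> replaced by the
  primitive of the coefficient size, so that unbounded coefficients do no harm.\<close>

private lemma picard_term_bound:
  "cmod (fst (picard_term n) x) + cmod (snd (picard_term n) x)
    \<le> (cmod y0 + cmod u0) * (\<bar>primitive coeff_size x\<bar> ^ n / fact n)"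
proof (induction n arbitrary: x)
  case (Suc n)
  let ?I = "{min 0 x..max 0 x}" and ?K = "cmod y0 + cmod u0"
  have i: "set_integrable lborel ?I (rhs1 n)" "set_integrable lborel ?I (rhs2 n)" using picard_term_integrable by auto
  have "cmod (primitive (rhs1 n) x) + cmod (primitive (rhs2 n) x) \<le> (LINT t:?I|lborel. cmod (rhs1 n t)) + (LINT t:?I|lborel. cmod (rhs2 n t))"
    unfolding norm_primitive by (intro add_mono set_integral_norm_bound i)
  also have "\<dots> = (LINT t:?I|lborel. cmod (rhs1 n t) + cmod (rhs2 n t))"
    by (rule set_integral_add(2)[symmetric]) (intro set_integrable_norm i)+
  also have "\<dots> \<le> (LINT t:?I|lborel. ?K / fact n * (coeff_size t * \<bar>primitive coeff_size t\<bar> ^ n))"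
  proof (rule set_integral_mono)
    fix t
    have "cmod (rhs1 n t) + cmod (rhs2 n t) \<le> coeff_size t * (cmod (fst (picard_term n) t) + cmod (snd (picard_term n) t))"
      by (rule picard_step_bound)
    also have "\<dots> \<le> coeff_size t * (?K * (\<bar>primitive coeff_size t\<bar> ^ n / fact n))"
      by (intro mult_left_mono Suc coeff_size)
    finally show "cmod (rhs1 n t) + cmod (rhs2 n t) \<le> ?K / fact n * (coeff_size t * \<bar>primitive coeff_size t\<bar> ^ n)"
      by (simp add: field_simps)
  qed (use i in \<open>auto intro!: set_integral_add set_integrable_norm set_integrable_coeff_size_power\<close>)
  also have "\<dots> = ?K / fact n * (\<bar>primitive coeff_size x\<bar> ^ Suc n / real (Suc n))"
    using integral_primitive_power[OF coeff_size(1,3,2), of x n] by simp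
  finally show ?case by (simp add: mult.commute)
qed simp

lemma linear_system_solution_exists:
  obtains y u where "ac_deriv y (\<lambda>x. p x * y x + q x * u x)" "ac_deriv u (\<lambda>x. r x * y x + s x * u x)"
    "y 0 = y0" "u 0 = u0"
proof -
  define Y U where "Y n = fst (picard_term n)" and "U n = snd (picard_term n)" for n
  define y where "y x = (\<Sum>n. Y n x)" for x
  define u where "u x = (\<Sum>n. U n x)" for x
  let ?K = "cmod y0 + cmod u0" and ?A = "primitive coeff_size"
  have bound: "cmod (Y n x) + cmod (U n x) \<le> ?K * (\<bar>?A x\<bar> ^ n / fact n)" for n x
    unfolding Y_def U_def by (rule picard_term_bound)
  have expsum: "summable (\<lambda>n. K * (z ^ n / fact n))" for K z :: real
    using summable_exp[of z] by (intro summable_mult) (simp add: divide_inverse mult.commute)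
  have sY: "summable (\<lambda>n. Y n x)" and sU: "summable (\<lambda>n. U n x)" for x
    by (rule summable_comparison_test'[OF expsum[of ?K "\<bar>?A x\<bar>"], of 0],
      use bound[of _ x] in \<open>smt (verit) norm_ge_zero\<close>)+
  have ymeas: "continuous_on UNIV (Y n)" "continuous_on UNIV (U n)" for n
    unfolding Y_def U_def using picard_term_continuous by auto
  have [measurable]: "Y n \<in> borel_measurable borel" "U n \<in> borel_measurable borel" for n
    using ymeas by (auto intro: borel_measurable_continuous_onI)
  have [measurable]: "y \<in> borel_measurable borel" "u \<in> borel_measurable borel"
    unfolding y_def u_def by measurable
  \<comment> \<open>Termwise integration for both components at once: \<open>f\<close> and
    \<open>g\<close> form a row of the matrix, and \<open>Z\<close> holds the increments of that
    component. As \<open>Z 0\<close> is constant, its contribution to differences is zero and the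
    index shift is harmless.\<close>
  have gen: "ac_deriv z (\<lambda>x. f x * y x + g x * u x)"
    if fg[measurable]: "f \<in> borel_measurable borel" "g \<in> borel_measurable borel"
      and le: "\<And>x n. cmod (f x * Y n x + g x * U n x) \<le> coeff_size x * (cmod (Y n x) + cmod (U n x))"
      and ac: "\<And>n. ac_deriv (Z (Suc n)) (\<lambda>x. f x * Y n x + g x * U n x)"
      and Z0: "\<And>x. Z 0 x = (z0 :: complex)" and zs: "\<And>x. (\<lambda>n. Z n x) sums z x" for f g z Z z0
  proof (rule ac_derivI)
    show "(\<lambda>x. f x * y x + g x * u x) \<in> borel_measurable borel" by measurable
    fix a b :: real
    let ?F = "\<lambda>n x. indicator {a..b} x *\<^sub>R (f x * Y n x + g x * U n x)"
    have "continuous_on {a..b} ?A"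
      by (intro ac_deriv_continuous[OF ac_deriv_primitive]) (use coeff_size in auto)
    then have "bounded (?A ` {a..b})" by (intro compact_imp_bounded compact_continuous_image) auto
    then obtain M where M: "\<And>x. x \<in> {a..b} \<Longrightarrow> \<bar>?A x\<bar> \<le> M" unfolding bounded_iff real_norm_def by blast
    have Fi: "integrable lborel (?F n)" for n
      using ac_deriv_integrable[OF ac[of n], of a b] unfolding set_integrable_def .
    have Fb: "norm (?F n x) \<le> (?K * (M ^ n / fact n)) * (indicator {a..b} x *\<^sub>R coeff_size x)" for n x
    proof (cases "x \<in> {a..b}")
      case True
      have "cmod (f x * Y n x + g x * U n x) \<le> coeff_size x * (?K * (\<bar>?A x\<bar> ^ n / fact n))"
        by (rule order_trans[OF le]) (intro mult_left_mono bound coeff_size)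
      also have "\<dots> \<le> coeff_size x * (?K * (M ^ n / fact n))"
        using M[OF True] by (intro mult_left_mono divide_right_mono power_mono coeff_size) auto
      finally show ?thesis using True by (simp add: mult.commute)
    qed simp
    have ci: "integrable lborel (\<lambda>x. indicator {a..b} x *\<^sub>R coeff_size x)"
      using coeff_size(3)[of a b] unfolding set_integrable_def .
    have s1: "AE x in lborel. summable (\<lambda>n. norm (?F n x))"
    proof (rule AE_I2)
      fix x
      show "summable (\<lambda>n. norm (?F n x))"
        by (rule summable_comparison_test'[OF summable_mult2[OF expsum[of ?K M]], of 0]) (use Fb in simp)
    qed
    have s2: "summable (\<lambda>n. LINT x|lborel. norm (?F n x))"
    proof (rule summable_comparison_test'[OF summable_mult2[OF expsum[of ?K M]], of 0])
      fix n :: nat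
      have "(LINT x|lborel. norm (?F n x)) \<le> (LINT x|lborel. (?K * (M ^ n / fact n)) * (indicator {a..b} x *\<^sub>R coeff_size x))"
        by (rule integral_mono[OF integrable_norm[OF Fi] integrable_mult_right[OF ci] Fb])
      also have "\<dots> = (?K * (M ^ n / fact n)) * (LINT x|lborel. indicator {a..b} x *\<^sub>R coeff_size x)" by simp
      finally show "norm (LINT x|lborel. norm (?F n x)) \<le> (?K * (M ^ n / fact n)) * (LINT x|lborel. indicator {a..b} x *\<^sub>R coeff_size x)"
        by simp
    qed
    have sumF: "(\<Sum>n. ?F n x) = indicator {a..b} x *\<^sub>R (f x * y x + g x * u x)" for x
    proof -
      have "(\<lambda>n. f x * Y n x + g x * U n x) sums (f x * y x + g x * u x)"
        unfolding y_def u_def by (intro sums_add sums_mult summable_sums sY sU)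
      from sums_scaleR_right[OF this, of "indicator {a..b} x"] show ?thesis by (rule sums_unique[symmetric])
    qed
    show "set_integrable lborel {a..b} (\<lambda>x. f x * y x + g x * u x)"
      unfolding set_integrable_def sumF[symmetric] by (rule integrable_suminf[OF Fi s1 s2])
    assume ab: "a \<le> b"
    have "(\<lambda>n. LINT x|lborel. ?F n x) sums (LINT x|lborel. (\<Sum>n. ?F n x))"
      by (rule sums_integral[OF Fi s1 s2])
    moreover have "(LINT x|lborel. ?F n x) = Z (Suc n) b - Z (Suc n) a" for n
      using ac_deriv_integral[OF ac ab, of n] unfolding set_lebesgue_integral_def .
    ultimately have "(\<lambda>n. Z (Suc n) b - Z (Suc n) a) sums (LINT x:{a..b}|lborel. f x * y x + g x * u x)"
      unfolding sumF set_lebesgue_integral_def by simp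
    moreover have "(\<lambda>n. Z (Suc n) b - Z (Suc n) a) sums ((z b - z a) - (Z 0 b - Z 0 a))"
      unfolding sums_Suc_iff[of "\<lambda>n. Z n b - Z n a"] using sums_diff[OF zs zs, of b a] by simp
    ultimately show "z b - z a = (LINT x:{a..b}|lborel. f x * y x + g x * u x)"
      unfolding Z0 by (simp add: sums_unique2)
  qed
  have Y: "ac_deriv (Y (Suc n)) (\<lambda>x. p x * Y n x + q x * U n x)" and U: "ac_deriv (U (Suc n)) (\<lambda>x. r x * Y n x + s x * U n x)" for n
    unfolding Y_def U_def using picard_term_measurable picard_term_integrable
    by (auto intro!: ac_deriv_primitive)
  have "ac_deriv y (\<lambda>x. p x * y x + q x * u x)"
    by (rule gen[of p q Y y0 y])
      (use Y sY picard_step_bound in \<open>auto simp: y_def Y_def intro: summable_sums order_trans[OF _ picard_step_bound]\<close>)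
  moreover have "ac_deriv u (\<lambda>x. r x * y x + s x * u x)"
    by (rule gen[of r s U u0 u])
      (use U sU in \<open>auto simp: u_def U_def intro: summable_sums order_trans[OF _ picard_step_bound]\<close>)
  moreover have "y 0 = y0" "u 0 = u0"
  proof -
    have "Y n 0 = (if n = 0 then y0 else 0)" "U n 0 = (if n = 0 then u0 else 0)" for n
      unfolding Y_def U_def by (cases n; simp)+
    then show "y 0 = y0" "u 0 = u0"
      unfolding y_def u_def using sums_single[where i=0 and f="\<lambda>_. y0"] sums_single[where i=0 and f="\<lambda>_. u0"] by (simp_all add: sums_iff)
  qed
  ultimately show ?thesis by (rule that)
qed

end

section \<open>Hill systems with a singular potential\<close>

lemma set_integrable_Icc_const: "set_integrable lborel {a..b::real} (\<lambda>x. k :: 'a::{banach,second_countable_topology})"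
  unfolding set_integrable_def
  by (intro integrable_scaleR_left integrable_real_indicator) (auto simp: emeasure_lborel_Icc_eq)

locale hill_potential =
  fixes Q :: "real \<Rightarrow> complex"
  assumes Q_borel[measurable]: "Q \<in> borel_measurable borel"
    and Q_sq_integrable: "\<And>a b. set_integrable lborel {a..b} (\<lambda>x. (cmod (Q x))\<^sup>2)"
    and Q_periodic: "AE x in lborel. Q (x + pi) = Q x"
begin

text \<open>The sign of \<open>f\<close> is chosen so that, with \<open>c = C - lam\<close> and
  \<open>u = y' - Q y\<close>, the system expresses that the operator minus \<open>lam\<close> maps
  \<open>y\<close> to \<open>f\<close>.\<close>

definition hill_sol :: "complex \<Rightarrow> (real \<Rightarrow> complex) \<Rightarrow> (real \<Rightarrow> complex) \<Rightarrow> (real \<Rightarrow> complex) \<Rightarrow> bool" where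
  "hill_sol c f y u \<longleftrightarrow> ac_deriv y (\<lambda>x. Q x * y x + u x) \<and>
     ac_deriv u (\<lambda>x. (c - (Q x)\<^sup>2) * y x - Q x * u x - f x)"

abbreviation homog_sol :: "complex \<Rightarrow> (real \<Rightarrow> complex) \<Rightarrow> (real \<Rightarrow> complex) \<Rightarrow> bool" where
  "homog_sol c \<equiv> hill_sol c (\<lambda>x. 0)"

lemma Q_integrable: "set_integrable lborel {a..b} Q"
proof (rule set_integrable_bound)
  show "set_integrable lborel {a..b} (\<lambda>x. 1 + (cmod (Q x))\<^sup>2)"
    by (intro set_integral_add Q_sq_integrable set_integrable_Icc_const)
  show "set_borel_measurable lborel {a..b} Q" unfolding set_borel_measurable_def by simp
  have "cmod z \<le> 1 + (cmod z)\<^sup>2" for z :: complex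
    using sum_squares_bound[of "cmod z" 1] norm_ge_zero[of z] unfolding mult_1_right power_one by linarith
  then show "AE x in lborel. x \<in> {a..b} \<longrightarrow> norm (Q x) \<le> norm (1 + (cmod (Q x))\<^sup>2)" by simp
qed

lemma Q_squared_integrable: "set_integrable lborel {a..b} (\<lambda>x. (Q x)\<^sup>2)"
  by (rule set_integrable_bound[OF Q_sq_integrable]) (auto simp: set_borel_measurable_def norm_power)

lemma hill_sol_add:
  assumes "hill_sol c f y u" "hill_sol c g z w"
  shows "hill_sol c (\<lambda>x. f x + g x) (\<lambda>x. y x + z x) (\<lambda>x. u x + w x)"
  using ac_deriv_add[of y _ z] ac_deriv_add[of u _ w] assms
  unfolding hill_sol_def by (fastforce simp: algebra_simps)

lemma hill_sol_cmult:
  assumes "hill_sol c f y u"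
  shows "hill_sol c (\<lambda>x. k * f x) (\<lambda>x. k * y x) (\<lambda>x. k * u x)"
  using ac_deriv_cmult[of y _ k] ac_deriv_cmult[of u _ k] assms
  unfolding hill_sol_def by (fastforce simp: algebra_simps)

lemma hill_sol_diff:
  assumes "hill_sol c f y u" "hill_sol c g z w"
  shows "hill_sol c (\<lambda>x. f x - g x) (\<lambda>x. y x - z x) (\<lambda>x. u x - w x)"
  using hill_sol_add[OF assms(1) hill_sol_cmult[OF assms(2), of "-1"]] by simp

lemma hill_sol_lincomb:
  assumes "homog_sol c y u" "homog_sol c z w"
  shows "homog_sol c (\<lambda>x. k * y x + l * z x) (\<lambda>x. k * u x + l * w x)"
  using hill_sol_add[OF hill_sol_cmult[OF assms(1), of k] hill_sol_cmult[OF assms(2), of l]] by simp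

lemma hill_sol_cont: "hill_sol c f y u \<Longrightarrow> continuous_on A y" "hill_sol c f y u \<Longrightarrow> continuous_on A u"
  unfolding hill_sol_def by (auto intro: ac_deriv_continuous)

lemma hill_sol_borel: "hill_sol c f y u \<Longrightarrow> y \<in> borel_measurable borel" "hill_sol c f y u \<Longrightarrow> u \<in> borel_measurable borel"
  unfolding hill_sol_def by (auto intro: ac_deriv_measurable)

lemma hill_sol_shift:
  assumes "homog_sol c y u"
  shows "homog_sol c (\<lambda>x. y (x + pi)) (\<lambda>x. u (x + pi))"
proof -
  note [measurable] = hill_sol_borel[OF assms]
  have "ac_deriv (\<lambda>x. y (x + pi)) (\<lambda>x. Q x * y (x + pi) + u (x + pi))"
    by (rule ac_deriv_cong_AE[OF ac_deriv_shift[of y "\<lambda>x. Q x * y x + u x" pi]])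
      (use assms Q_periodic in \<open>auto simp: hill_sol_def elim: eventually_mono\<close>)
  moreover have "ac_deriv (\<lambda>x. u (x + pi)) (\<lambda>x. (c - (Q x)\<^sup>2) * y (x + pi) - Q x * u (x + pi) - 0)"
    by (rule ac_deriv_cong_AE[OF ac_deriv_shift[of u "\<lambda>x. (c - (Q x)\<^sup>2) * y x - Q x * u x - 0" pi]])
      (use assms Q_periodic in \<open>auto simp: hill_sol_def elim: eventually_mono\<close>)
  ultimately show ?thesis unfolding hill_sol_def by simp
qed

lemma hill_sol_exists:
  obtains y u where "homog_sol c y u" "y 0 = y0" "u 0 = u0"
proof -
  obtain y u where "ac_deriv y (\<lambda>x. Q x * y x + 1 * u x)" "ac_deriv u (\<lambda>x. (c - (Q x)\<^sup>2) * y x + (- Q x) * u x)"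
    "y 0 = y0" "u 0 = u0"
    by (rule linear_system_solution_exists[of Q "\<lambda>x. 1" "\<lambda>x. c - (Q x)\<^sup>2" "\<lambda>x. - Q x" y0 u0])
      (use Q_integrable Q_squared_integrable set_integrable_Icc_const[where k="1::complex"] set_integrable_Icc_const[of _ _ c]
        set_integrable_mult_right[of "-1" lborel _ Q] in \<open>auto intro: set_integral_diff(1)\<close>)
  then show ?thesis by (intro that[of y u]) (auto simp: hill_sol_def)
qed

text \<open>All terms with \<open>c\<close> and \<open>Q\<close> cancel and only the forcing terms
  survive. The same identity yields uniqueness, variation of constants and Lagrange's
  identity.\<close>

lemma wronskian_deriv_forced:
  assumes "hill_sol c g y u" "hill_sol c f z w"
  shows "ac_deriv (\<lambda>x. y x * w x - u x * z x) (\<lambda>x. g x * z x - f x * y x)"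
proof -
  note S = assms[unfolded hill_sol_def]
  show ?thesis
    by (rule ac_deriv_eqI[OF ac_deriv_diff[OF ac_deriv_mult[OF conjunct1[OF S(1)] conjunct2[OF S(2)]]
            ac_deriv_mult[OF conjunct2[OF S(1)] conjunct1[OF S(2)]]]]) (simp add: algebra_simps)
qed

lemma wronskian_deriv:
  assumes "homog_sol c y u" "hill_sol c f z w"
  shows "ac_deriv (\<lambda>x. y x * w x - u x * z x) (\<lambda>x. - (f x * y x))"
  using wronskian_deriv_forced[OF assms] by simp

lemma wronskian_const:
  assumes "homog_sol c y u" "homog_sol c z w"
  shows "y x * w x - u x * z x = y 0 * w 0 - u 0 * z 0"
  using ac_deriv_zero_const[of "\<lambda>x. y x * w x - u x * z x"] wronskian_deriv[OF assms] by simp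

section \<open>Fundamental systems and the monodromy matrix\<close>

definition fundamental :: "complex \<Rightarrow> (real \<Rightarrow> complex) \<Rightarrow> (real \<Rightarrow> complex) \<Rightarrow> (real \<Rightarrow> complex) \<Rightarrow> (real \<Rightarrow> complex) \<Rightarrow> bool" where
  "fundamental c y1 u1 y2 u2 \<longleftrightarrow> homog_sol c y1 u1 \<and> homog_sol c y2 u2 \<and>
     y1 0 = 1 \<and> u1 0 = 0 \<and> y2 0 = 0 \<and> u2 0 = 1"

lemma fundamental_exists: obtains y1 u1 y2 u2 where "fundamental c y1 u1 y2 u2"
proof -
  obtain y1 u1 where "homog_sol c y1 u1" "y1 0 = 1" "u1 0 = 0" by (rule hill_sol_exists)
  moreover obtain y2 u2 where "homog_sol c y2 u2" "y2 0 = 0" "u2 0 = 1" by (rule hill_sol_exists)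
  ultimately show ?thesis by (intro that[of y1 u1 y2 u2]) (auto simp: fundamental_def)
qed

lemma fundamental_det: "fundamental c y1 u1 y2 u2 \<Longrightarrow> y1 x * u2 x - u1 x * y2 x = 1"
  using wronskian_const[of c y1 u1 y2 u2 x] by (simp add: fundamental_def)

text \<open>Cramer's rule: the Wronskians with the two fundamental solutions are constant and the
  determinant is 1. Uniqueness comes out without any Gronwall estimate.\<close>

lemma hill_sol_representation:
  assumes F: "fundamental c y1 u1 y2 u2" and S: "homog_sol c y u"
  shows "y x = y 0 * y1 x + u 0 * y2 x" "u x = y 0 * u1 x + u 0 * u2 x"
proof -
  have w: "u 0 = y1 x * u x - u1 x * y x" "y 0 = - (y2 x * u x - u2 x * y x)"
    using wronskian_const[OF _ S, of y1 u1 x] wronskian_const[OF _ S, of y2 u2 x] F by (auto simp: fundamental_def)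
  have "y 0 * y1 x + u 0 * y2 x = y x * (y1 x * u2 x - u1 x * y2 x)"
    "y 0 * u1 x + u 0 * u2 x = u x * (y1 x * u2 x - u1 x * y2 x)"
    unfolding w by (simp_all add: algebra_simps)
  then show "y x = y 0 * y1 x + u 0 * y2 x" "u x = y 0 * u1 x + u 0 * u2 x"
    using fundamental_det[OF F, of x] by simp_all
qed

lemma hill_sol_zero:
  assumes "homog_sol c y u" "y a = 0" "u a = 0"
  shows "y x = 0 \<and> u x = 0"
proof -
  obtain y1 u1 y2 u2 where F: "fundamental c y1 u1 y2 u2" by (rule fundamental_exists)
  have "y1 a * u a - u1 a * y a = u 0" "y2 a * u a - u2 a * y a = - y 0"
    using wronskian_const[OF _ assms(1), of y1 u1 a] wronskian_const[OF _ assms(1), of y2 u2 a] F by (auto simp: fundamental_def)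
  then have "y 0 = 0" "u 0 = 0" using assms by auto
  then show ?thesis using hill_sol_representation[OF F assms(1), of x] by simp
qed

text \<open>Where \<open>y\<close> vanishes on an interval, \<open>y' = Q y + u\<close> forces the continuous function \<open>u\<close> to vanish as well.\<close>
lemma hill_sol_zero_interval:
  assumes S: "homog_sol c y u" and "a < b" and z: "\<And>x. x \<in> {a<..<b} \<Longrightarrow> y x = 0"
  shows "y x = 0 \<and> u x = 0"
proof -
  obtain a' b' where ab: "a < a'" "a' < b'" "b' < b"
    using dense[OF \<open>a < b\<close>] by (metis dense order_less_trans)
  have y: "ac_deriv y (\<lambda>x. Q x * y x + u x)" using S by (auto simp: hill_sol_def)
  have u0: "(u has_integral 0) {a'..t}" if "t \<in> {a'..b'}" for t
  proof -
    have "((\<lambda>x. Q x * y x + u x) has_integral (y t - y a')) {a'..t}"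
      by (rule ac_deriv_has_integral[OF y]) (use that in auto)
    then have "(u has_integral (y t - y a')) {a'..t}"
      by (rule has_integral_eq[rotated]) (use z ab that in auto)
    moreover have "y t = 0" "y a' = 0" using z ab that by auto
    ultimately show ?thesis by simp
  qed
  have "u t = 0" if "t \<in> {a'..b'}" for t
  proof -
    have "((\<lambda>s. integral {a'..s} u) has_vector_derivative u t) (at t within {a'..b'})"
      by (rule integral_has_vector_derivative) (use hill_sol_cont[OF S] that in auto)
    moreover have "((\<lambda>s. integral {a'..s} u) has_vector_derivative 0) (at t within {a'..b'})"
      by (rule has_vector_derivative_transform[where f="\<lambda>s. 0", OF that]) (use integral_unique[OF u0] in auto)
    ultimately show ?thesis
      using vector_derivative_unique_within_closed_interval[of a' b' t] that ab by auto
  qed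
  then have "u a' = 0" "y a' = 0" using ab z by auto
  then show ?thesis using hill_sol_zero[OF S] by blast
qed

definition discriminant :: "complex \<Rightarrow> complex" where
  "discriminant c = (THE d. \<exists>y1 u1 y2 u2. fundamental c y1 u1 y2 u2 \<and> d = y1 pi + u2 pi)"

lemma discriminant_eq:
  assumes "fundamental c y1 u1 y2 u2"
  shows "discriminant c = y1 pi + u2 pi"
  unfolding discriminant_def
proof (rule the_equality)
  fix d assume "\<exists>y1 u1 y2 u2. fundamental c y1 u1 y2 u2 \<and> d = y1 pi + u2 pi"
  then obtain z1 w1 z2 w2 where F: "fundamental c z1 w1 z2 w2" "d = z1 pi + w2 pi" by auto
  have "z1 pi = y1 pi"
    using hill_sol_representation(1)[OF assms, of z1 w1 pi] F by (simp add: fundamental_def)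
  moreover have "w2 pi = u2 pi"
    using hill_sol_representation(2)[OF assms, of z2 w2 pi] F by (simp add: fundamental_def)
  ultimately show "d = y1 pi + u2 pi" using F by simp
qed (use assms in auto)

text \<open>The difference of the two sides is again a solution, so it suffices to look at 0. There
  the claim is the Cayley-Hamilton identity for the monodromy matrix, which has determinant 1 and
  trace \<open>discriminant c\<close>.\<close>

lemma hill_sol_Cayley_Hamilton:
  assumes S: "homog_sol c y u"
  shows "y (x + pi + pi) = discriminant c * y (x + pi) - y x"
    "u (x + pi + pi) = discriminant c * u (x + pi) - u x"
proof -
  obtain y1 u1 y2 u2 where F: "fundamental c y1 u1 y2 u2" by (rule fundamental_exists)
  let ?D = "discriminant c"
  note S1 = hill_sol_shift[OF S] and D = discriminant_eq[OF F]
  have T: "homog_sol c (\<lambda>x. y (x + pi + pi) - (?D * y (x + pi) + (-1) * y x)) (\<lambda>x. u (x + pi + pi) - (?D * u (x + pi) + (-1) * u x))"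
    using hill_sol_diff[OF hill_sol_shift[OF S1] hill_sol_lincomb[OF S1 S, of ?D "-1"]] by simp
  have 1: "y pi = y 0 * y1 pi + u 0 * y2 pi" "u pi = y 0 * u1 pi + u 0 * u2 pi"
    by (rule hill_sol_representation[OF F S])+
  have 2: "y (pi + pi) = y pi * y1 pi + u pi * y2 pi" "u (pi + pi) = y pi * u1 pi + u pi * u2 pi"
    using hill_sol_representation[OF F S1, of pi] by simp_all
  have det: "y1 pi * u2 pi = 1 + u1 pi * y2 pi" using fundamental_det[OF F, of pi] by (simp add: algebra_simps)
  have "y (pi + pi) - (?D * y pi - y 0) = y 0 * (1 + u1 pi * y2 pi - y1 pi * u2 pi)"
    "u (pi + pi) - (?D * u pi - u 0) = u 0 * (1 + u1 pi * y2 pi - y1 pi * u2 pi)"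
    unfolding 2 unfolding 1 D by (simp_all add: algebra_simps)
  then have "y (pi + pi) - (?D * y pi - y 0) = 0" "u (pi + pi) - (?D * u pi - u 0) = 0"
    unfolding det by simp_all
  with hill_sol_zero[OF T, of 0 x]
  show "y (x + pi + pi) = ?D * y (x + pi) - y x" "u (x + pi + pi) = ?D * u (x + pi) - u x" by simp_all
qed

end

section \<open>Solutions on half lines and Floquet multipliers\<close>

definition half_line_L2 :: "(real \<Rightarrow> complex) \<Rightarrow> bool" where
  "half_line_L2 g \<longleftrightarrow> (\<exists>a. set_integrable lborel {a..} (\<lambda>x. (cmod (g x))\<^sup>2)) \<or>
     (\<exists>a. set_integrable lborel {..a} (\<lambda>x. (cmod (g x))\<^sup>2))"

lemma half_line_L2_of_L2: "L2 g \<Longrightarrow> half_line_L2 g"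
  unfolding half_line_L2_def set_integrable_def
  by (intro disjI1 exI[of _ 0] integrable_mult_indicator) (auto simp: L2_def)

lemma set_integrable_sq_shift_diff:
  fixes g :: "real \<Rightarrow> complex"
  assumes [measurable]: "g \<in> borel_measurable borel" "S \<in> sets borel"
    and i: "set_integrable lborel S (\<lambda>x. (cmod (g x))\<^sup>2)" "set_integrable lborel ((\<lambda>x. x + c) -` S) (\<lambda>x. (cmod (g x))\<^sup>2)"
  shows "set_integrable lborel ((\<lambda>x. x + c) -` S) (\<lambda>x. (cmod (g (x + c) - k * g x))\<^sup>2)"
proof (rule set_integrable_bound)
  have "integrable lborel (\<lambda>x. indicator S (c + 1 * x) *\<^sub>R (cmod (g (c + 1 * x)))\<^sup>2)"
    by (rule lborel_integrable_real_affine) (use i(1) in \<open>auto simp: set_integrable_def\<close>)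
  moreover have "(\<lambda>x. indicator S (c + 1 * x) *\<^sub>R (cmod (g (c + 1 * x)))\<^sup>2) = (\<lambda>x. indicator ((\<lambda>x. x + c) -` S) x *\<^sub>R (cmod (g (x + c)))\<^sup>2)"
    by (auto simp: indicator_def add.commute)
  ultimately have "set_integrable lborel ((\<lambda>x. x + c) -` S) (\<lambda>x. (cmod (g (x + c)))\<^sup>2)"
    unfolding set_integrable_def by simp
  then show "set_integrable lborel ((\<lambda>x. x + c) -` S) (\<lambda>x. 2 * (cmod (g (x + c)))\<^sup>2 + (2 * (cmod k)\<^sup>2) * (cmod (g x))\<^sup>2)"
    by (intro set_integral_add set_integrable_mult_right) (use i in auto)
  have [measurable]: "(\<lambda>x. x + c) -` S \<in> sets borel"
    using measurable_sets[of "\<lambda>x. x + c" borel borel S] by simp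
  show "set_borel_measurable lborel ((\<lambda>x. x + c) -` S) (\<lambda>x. (cmod (g (x + c) - k * g x))\<^sup>2)"
    unfolding set_borel_measurable_def by measurable
  have "(cmod (g (x + c) - k * g x))\<^sup>2 \<le> 2 * (cmod (g (x + c)))\<^sup>2 + (2 * (cmod k)\<^sup>2) * (cmod (g x))\<^sup>2" for x
    using cmod_add_sq_le[of "g (x + c)" "- k * g x"] by (simp add: norm_mult power_mult_distrib)
  then show "AE x in lborel. x \<in> (\<lambda>x. x + c) -` S \<longrightarrow> norm ((cmod (g (x + c) - k * g x))\<^sup>2)
      \<le> norm (2 * (cmod (g (x + c)))\<^sup>2 + (2 * (cmod k)\<^sup>2) * (cmod (g x))\<^sup>2)"
    by (auto intro: order_trans[OF _ abs_ge_self])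
qed

lemma half_line_L2_shift_diff:
  assumes g: "g \<in> borel_measurable borel" and c: "0 \<le> c" and h: "half_line_L2 g"
  shows "half_line_L2 (\<lambda>x. g (x + c) - k * g x)"
proof -
  consider (right) a where "set_integrable lborel {a..} (\<lambda>x. (cmod (g x))\<^sup>2)"
    | (left) a where "set_integrable lborel {..a} (\<lambda>x. (cmod (g x))\<^sup>2)"
    using h unfolding half_line_L2_def by blast
  then show ?thesis
  proof cases
    case right
    have "(\<lambda>x. x + c) -` {a + c..} = {a..}" by auto
    moreover have "set_integrable lborel {a + c..} (\<lambda>x. (cmod (g x))\<^sup>2)"
      by (rule set_integrable_subset[OF right]) (use c in auto)
    ultimately show ?thesis
      using set_integrable_sq_shift_diff[OF g, of "{a + c..}" c k] right unfolding half_line_L2_def by auto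
  next
    case left
    have "(\<lambda>x. x + c) -` {..a} = {..a - c}" by auto
    moreover have "set_integrable lborel {..a - c} (\<lambda>x. (cmod (g x))\<^sup>2)"
      by (rule set_integrable_subset[OF left]) (use c in auto)
    ultimately show ?thesis
      using set_integrable_sq_shift_diff[OF g, of "{..a}" c k] left unfolding half_line_L2_def by auto
  qed
qed

text \<open>Translation by a period maps one of the rays \<open>S\<close> and \<open>T\<close> onto
  the other, so both carry the same integral and nothing is left for \<open>S - T\<close>. The
  alternative in the hypothesis covers rays to the right and to the left.\<close>

lemma half_line_integral_split_zero:
  fixes h :: "real \<Rightarrow> real"
  assumes [measurable]: "h \<in> borel_measurable borel" "S \<in> sets borel" and h0: "\<And>x. 0 \<le> h x"
    and per: "\<And>x. h (x + c) = h x"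
    and i: "set_integrable lborel S h" and sub: "T \<subseteq> S" "T = (\<lambda>x. x + c) -` S \<or> S = (\<lambda>x. x + c) -` T"
    and T[measurable]: "T \<in> sets borel"
  shows "AE x in lborel. x \<in> S - T \<longrightarrow> h x = 0"
proof -
  have iT: "set_integrable lborel T h"
    by (rule set_integrable_subset[OF i]) (use sub in auto)
  have iD: "set_integrable lborel (S - T) h"
    by (rule set_integrable_subset[OF i]) auto
  have sh: "(LINT x:(\<lambda>x. x + c) -` U|lborel. h x) = (LINT x:U|lborel. h x)" for U
  proof -
    have "(LINT x:U|lborel. h x) = \<bar>1\<bar> *\<^sub>R (LINT x|lborel. indicator U (c + 1 * x) *\<^sub>R h (c + 1 * x))"
      unfolding set_lebesgue_integral_def by (rule lborel_integral_real_affine) simp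
    also have "(\<lambda>x. indicator U (c + 1 * x) *\<^sub>R h (c + 1 * x)) = (\<lambda>x. indicator ((\<lambda>x. x + c) -` U) x *\<^sub>R h x)"
      using per by (auto simp: indicator_def add.commute)
    finally show ?thesis by (simp add: set_lebesgue_integral_def)
  qed
  have "(LINT x:S|lborel. h x) = (LINT x:T|lborel. h x)" using sub sh by metis
  moreover have "(LINT x:(S - T) \<union> T|lborel. h x) = (LINT x:S - T|lborel. h x) + (LINT x:T|lborel. h x)"
    by (rule set_integral_Un[OF _ iD iT]) auto
  moreover have "(S - T) \<union> T = S" using sub by auto
  ultimately have "(LINT x|lborel. indicator (S - T) x *\<^sub>R h x) = 0" by (simp add: set_lebesgue_integral_def)
  then have "AE x in lborel. indicator (S - T) x *\<^sub>R h x = 0"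
    using integral_nonneg_eq_0_iff_AE[OF iD[unfolded set_integrable_def]] h0 by auto
  then show ?thesis by eventually_elim (auto simp: indicator_def split: if_splits)
qed

lemma half_line_L2_periodic_vanishes:
  assumes c: "continuous_on UNIV g" and h: "half_line_L2 g" and per: "\<And>x. cmod (g (x + pi)) = cmod (g x)"
  obtains a b where "a < b" "\<And>x. x \<in> {a<..<b} \<Longrightarrow> g x = 0"
proof -
  have [measurable]: "g \<in> borel_measurable borel" using c by (rule borel_measurable_continuous_onI)
  have fin: "\<exists>a b. a < b \<and> (\<forall>x\<in>{a<..<b}. g x = 0)"
    if "a < b" "AE x in lborel. x \<in> S - T \<longrightarrow> (cmod (g x))\<^sup>2 = 0" "{a<..<b} \<subseteq> S - T" for a b S T
  proof (intro exI conjI ballI)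
    fix x assume "x \<in> {a<..<b}"
    then show "g x = 0"
      by (rule continuous_AE_eq_imp_eq[OF c continuous_on_const open_greaterThanLessThan, rotated])
        (use that in \<open>auto elim!: eventually_mono\<close>)
  qed fact
  from h have "\<exists>a b. a < b \<and> (\<forall>x\<in>{a<..<b}. g x = 0)"
    unfolding half_line_L2_def
  proof (elim disjE exE)
    fix a assume i: "set_integrable lborel {a..} (\<lambda>x. (cmod (g x))\<^sup>2)"
    show ?thesis
      by (rule fin[of a "a + pi" "{a..}" "{a + pi..}"], simp, rule half_line_integral_split_zero[where c=pi])
        (use i per in auto)
  next
    fix a assume i: "set_integrable lborel {..a} (\<lambda>x. (cmod (g x))\<^sup>2)"
    show ?thesis
      by (rule fin[of "a - pi" a "{..a}" "{..a - pi}"], simp, rule half_line_integral_split_zero[where c=pi])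
        (use i per in auto)
  qed
  then show ?thesis using that by blast
qed

section \<open>Multipliers as roots of a quadratic\<close>

lemma reciprocal_roots: obtains m n :: complex where "m * n = 1" "m + n = D"
proof -
  define s where "s = csqrt (D\<^sup>2 - 4)"
  have "s\<^sup>2 = D\<^sup>2 - 4" by (simp add: s_def)
  then have "((D + s) / 2) * ((D - s) / 2) = 1" by (simp add: field_simps power2_eq_square)
  moreover have "(D + s) / 2 + (D - s) / 2 = D" by (simp add: field_simps)
  ultimately show ?thesis by (rule that)
qed

lemma reciprocal_roots_unimodular:
  fixes m n :: complex
  assumes "m * n = 1" "cmod m = 1"
  obtains t where "t \<in> {0..<2*pi}" "m + n = 2 * complex_of_real (cos t)"
proof -
  obtain t where t: "0 \<le> t" "t < 2*pi" "Re m = cos t" "Im m = sin t"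
    using sincos_total_2pi[of "Re m" "Im m"] assms(2) cmod_power2[of m] by auto
  have "n = cnj m"
  proof -
    have "m * cnj m = 1" using complex_norm_square[of m] assms(2) by simp
    then have "m * (n - cnj m) = 0" using assms(1) by (simp add: right_diff_distrib)
    then show ?thesis using assms(2) by auto
  qed
  then have "m + n = 2 * complex_of_real (cos t)"
    by (simp add: complex_eq_iff t)
  then show ?thesis using that t by simp
qed

lemma unimodular_roots:
  fixes m n :: complex
  assumes "m * n = 1" "m + n = 2 * complex_of_real (cos t)"
  shows "cmod m = 1" "cmod n = 1"
proof -
  have "(m - cis t) * (m - cis (-t)) = m\<^sup>2 - (cis t + cis (-t)) * m + cis t * cis (-t)"
    by (simp add: algebra_simps power2_eq_square)
  also have "cis t + cis (-t) = m + n" using assms(2) by (simp add: complex_eq_iff)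
  also have "cis t * cis (-t) = m * n" using assms(1) by (simp add: cis_mult)
  also have "m\<^sup>2 - (m + n) * m + m * n = 0" by (simp add: algebra_simps power2_eq_square)
  finally have "m = cis t \<or> m = cis (-t)" by auto
  then show "cmod m = 1" by (metis norm_cis)
  then show "cmod n = 1" using arg_cong[OF assms(1), of cmod] by (simp add: norm_mult)
qed

context hill_potential begin

lemma hill_sol_shift_diff:
  assumes S: "homog_sol c y u"
  shows "homog_sol c (\<lambda>x. y (x + pi) - k * y x) (\<lambda>x. u (x + pi) - k * u x)"
  using hill_sol_diff[OF hill_sol_shift[OF S] hill_sol_cmult[OF S, of k]] by simp

lemma hill_sol_shift_diff_multiplier:
  assumes S: "homog_sol c y u" and r: "m * n = 1" "m + n = discriminant c"
  shows "y (x + pi + pi) - m * y (x + pi) = n * (y (x + pi) - m * y x)"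
    "u (x + pi + pi) - m * u (x + pi) = n * (u (x + pi) - m * u x)"
proof -
  have "n * (z - m * w) = (m + n) * z - (m * n) * w - m * z" for z w by (simp add: algebra_simps)
  then show "y (x + pi + pi) - m * y (x + pi) = n * (y (x + pi) - m * y x)"
    "u (x + pi + pi) - m * u (x + pi) = n * (u (x + pi) - m * u x)"
    unfolding hill_sol_Cayley_Hamilton[OF S] r by simp_all
qed

text \<open>The multiplier argument never diagonalises the monodromy matrix; a double multiplier
  with a Jordan block, where solutions may grow linearly, needs no separate case.\<close>

lemma half_line_L2_hill_sol_zero:
  assumes S: "homog_sol c y u" and h: "half_line_L2 y"
    and D: "discriminant c = 2 * complex_of_real (cos t)"
  shows "y x = 0 \<and> u x = 0"
proof -
  obtain m n where r: "m * n = 1" "m + n = discriminant c" by (rule reciprocal_roots)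
  have mn: "cmod m = 1" "cmod n = 1" using unimodular_roots[OF r(1)] r(2) D by auto
  note S1 = hill_sol_shift_diff[OF S, of m]
  have h1: "half_line_L2 (\<lambda>x. y (x + pi) - m * y x)"
    by (rule half_line_L2_shift_diff[OF hill_sol_borel(1)[OF S] _ h]) simp
  have "cmod (y (x + pi + pi) - m * y (x + pi)) = cmod (y (x + pi) - m * y x)" for x
    unfolding hill_sol_shift_diff_multiplier(1)[OF S r] using mn by (simp add: norm_mult)
  then obtain a b where "a < b" "\<And>x. x \<in> {a<..<b} \<Longrightarrow> y (x + pi) - m * y x = 0"
    using half_line_L2_periodic_vanishes[OF hill_sol_cont(1)[OF S1] h1] by blast
  from hill_sol_zero_interval[OF S1 this]
  have "y (x + pi) = m * y x" for x by simp
  then have "cmod (y (x + pi)) = cmod (y x)" for x using mn by (simp add: norm_mult)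
  then obtain a b where "a < b" "\<And>x. x \<in> {a<..<b} \<Longrightarrow> y x = 0"
    using half_line_L2_periodic_vanishes[OF hill_sol_cont(1)[OF S] h] by blast
  from hill_sol_zero_interval[OF S this] show ?thesis .
qed

text \<open>Translation preserves the L2 norm, whereas here it multiplies it by
  \<open>cmod m\<close>.\<close>

lemma L2_multiplier_zero:
  assumes c: "continuous_on UNIV g" and L: "L2 g" and m: "\<And>x. g (x + pi) = m * g x" and "cmod m \<noteq> 1"
  shows "g x = 0"
proof -
  have "(LINT x|lborel. (cmod (g x))\<^sup>2) = \<bar>1\<bar> *\<^sub>R (LINT x|lborel. (cmod (g (pi + 1 * x)))\<^sup>2)"
    by (rule lborel_integral_real_affine) simp
  also have "\<dots> = (cmod m)\<^sup>2 * (LINT x|lborel. (cmod (g x))\<^sup>2)"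
    using m by (simp add: add.commute[of pi] norm_mult power_mult_distrib)
  finally have "(1 - (cmod m)\<^sup>2) * (l2norm g)\<^sup>2 = 0" unfolding l2norm_sq by (simp add: algebra_simps)
  moreover have "(cmod m)\<^sup>2 \<noteq> 1" using \<open>cmod m \<noteq> 1\<close> norm_ge_zero[of m] unfolding power2_eq_1_iff by linarith
  ultimately have "l2norm g = 0" by simp
  then have "AE x in lborel. g x = 0" by (rule l2norm_eq_zero[OF L])
  then show ?thesis
    using continuous_AE_eq_imp_eq[OF c continuous_on_const, of UNIV 0 x] by auto
qed

lemma L2_hill_sol_zero:
  assumes S: "homog_sol c y u" and L: "L2 y"
  shows "y x = 0 \<and> u x = 0"
proof -
  obtain m n where r: "m * n = 1" "m + n = discriminant c" by (rule reciprocal_roots)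
  show ?thesis
  proof (cases "cmod m = 1")
    case True
    obtain t where "m + n = 2 * complex_of_real (cos t)" by (rule reciprocal_roots_unimodular[OF r(1) True])
    then show ?thesis using half_line_L2_hill_sol_zero[OF S half_line_L2_of_L2[OF L], of t] r by simp
  next
    case False
    then have n: "cmod n \<noteq> 1" using arg_cong[OF r(1), of cmod] by (auto simp: norm_mult)
    note S1 = hill_sol_shift_diff[OF S, of m]
    have "y (x + pi) - m * y x = 0" for x
      by (rule L2_multiplier_zero[OF hill_sol_cont(1)[OF S1] L2_diff[OF L2_shift[OF L] L2_cmult[OF L]] _ n])
        (rule hill_sol_shift_diff_multiplier(1)[OF S r])
    then have "y (x + pi) = m * y x" for x by simp
    then have "y x = 0" for x
      by (rule L2_multiplier_zero[OF hill_sol_cont(1)[OF S] L _ False])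
    then show ?thesis using hill_sol_zero_interval[OF S, of 0 1] by simp
  qed
qed

text \<open>For any solution \<open>y\<close>, the function \<open>y (x + pi) - n * y x\<close> has
  multiplier \<open>m\<close>. If it vanishes for both fundamental solutions, the monodromy matrix
  is \<open>n\<close> times the identity; its trace then gives \<open>m = n\<close>, and
  \<open>y1\<close> itself serves.\<close>

lemma floquet_sol_exists:
  assumes r: "m * n = 1" "m + n = discriminant c"
  obtains y u where "homog_sol c y u" "\<And>x. y (x + pi) = m * y x" "\<And>x. u (x + pi) = m * u x"
    "\<exists>x. y x \<noteq> 0"
proof -
  obtain y1 u1 y2 u2 where F: "fundamental c y1 u1 y2 u2" by (rule fundamental_exists)
  have S: "homog_sol c y1 u1" "homog_sol c y2 u2" using F by (auto simp: fundamental_def)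
  have r': "n * m = 1" "n + m = discriminant c" using r by (simp_all add: mult.commute add.commute)
  note M = hill_sol_shift_diff_multiplier[OF S(1) r'] hill_sol_shift_diff_multiplier[OF S(2) r']
  note goal_rule = that
  have main: thesis if "homog_sol c y u" "\<exists>x. y (x + pi) - n * y x \<noteq> 0"
    for y u
    by (rule goal_rule[OF hill_sol_shift_diff[OF that(1), of n]
        hill_sol_shift_diff_multiplier(1)[OF that(1) r'] hill_sol_shift_diff_multiplier(2)[OF that(1) r'] that(2)])
  show thesis
  proof (cases "(\<exists>x. y1 (x + pi) - n * y1 x \<noteq> 0) \<or> (\<exists>x. y2 (x + pi) - n * y2 x \<noteq> 0)")
    case True
    then show ?thesis using main S by blast
  next
    case False
    then have z: "y1 (x + pi) = n * y1 x" "y2 (x + pi) = n * y2 x" for x by auto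
    have w: "u1 (x + pi) = n * u1 x" "u2 (x + pi) = n * u2 x" for x
      using hill_sol_zero_interval[OF hill_sol_shift_diff[OF S(1), of n], of 0 1 x]
        hill_sol_zero_interval[OF hill_sol_shift_diff[OF S(2), of n], of 0 1 x] z by auto
    have "m + n = n + n" using discriminant_eq[OF F] z(1)[of 0] w(2)[of 0] F r by (simp add: fundamental_def)
    then have "m = n" by simp
    show ?thesis
      by (rule goal_rule[OF S(1)]) (use z w F \<open>m = n\<close> in \<open>auto simp: fundamental_def intro: exI[of _ 0]\<close>)
  qed
qed

text \<open>Here \<open>y\<close> and \<open>u\<close> are numbers: an arbitrary vector is expanded
  in the basis that the fundamental solutions form at \<open>x\<close>. Wronskians appear as
  coefficients, and they are constant wherever the forcing vanishes.\<close>

lemma hill_sol_variation: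
  assumes F: "fundamental c y1 u1 y2 u2"
  shows "y = (y1 x * u - u1 x * y) * y2 x - (y2 x * u - u2 x * y) * y1 x"
    "u = (y1 x * u - u1 x * y) * u2 x - (y2 x * u - u2 x * y) * u1 x"
proof -
  have "(y1 x * u - u1 x * y) * y2 x - (y2 x * u - u2 x * y) * y1 x = y * (y1 x * u2 x - u1 x * y2 x)"
   "(y1 x * u - u1 x * y) * u2 x - (y2 x * u - u2 x * y) * u1 x = u * (y1 x * u2 x - u1 x * y2 x)"
    by (simp_all add: algebra_simps)
  then show "y = (y1 x * u - u1 x * y) * y2 x - (y2 x * u - u2 x * y) * y1 x"
    "u = (y1 x * u - u1 x * y) * u2 x - (y2 x * u - u2 x * y) * u1 x"
    unfolding fundamental_det[OF F] by simp_all
qed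

lemma ac_deriv_constant_on_ray:
  assumes w: "ac_deriv w k" and S: "S = {a..} \<or> S = {..a}" and z: "\<And>x. x \<in> S \<Longrightarrow> k x = 0" and x: "x \<in> S"
  shows "w x = w a"
proof (cases "a \<le> x")
  case True
  have "(LINT t:{a..x}|lborel. k t) = (LINT t:{a..x}|lborel. 0)"
    by (rule set_lebesgue_integral_cong) (use S z x True in auto)
  then show ?thesis using ac_deriv_integral[OF w True] by simp
next
  case False
  have "(LINT t:{x..a}|lborel. k t) = (LINT t:{x..a}|lborel. 0)"
    by (rule set_lebesgue_integral_cong) (use S z x False in auto)
  then show ?thesis using ac_deriv_integral[OF w, of x a] False by simp
qed

text \<open>On the ray the constant Wronskians identify \<open>y\<close> with a homogeneous solution
  \<open>Z\<close>. This one is square integrable there, hence zero, and continuity carries no extra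
  burden because \<open>a\<close> belongs to the ray.\<close>

lemma L2_forced_sol_zero_outside:
  assumes Sol: "hill_sol c f y u" and L: "L2 y" and D: "discriminant c = 2 * complex_of_real (cos t)"
    and S: "S = {a..} \<or> S = {..a}" and z: "\<And>x. x \<in> S \<Longrightarrow> x \<noteq> a \<Longrightarrow> f x = 0"
  shows "y a = 0 \<and> u a = 0"
proof -
  obtain y1 u1 y2 u2 where F: "fundamental c y1 u1 y2 u2" by (rule fundamental_exists)
  have S12: "homog_sol c y1 u1" "homog_sol c y2 u2" using F by (auto simp: fundamental_def)
  define k1 k2 where "k1 = y1 a * u a - u1 a * y a" and "k2 = y2 a * u a - u2 a * y a"
  have const: "z x * u x - w x * y x = z a * u a - w a * y a"
    if Z: "homog_sol c z w" and x: "x \<in> S" for z w x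
  proof (rule ac_deriv_constant_on_ray[OF _ S _ x])
    \<comment> \<open>The forcing may be nonzero at the endpoint \<open>a\<close>, as for an
      indicator of a closed interval; resetting the derivative at one point makes it vanish on the
      whole ray.\<close>
    show "ac_deriv (\<lambda>x. z x * u x - w x * y x) (\<lambda>x. if x = a then 0 else - (f x * z x))"
    proof (rule ac_deriv_cong_AE[OF wronskian_deriv[OF Z Sol]])
      show "AE x in lborel. - (f x * z x) = (if x = a then 0 else - (f x * z x))"
        using AE_lborel_singleton[of a] by eventually_elim auto
      show "(\<lambda>x. if x = a then 0 else - (f x * z x)) \<in> borel_measurable borel"
        using ac_deriv_borel[OF wronskian_deriv[OF Z Sol]] by measurable
    qed
  qed (use z in auto)
  have rep: "y x = k1 * y2 x + (- k2) * y1 x" "u x = k1 * u2 x + (- k2) * u1 x" if "x \<in> S" for x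
    using hill_sol_variation(1)[OF F, of "y x" x "u x"] hill_sol_variation(2)[OF F, of "u x" x "y x"]
    unfolding const[OF S12(1) that] const[OF S12(2) that] k1_def[symmetric] k2_def[symmetric]
    by (simp_all only: mult_minus_left add_uminus_conv_diff)
  define Z where "Z x = k1 * y2 x + (- k2) * y1 x" for x
  have Zs: "homog_sol c Z (\<lambda>x. k1 * u2 x + (- k2) * u1 x)"
    unfolding Z_def by (rule hill_sol_lincomb[OF S12(2) S12(1)])
  have "set_integrable lborel S (\<lambda>x. (cmod (y x))\<^sup>2)"
    unfolding set_integrable_def by (intro integrable_mult_indicator L2_integrable[OF L]) (use S in auto)
  then have "set_integrable lborel S (\<lambda>x. (cmod (Z x))\<^sup>2)"
    by (rule set_integrable_cong[THEN iffD1, rotated -1]) (use rep in \<open>auto simp: Z_def\<close>)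
  then have "half_line_L2 Z" using S unfolding half_line_L2_def by blast
  from half_line_L2_hill_sol_zero[OF Zs this D, of a]
  show ?thesis using rep[of a] S by (auto simp: Z_def)
qed

end

section \<open>The operator and points of its spectrum\<close>

lemma set_integrable_continuous:
  fixes f :: "real \<Rightarrow> 'a::{real_normed_field,euclidean_space}"
  assumes "continuous_on UNIV f"
  shows "set_integrable lborel {a..b} f"
  using set_integrable_mult_continuous[OF continuous_on_subset[OF assms] borel_measurable_continuous_onI[OF assms] set_integrable_Icc_const[of a b 1]]
  by simp

lemma L2_indicator_continuous:
  assumes "continuous_on UNIV f"
  shows "L2 (\<lambda>x. of_real (indicator {a..b} x) * f x)"
  unfolding L2_def
proof
  have [measurable]: "f \<in> borel_measurable borel" by (rule borel_measurable_continuous_onI[OF assms])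
  show "(\<lambda>x. of_real (indicator {a..b} x) * f x) \<in> borel_measurable lborel" by measurable
  have "continuous_on UNIV (\<lambda>x. (cmod (f x))\<^sup>2)" by (intro continuous_intros assms)
  from set_integrable_continuous[OF this, of a b]
  have "integrable lborel (\<lambda>x. indicator {a..b} x *\<^sub>R (cmod (f x))\<^sup>2)" unfolding set_integrable_def .
  also have "(\<lambda>x. indicator {a..b} x *\<^sub>R (cmod (f x))\<^sup>2) = (\<lambda>x. (cmod (of_real (indicator {a..b} x) * f x))\<^sup>2)"
    by (auto simp: indicator_def)
  finally show "integrable lborel (\<lambda>x. (cmod (of_real (indicator {a..b} x) * f x))\<^sup>2)" .
qed

context hill_potential begin

lemma hill_sol_cong_AE:
  assumes "hill_sol c f y u" "AE x in lborel. f x = g x" "g \<in> borel_measurable borel"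
  shows "hill_sol c g y u"
proof -
  note [measurable] = hill_sol_borel[OF assms(1)] assms(3)
  have "ac_deriv u (\<lambda>x. (c - (Q x)\<^sup>2) * y x - Q x * u x - g x)"
    by (rule ac_deriv_cong_AE[of u "\<lambda>x. (c - (Q x)\<^sup>2) * y x - Q x * u x - f x"])
      (use assms in \<open>auto simp: hill_sol_def elim: eventually_mono\<close>)
  then show ?thesis using assms(1) by (simp add: hill_sol_def)
qed

lemma hill_sol_spectral_shift:
  "hill_sol (c - l) (\<lambda>x. f x - l * y x) y u \<longleftrightarrow> hill_sol c f y u"
proof -
  have "(\<lambda>x. (c - l - (Q x)\<^sup>2) * y x - Q x * u x - (f x - l * y x)) = (\<lambda>x. (c - (Q x)\<^sup>2) * y x - Q x * u x - f x)"
    by (auto simp: algebra_simps)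
  then show ?thesis unfolding hill_sol_def by simp
qed

text \<open>The functions \<open>y'\<close> and \<open>u'\<close> in the graph are determined almost
  everywhere by \<open>yr\<close>, \<open>u\<close> and \<open>f\<close>. Eliminating them leaves
  the forced first order system with Borel right-hand sides.\<close>

lemma hill_graph_iff:
  "(y, f) \<in> hill_graph C Q \<longleftrightarrow> L2 y \<and> L2 f \<and>
     (\<exists>yr u. (AE x in lborel. yr x = y x) \<and> hill_sol C f yr u \<and> L2 (\<lambda>x. Q x * yr x + u x) \<and> L2 u)" (is "_ \<longleftrightarrow> ?R")
proof
  assume "(y, f) \<in> hill_graph C Q"
  then obtain yr y' u u' where *: "L2 y" "L2 f" "AE x in lborel. yr x = y x" "loc_ac_deriv yr y'" "L2 y'"
    "loc_ac_deriv u u'" "AE x in lborel. u x = y' x - Q x * yr x" "L2 u"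
    "AE x in lborel. f x = - u' x - Q x * y' x + C * yr x"
    unfolding hill_graph_def by auto
  have [measurable]: "yr \<in> borel_measurable borel" "u \<in> borel_measurable borel" "f \<in> borel_measurable borel"
    using loc_ac_deriv_continuous[OF *(4)] loc_ac_deriv_continuous[OF *(6)] L2_measurable[OF *(2)]
    by (auto intro: borel_measurable_continuous_onI)
  have y': "AE x in lborel. y' x = Q x * yr x + u x" using *(7) by eventually_elim simp
  have u': "AE x in lborel. u' x = (C - (Q x)\<^sup>2) * yr x - Q x * u x - f x"
    using y' *(9) by eventually_elim (simp add: power2_eq_square algebra_simps)
  have "ac_deriv yr (\<lambda>x. Q x * yr x + u x)"
    by (rule loc_ac_deriv_imp_ac_deriv[OF *(4) y']) measurable
  moreover have "ac_deriv u (\<lambda>x. (C - (Q x)\<^sup>2) * yr x - Q x * u x - f x)"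
    by (rule loc_ac_deriv_imp_ac_deriv[OF *(6) u']) measurable
  moreover have "L2 (\<lambda>x. Q x * yr x + u x)"
    by (rule L2_cong_AE[OF *(5) y']) measurable
  ultimately show ?R
    using * unfolding hill_sol_def by blast
next
  assume ?R
  then obtain yr u where *: "L2 y" "L2 f" "AE x in lborel. yr x = y x" "hill_sol C f yr u"
    "L2 (\<lambda>x. Q x * yr x + u x)" "L2 u" by auto
  have "loc_ac_deriv yr (\<lambda>x. Q x * yr x + u x)" "loc_ac_deriv u (\<lambda>x. (C - (Q x)\<^sup>2) * yr x - Q x * u x - f x)"
    using *(4) by (auto simp: hill_sol_def intro: ac_deriv_imp_loc_ac_deriv)
  moreover have "AE x in lborel. u x = (Q x * yr x + u x) - Q x * yr x" by simp
  moreover have "AE x in lborel. f x = - ((C - (Q x)\<^sup>2) * yr x - Q x * u x - f x) - Q x * (Q x * yr x + u x) + C * yr x"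
    by (simp add: power2_eq_square algebra_simps)
  ultimately show "(y, f) \<in> hill_graph C Q"
    unfolding hill_graph_def mem_Collect_eq prod.case using * by blast
qed

lemma hill_graph_zero: "((\<lambda>x. 0), (\<lambda>x. 0)) \<in> hill_graph C Q"
  unfolding hill_graph_iff
  by (auto intro!: L2_zero exI[of _ "\<lambda>x. 0"] simp: hill_sol_def ac_deriv_const)

lemma hill_graph_add:
  assumes "(y, f) \<in> hill_graph C Q" "(z, g) \<in> hill_graph C Q"
  shows "((\<lambda>x. y x + z x), (\<lambda>x. f x + g x)) \<in> hill_graph C Q"
proof -
  from assms obtain yr u zr w where *: "L2 y" "L2 f" "L2 z" "L2 g"
    "AE x in lborel. yr x = y x" "hill_sol C f yr u" "L2 (\<lambda>x. Q x * yr x + u x)" "L2 u"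
    "AE x in lborel. zr x = z x" "hill_sol C g zr w" "L2 (\<lambda>x. Q x * zr x + w x)" "L2 w"
    unfolding hill_graph_iff by auto
  have "AE x in lborel. yr x + zr x = y x + z x" using *(5,9) by eventually_elim simp
  moreover have "L2 (\<lambda>x. Q x * (yr x + zr x) + (u x + w x))"
    using L2_add[OF *(7,11)] by (simp add: algebra_simps)
  ultimately show ?thesis
    unfolding hill_graph_iff using L2_add[OF *(1,3)] L2_add[OF *(2,4)] L2_add[OF *(8,12)] hill_sol_add[OF *(6,10)]
    by (intro conjI exI[of _ "\<lambda>x. yr x + zr x"] exI[of _ "\<lambda>x. u x + w x"])
qed

lemma hill_graph_cmult:
  assumes "(y, f) \<in> hill_graph C Q"
  shows "((\<lambda>x. k * y x), (\<lambda>x. k * f x)) \<in> hill_graph C Q"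
proof -
  from assms obtain yr u where *: "L2 y" "L2 f"
    "AE x in lborel. yr x = y x" "hill_sol C f yr u" "L2 (\<lambda>x. Q x * yr x + u x)" "L2 u"
    unfolding hill_graph_iff by auto
  have "AE x in lborel. k * yr x = k * y x" using *(3) by eventually_elim simp
  moreover have "L2 (\<lambda>x. Q x * (k * yr x) + k * u x)"
    using L2_cmult[OF *(5), of k] by (simp add: algebra_simps)
  ultimately show ?thesis
    unfolding hill_graph_iff using L2_cmult[OF *(1)] L2_cmult[OF *(2)] L2_cmult[OF *(6)] hill_sol_cmult[OF *(4)]
    by (intro conjI exI[of _ "\<lambda>x. k * yr x"] exI[of _ "\<lambda>x. k * u x"])
qed

lemma hill_graph_cong_AE:
  assumes "(y, f) \<in> hill_graph C Q" "AE x in lborel. y x = z x" "AE x in lborel. f x = g x" "L2 z" "L2 g"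
  shows "(z, g) \<in> hill_graph C Q"
proof -
  from assms(1) obtain yr u where *: "AE x in lborel. yr x = y x" "hill_sol C f yr u" "L2 (\<lambda>x. Q x * yr x + u x)" "L2 u"
    unfolding hill_graph_iff by auto
  have "AE x in lborel. yr x = z x" using *(1) assms(2) by eventually_elim simp
  then show ?thesis
    unfolding hill_graph_iff using * assms(4,5) hill_sol_cong_AE[OF *(2) assms(3) L2_measurable[OF assms(5)]] by blast
qed

lemma hill_graph_resolvent_equation:
  assumes "(y, g) \<in> hill_graph C Q" and f: "AE x in lborel. g x - lam * y x = f x" "f \<in> borel_measurable borel"
  obtains yr u where "AE x in lborel. yr x = y x" "L2 yr" "hill_sol (C - lam) f yr u"
proof -
  from assms(1) obtain yr u where *: "L2 y" "L2 g"
    "AE x in lborel. yr x = y x" "hill_sol C g yr u"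
    unfolding hill_graph_iff by auto
  have "AE x in lborel. g x - lam * yr x = f x" using *(3) f(1) by eventually_elim simp
  then have "hill_sol (C - lam) f yr u"
    using hill_sol_cong_AE[OF _ _ f(2)] *(4) hill_sol_spectral_shift by blast
  moreover have "L2 yr"
    by (rule L2_cong_AE[OF *(1)]) (use *(3) hill_sol_borel[OF *(4)] in \<open>auto elim: eventually_mono\<close>)
  ultimately show ?thesis using that *(3) by blast
qed

lemma hill_graph_kernel:
  assumes "(y, g) \<in> hill_graph C Q" "AE x in lborel. g x = lam * y x"
  shows "AE x in lborel. y x = 0"
proof -
  have "AE x in lborel. g x - lam * y x = 0" using assms(2) by eventually_elim simp
  from hill_graph_resolvent_equation[OF assms(1) this]
  obtain yr u where *: "AE x in lborel. yr x = y x" "L2 yr" "homog_sol (C - lam) yr u" by auto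
  then show ?thesis using L2_hill_sol_zero[OF *(3,2)] by auto
qed

lemma hill_sol_zero_of_integral_zero:
  assumes S: "homog_sol c y u" and I: "(LINT x:{0..pi}|lborel. (cmod (y x))\<^sup>2) = 0"
  shows "y x = 0"
proof -
  have "set_integrable lborel {0..pi} (\<lambda>x. (cmod (y x))\<^sup>2)"
    by (intro set_integrable_continuous continuous_intros hill_sol_cont[OF S])
  then have "AE x in lborel. indicator {0..pi} x *\<^sub>R (cmod (y x))\<^sup>2 = 0"
    using I unfolding set_lebesgue_integral_def set_integrable_def
    by (subst (asm) integral_nonneg_eq_0_iff_AE) auto
  then have "AE x in lborel. x \<in> {0<..<pi} \<longrightarrow> y x = 0"
    by eventually_elim (auto simp: indicator_def split: if_splits)
  then have "y x = 0" if "x \<in> {0<..<pi}" for x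
    using continuous_AE_eq_imp_eq[OF hill_sol_cont(1)[OF S] continuous_on_const open_greaterThanLessThan _ that] by blast
  then show ?thesis using hill_sol_zero_interval[OF S, of 0 pi] by simp
qed

text \<open>For a nonzero solution \<open>z\<close> of the homogeneous equation, the right-hand side \<open>f\<close> equal to the conjugate of \<open>z\<close> on \<open>[0, \<pi>]\<close>
  and zero elsewhere has no \<open>L\<^sup>2\<close> preimage: such a preimage would vanish outside \<open>[0, \<pi>]\<close>, forcing
  \<open>\<integral> f z = 0\<close>.\<close>
lemma not_surjective:
  assumes D: "discriminant (C - lam) = 2 * complex_of_real (cos t)"
  shows "\<exists>f. L2 f \<and> \<not> (\<exists>(y, g)\<in>hill_graph C Q. AE x in lborel. g x - lam * y x = f x)"
proof -
  obtain z w z2 w2 where F: "fundamental (C - lam) z w z2 w2" by (rule fundamental_exists)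
  then have Z: "homog_sol (C - lam) z w" and z0: "z 0 = 1" by (auto simp: fundamental_def)
  define f where "f x = of_real (indicator {0..pi} x) * cnj (z x)" for x
  have fL: "L2 f" unfolding f_def
    by (intro L2_indicator_continuous continuous_intros hill_sol_cont[OF Z])
  have False if yg: "(y, g) \<in> hill_graph C Q" "AE x in lborel. g x - lam * y x = f x" for y g
  proof -
    obtain yr u where *: "L2 yr" "hill_sol (C - lam) f yr u"
      by (rule hill_graph_resolvent_equation[OF yg L2_measurable[OF fL]])
    have r: "yr pi = 0 \<and> u pi = 0"
      by (rule L2_forced_sol_zero_outside[OF *(2,1) D, of "{pi..}"]) (auto simp: f_def)
    have l: "yr 0 = 0 \<and> u 0 = 0"
      by (rule L2_forced_sol_zero_outside[OF *(2,1) D, of "{..0}"]) (auto simp: f_def)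
    have "(LINT x:{0..pi}|lborel. - (f x * z x)) = 0"
      using ac_deriv_integral[OF wronskian_deriv[OF Z *(2)], of 0 pi] r l by simp
    also have "(LINT x:{0..pi}|lborel. - (f x * z x)) = (LINT x:{0..pi}|lborel. complex_of_real (- (cmod (z x))\<^sup>2))"
      by (rule set_lebesgue_integral_cong) (auto simp: f_def complex_norm_square simp del: of_real_power)
    also have "\<dots> = complex_of_real (LINT x:{0..pi}|lborel. - (cmod (z x))\<^sup>2)"
      by (rule set_integral_complex_of_real)
    finally have "(LINT x:{0..pi}|lborel. - (cmod (z x))\<^sup>2) = 0" by simp
    then have "(LINT x:{0..pi}|lborel. (cmod (z x))\<^sup>2) = 0"
      by (simp add: set_lebesgue_integral_def)
    from hill_sol_zero_of_integral_zero[OF Z this, of 0] z0 show False by simp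
  qed
  with fL show ?thesis by blast
qed

text \<open>The real part of \<open>\<integral> (u cnj y)' = 0\<close> over a period bounds \<open>K \<integral>\<bar>y\<bar>\<^sup>2 + \<integral>\<bar>y'\<bar>\<^sup>2\<close> by \<open>2 \<integral>\<bar>Q\<bar>\<bar>y\<bar>\<bar>y'\<bar>\<close>. By the Sobolev inequality
  \<open>sup \<bar>y\<bar>\<^sup>2 \<le> d \<integral>\<bar>y'\<bar>\<^sup>2 + (1/\<pi> + 1/d) \<integral>\<bar>y\<bar>\<^sup>2\<close> with \<open>d = 1/(4(q + 1))\<close>, the right side is absorbed for this \<open>K\<close>.\<close>
lemma Q_energy_bound:
  assumes S: "homog_sol (of_real K) y u" and m: "y pi = m * y 0" "u pi = m * u 0" "cmod m = 1"
    and q: "q = (LINT x:{0..pi}|lborel. (cmod (Q x))\<^sup>2)"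
    and K: "K = 2 * q * (1 / pi + 4 * (q + 1)) + 1"
  shows "(LINT x:{0..pi}|lborel. (cmod (y x))\<^sup>2) \<le> 0"
proof -
  define v where "v x = Q x * y x + u x" for x
  let ?Y = "\<lambda>x. (cmod (y x))\<^sup>2" and ?V = "\<lambda>x. (cmod (v x))\<^sup>2"
  let ?Q = "\<lambda>x. (cmod (Q x))\<^sup>2" and ?U = "\<lambda>x. (cmod (u x))\<^sup>2"
  define IY where "IY = (LINT x:{0..pi}|lborel. ?Y x)"
  define IV where "IV = (LINT x:{0..pi}|lborel. ?V x)"
  note yc = hill_sol_cont(1)[OF S, of UNIV] and uc = hill_sol_cont(2)[OF S, of UNIV]
  note [measurable] = hill_sol_borel[OF S]
  have vm[measurable]: "v \<in> borel_measurable borel" unfolding v_def by measurable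
  have iY: "set_integrable lborel {0..pi} ?Y"
    by (intro set_integrable_continuous continuous_intros yc)
  have iQY: "set_integrable lborel {0..pi} (\<lambda>x. ?Y x * ?Q x)"
    by (rule set_integrable_mult_continuous[OF _ _ Q_sq_integrable])
      (auto intro!: continuous_intros continuous_on_subset[OF yc])
  have iV: "set_integrable lborel {0..pi} ?V"
  proof (rule set_integrable_bound)
    show "set_integrable lborel {0..pi} (\<lambda>x. 2 * (?Y x * ?Q x) + 2 * ?U x)"
      by (intro set_integral_add set_integrable_mult_right iQY set_integrable_continuous continuous_intros uc)
    show "set_borel_measurable lborel {0..pi} ?V" unfolding set_borel_measurable_def by measurable
    have "?V x \<le> 2 * (?Y x * ?Q x) + 2 * ?U x" for x
      using cmod_add_sq_le[of "Q x * y x" "u x"] by (simp add: v_def norm_mult power_mult_distrib mult_ac)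
    then show "AE x in lborel. x \<in> {0..pi} \<longrightarrow> norm (?V x) \<le> norm (2 * (?Y x * ?Q x) + 2 * ?U x)"
      by (auto intro: order_trans[OF _ abs_ge_self])
  qed
  have IY0: "0 \<le> IY" and IV0: "0 \<le> IV" unfolding IY_def IV_def set_lebesgue_integral_def by (auto intro!: integral_nonneg_AE)
  have q0: "0 \<le> q" unfolding q set_lebesgue_integral_def by (auto intro!: integral_nonneg_AE)
  have yd: "ac_deriv y v" and ud: "ac_deriv u (\<lambda>x. (of_real K - (Q x)\<^sup>2) * y x - Q x * u x - 0)"
    using S unfolding hill_sol_def v_def by auto

  define k where "k x = ((of_real K - (Q x)\<^sup>2) * y x - Q x * u x - 0) * cnj (y x) + u x * cnj (v x)" for x
  have kd: "ac_deriv (\<lambda>x. u x * cnj (y x)) k"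
    unfolding k_def by (rule ac_deriv_mult[OF ud ac_deriv_cnj[OF yd]])
  \<comment> \<open>A unimodular multiplier makes the boundary values of \<open>u * cnj y\<close> at
    0 and \<open>pi\<close> equal.\<close>
  have "cnj m * m = 1" using complex_norm_square[of m] m(3) by (simp add: mult.commute)
  then have "u pi * cnj (y pi) = u 0 * cnj (y 0)" unfolding m(1,2) by (simp add: mult_ac)
  then have "(LINT x:{0..pi}|lborel. k x) = 0" using ac_deriv_integral[OF kd, of 0 pi] by simp
  then have "Re (LINT x|lborel. indicator {0..pi} x *\<^sub>R k x) = 0" unfolding set_lebesgue_integral_def by simp
  then have Rek: "(LINT x:{0..pi}|lborel. Re (k x)) = 0"
    using integral_Re[OF ac_deriv_integrable[OF kd, of 0 pi, unfolded set_integrable_def]]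
    unfolding set_lebesgue_integral_def by simp
  have iRek: "set_integrable lborel {0..pi} (\<lambda>x. Re (k x))"
    using integrable_Re[OF ac_deriv_integrable[OF kd, of 0 pi, unfolded set_integrable_def]]
    unfolding set_integrable_def by simp
  have kge: "K * ?Y x + (1/2) * ?V x - 2 * (?Y x * ?Q x) \<le> Re (k x)" for x
  proof -
    have "k x = of_real K * (y x * cnj (y x)) + v x * cnj (v x) - (Q x * v x * cnj (y x) + Q x * y x * cnj (v x))"
      unfolding k_def v_def by (simp add: power2_eq_square algebra_simps)
    then have "Re (k x) = K * ?Y x + ?V x - Re (Q x * v x * cnj (y x) + Q x * y x * cnj (v x))"
      unfolding complex_norm_square[symmetric] by simp
    moreover have "Re (Q x * v x * cnj (y x) + Q x * y x * cnj (v x)) \<le> cmod (Q x * v x * cnj (y x) + Q x * y x * cnj (v x))"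
      by (rule complex_Re_le_cmod)
    moreover have "\<dots> \<le> 2 * (cmod (v x) * (cmod (Q x) * cmod (y x)))"
      using norm_triangle_ineq[of "Q x * v x * cnj (y x)" "Q x * y x * cnj (v x)"] by (simp add: norm_mult mult_ac)
    \<comment> \<open>Young's inequality is weighted so that only half of the available
      \<open>?V x\<close> is spent; the other half has to absorb the Sobolev term.\<close>
    moreover have "2 * (cmod (v x) * (cmod (Q x) * cmod (y x))) \<le> (1/2) * ?V x + 2 * (?Y x * ?Q x)"
      using zero_le_power2[of "cmod (v x) - 2 * (cmod (Q x) * cmod (y x))"]
      by (simp add: power2_eq_square algebra_simps)
    ultimately show ?thesis by linarith
  qed
  have "K * IY + (1/2) * IV - 2 * (LINT x:{0..pi}|lborel. ?Y x * ?Q x)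
     = (LINT x:{0..pi}|lborel. K * ?Y x + (1/2) * ?V x - 2 * (?Y x * ?Q x))"
    unfolding IY_def IV_def using iY iV iQY by (simp add: set_integral_diff set_integral_add)
  also have "\<dots> \<le> (LINT x:{0..pi}|lborel. Re (k x))"
    by (rule set_integral_mono[OF _ iRek kge])
      (intro set_integral_diff set_integral_add set_integrable_mult_right iY iV iQY)
  finally have en: "K * IY + (1/2) * IV \<le> 2 * (LINT x:{0..pi}|lborel. ?Y x * ?Q x)"
    unfolding Rek by simp

  \<comment> \<open>The factor 4 makes \<open>2 * q * d\<close> at most 1/2, which is what remains
    in front of \<open>IV\<close>; \<open>q + 1\<close> avoids division by zero when
    \<open>Q\<close> vanishes.\<close>
  define d where "d = 1 / (4 * (q + 1))"
  have d0: "0 < d" using q0 by (simp add: d_def)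
  let ?E = "d * IV + (1/d) * IY"
  have dd: "ac_deriv (\<lambda>x. y x * cnj (y x)) (\<lambda>x. v x * cnj (y x) + y x * cnj (v x))"
    by (rule ac_deriv_mult[OF yd ac_deriv_cnj[OF yd]])
  have dbound: "cmod (v x * cnj (y x) + y x * cnj (v x)) \<le> d * ?V x + (1/d) * ?Y x" for x
  proof -
    have "cmod (v x * cnj (y x) + y x * cnj (v x)) \<le> 2 * (cmod (v x) * cmod (y x))"
      using norm_triangle_ineq[of "v x * cnj (y x)" "y x * cnj (v x)"] by (simp add: norm_mult mult_ac)
    also have "\<dots> \<le> d * ?V x + (1/d) * ?Y x"
    proof -
      have "0 \<le> (1/d) * (d * cmod (v x) - cmod (y x))\<^sup>2" using d0 by simp
      also have "\<dots> = d * ?V x + (1/d) * ?Y x - 2 * (cmod (v x) * cmod (y x))"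
        using d0 by (simp add: power2_eq_square field_simps)
      finally show ?thesis by simp
    qed
    finally show ?thesis .
  qed
  have inc: "cmod (y b * cnj (y b) - y a * cnj (y a)) \<le> ?E" if ab: "0 \<le> a" "a \<le> b" "b \<le> pi" for a b
  proof -
    have "cmod (y b * cnj (y b) - y a * cnj (y a)) \<le> (LINT x:{a..b}|lborel. cmod (v x * cnj (y x) + y x * cnj (v x)))"
      unfolding ac_deriv_integral[OF dd ab(2), symmetric] by (rule set_integral_norm_bound[OF ac_deriv_integrable[OF dd]])
    also have "\<dots> \<le> (LINT x:{0..pi}|lborel. d * ?V x + (1/d) * ?Y x)"
      unfolding set_lebesgue_integral_def
    proof (rule integral_mono)
      show "integrable lborel (\<lambda>x. indicator {a..b} x *\<^sub>R cmod (v x * cnj (y x) + y x * cnj (v x)))"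
        using set_integrable_norm[OF ac_deriv_integrable[OF dd, of a b]] unfolding set_integrable_def .
      have "set_integrable lborel {0..pi} (\<lambda>x. d * ?V x + (1/d) * ?Y x)"
        by (intro set_integral_add set_integrable_mult_right iY iV)
      then show "integrable lborel (\<lambda>x. indicator {0..pi} x *\<^sub>R (d * ?V x + (1/d) * ?Y x))"
        unfolding set_integrable_def .
      fix x
      have "0 \<le> d * ?V x + (1/d) * ?Y x" using d0 by simp
      then show "indicator {a..b} x *\<^sub>R cmod (v x * cnj (y x) + y x * cnj (v x)) \<le> indicator {0..pi} x *\<^sub>R (d * ?V x + (1/d) * ?Y x)"
        using dbound[of x] ab by (auto simp: indicator_def)
    qed
    also have "\<dots> = ?E"
      unfolding IY_def IV_def using iY iV by (simp add: set_integral_add)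
    finally show ?thesis .
  qed
  have osc: "?Y x \<le> ?Y t + ?E" if xt: "x \<in> {0..pi}" "t \<in> {0..pi}" for x t
  proof -
    have "cmod (y x * cnj (y x) - y t * cnj (y t)) \<le> ?E"
      using inc[of x t] inc[of t x] xt by (cases "x \<le> t") (auto simp: norm_minus_commute)
    then have "\<bar>?Y x - ?Y t\<bar> \<le> ?E"
      unfolding complex_norm_square[symmetric] of_real_diff[symmetric] norm_of_real .
    then show ?thesis by linarith
  qed
  have sup: "?Y x \<le> (1 / pi) * IY + ?E" if x: "x \<in> {0..pi}" for x
  proof -
    have c: "(LINT t:{0..pi}|lborel. r) = pi * r" for r :: real
      unfolding set_lebesgue_integral_def by simp
    \<comment> \<open>Averaging the oscillation bound over the free point \<open>t\<close> turns it
      into a bound for the supremum.\<close>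
    have "pi * ?Y x = (LINT t:{0..pi}|lborel. ?Y x)" unfolding c ..
    also have "\<dots> \<le> (LINT t:{0..pi}|lborel. ?Y t + ?E)"
      by (rule set_integral_mono[OF set_integrable_Icc_const set_integral_add(1)[OF iY set_integrable_Icc_const] osc[OF x]])
    also have "\<dots> = IY + pi * ?E"
      unfolding IY_def[symmetric] set_integral_add(2)[OF iY set_integrable_Icc_const] c by simp
    finally have "?Y x \<le> (IY + pi * ?E) / pi" by (simp add: le_divide_eq mult.commute)
    also have "\<dots> = (1 / pi) * IY + ?E" by (simp add: add_divide_distrib)
    finally show ?thesis .
  qed
  have "(LINT x:{0..pi}|lborel. ?Y x * ?Q x) \<le> (LINT x:{0..pi}|lborel. ((1 / pi) * IY + ?E) * ?Q x)"
    by (rule set_integral_mono[OF iQY set_integrable_mult_right[OF Q_sq_integrable]])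
      (intro mult_right_mono sup zero_le_power2)
  also have "\<dots> = ((1 / pi) * IY + ?E) * q" unfolding q by simp
  finally have "K * IY + (1/2) * IV \<le> 2 * (((1 / pi) * IY + ?E) * q)" using en by linarith
  moreover have "2 * (((1 / pi) * IY + ?E) * q) = (2 * q * (1 / pi + 1 / d)) * IY + (2 * q * d) * IV"
    by (simp add: algebra_simps)
  moreover have "(2 * q * d) * IV \<le> (1/2) * IV"
    by (rule mult_right_mono[OF _ IV0]) (use q0 in \<open>simp add: d_def field_simps\<close>)
  moreover have "K = 2 * q * (1 / pi + 1 / d) + 1" unfolding K d_def by simp
  ultimately have "(2 * q * (1 / pi + 1 / d) + 1) * IY \<le> (2 * q * (1 / pi + 1 / d)) * IY" by simp
  then have "IY \<le> 0" by (simp add: distrib_right)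
  then show ?thesis unfolding IY_def .
qed

text \<open>A discriminant of the form \<open>2 cos t\<close> would provide a nonzero Floquet
  solution with unimodular multiplier, against the energy bound. The constant \<open>K\<close>
  depends on the norm of \<open>Q\<close> over one period only, so one value excludes all
  \<open>t\<close>.\<close>

lemma discriminant_outside_exists:
  obtains K where "\<And>t. discriminant (of_real K) \<noteq> 2 * complex_of_real (cos t)"
proof -
  define q where "q = (LINT x:{0..pi}|lborel. (cmod (Q x))\<^sup>2)"
  define K where "K = 2 * q * (1 / pi + 4 * (q + 1)) + 1"
  have False if D: "discriminant (of_real K) = 2 * complex_of_real (cos t)" for t
  proof -
    obtain m n where r: "m * n = 1" "m + n = discriminant (of_real K)" by (rule reciprocal_roots)
    have m1: "cmod m = 1" using unimodular_roots(1)[OF r(1)] r(2) D by auto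
    obtain y u where S: "homog_sol (of_real K) y u" "\<And>x. y (x + pi) = m * y x" "\<And>x. u (x + pi) = m * u x" "\<exists>x. y x \<noteq> 0"
      using floquet_sol_exists[OF r] by blast
    have "(LINT x:{0..pi}|lborel. (cmod (y x))\<^sup>2) \<le> 0"
      by (rule Q_energy_bound[OF S(1) _ _ m1 q_def K_def]) (use S(2)[of 0] S(3)[of 0] in auto)
    moreover have "0 \<le> (LINT x:{0..pi}|lborel. (cmod (y x))\<^sup>2)"
      unfolding set_lebesgue_integral_def by (auto intro!: integral_nonneg_AE)
    ultimately have "(LINT x:{0..pi}|lborel. (cmod (y x))\<^sup>2) = 0" by linarith
    from hill_sol_zero_of_integral_zero[OF S(1) this] S(4) show False by blast
  qed
  then show ?thesis using that by blast
qed

end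

section \<open>Convolution with exponentials\<close>

lemma periodic_reduce:
  fixes h :: "real \<Rightarrow> 'b"
  assumes "\<And>x. h (x + pi) = h x"
  obtains s where "s \<in> {0..pi}" "h x = h s"
proof -
  have *: "h (x + of_int n * pi) = h x" for n :: int and x
  proof (induction n rule: int_induct[where k=0])
    case (step1 i)
    then show ?case using assms[of "x + of_int i * pi"] by (simp add: algebra_simps)
  next
    case (step2 i)
    then show ?case using assms[of "x + of_int (i - 1) * pi"] by (simp add: algebra_simps)
  qed simp
  have "of_int \<lfloor>x / pi\<rfloor> \<le> x / pi" "x / pi < of_int \<lfloor>x / pi\<rfloor> + 1" by linarith+
  then have "of_int \<lfloor>x / pi\<rfloor> * pi \<le> x" "x < (of_int \<lfloor>x / pi\<rfloor> + 1) * pi"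
    by (simp_all only: pos_le_divide_eq[OF pi_gt_zero] pos_divide_less_eq[OF pi_gt_zero])
  then have "of_int \<lfloor>x / pi\<rfloor> * pi \<le> x" "x \<le> of_int \<lfloor>x / pi\<rfloor> * pi + pi"
    by (simp_all add: distrib_right)
  then have "x + of_int (- \<lfloor>x / pi\<rfloor>) * pi \<in> {0..pi}" by simp
  then show ?thesis using that *[of x "- \<lfloor>x / pi\<rfloor>"] by metis
qed

text \<open>Multiplying \<open>cmod (g x)\<close> by \<open>exp (k * x)\<close> gives a continuous
  periodic function, which is bounded.\<close>

lemma multiplier_exp_bound:
  fixes g :: "real \<Rightarrow> complex"
  assumes c: "continuous_on UNIV g" and m: "\<And>x. g (x + pi) = m * g x" "cmod m = exp (- k * pi)"
  obtains K where "0 \<le> K" "\<And>x. cmod (g x) \<le> K * exp (- k * x)"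
proof -
  define h where "h x = cmod (g x) * exp (k * x)" for x
  have per: "h (x + pi) = h x" for x
    unfolding h_def m(1) norm_mult m(2) by (simp add: exp_add exp_minus field_simps)
  have "continuous_on {0..pi} h" unfolding h_def by (intro continuous_intros continuous_on_subset[OF c]) auto
  then have "bounded (h ` {0..pi})" by (intro compact_imp_bounded compact_continuous_image) auto
  then obtain K where K: "\<And>x. x \<in> {0..pi} \<Longrightarrow> \<bar>h x\<bar> \<le> K" unfolding bounded_iff real_norm_def by blast
  have hK: "h x \<le> K" for x
  proof -
    obtain s where "s \<in> {0..pi}" "h x = h s" by (rule periodic_reduce[of h x, OF per])
    then show ?thesis using K[of s] by simp
  qed
  have "cmod (g x) \<le> K * exp (- k * x)" for x
    using hK[of x] unfolding h_def by (simp add: exp_minus field_simps)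
  moreover have "0 \<le> K" using K[of 0] by (smt (verit) abs_ge_zero atLeastAtMost_iff pi_ge_zero)
  ultimately show ?thesis using that by blast
qed

lemma nn_integral_set_integrable_finite:
  fixes w :: "real \<Rightarrow> real"
  assumes "\<And>x. 0 \<le> w x" "set_integrable lborel A w"
  shows "(\<integral>\<^sup>+x. ennreal (w x) * indicator A x \<partial>lborel) < \<infinity>"
proof -
  have "(\<integral>\<^sup>+x. ennreal (w x) * indicator A x \<partial>lborel) = (\<integral>\<^sup>+x. ennreal (indicator A x *\<^sub>R w x) \<partial>lborel)"
    by (rule nn_integral_cong) (auto simp: indicator_def)
  also have "\<dots> = ennreal (LINT x|lborel. indicator A x *\<^sub>R w x)"
    by (rule nn_integral_eq_integral) (use assms in \<open>auto simp: set_integrable_def\<close>)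
  finally show ?thesis by simp
qed

text \<open>Splitting off the first period gives \<open>J (Suc N) \<le> P + r * J N\<close> with
  \<open>r < 1\<close>, hence a bound by \<open>p / (1 - r)\<close> for all \<open>N\<close>. The
  integrals are truncated because the same inequality for the full integral would say nothing if
  that were infinite.\<close>

lemma periodic_exp_weight_half_line:
  fixes w :: "real \<Rightarrow> real"
  assumes [measurable]: "w \<in> borel_measurable borel" and w0: "\<And>x. 0 \<le> w x"
    and per: "AE x in lborel. w (x + pi) = w x" and i: "set_integrable lborel {0..pi} w" and k: "0 < k"
  shows "(\<integral>\<^sup>+x. ennreal (w x * exp (- k * x)) * indicator {0..} x \<partial>lborel) < \<infinity>"
proof -
  let ?v = "\<lambda>x. ennreal (w x * exp (- k * x))"
  define J where "J N = (\<integral>\<^sup>+x. ?v x * indicator {0..<real N * pi} x \<partial>lborel)" for N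
  define P where "P = (\<integral>\<^sup>+x. ennreal (w x) * indicator {0..pi} x \<partial>lborel)"
  have P: "P < \<infinity>" unfolding P_def by (rule nn_integral_set_integrable_finite[OF w0 i])
  define r where "r = exp (- k * pi)"
  have r: "0 < r" "r < 1" unfolding r_def using k by auto
  have step: "J (Suc N) \<le> P + ennreal r * J N" for N
  proof -
    have "(\<integral>\<^sup>+x. ?v x * indicator {pi..<real (Suc N) * pi} x \<partial>lborel)
       = ennreal \<bar>1\<bar> * (\<integral>\<^sup>+x. ennreal (w (pi + 1 * x) * exp (- k * (pi + 1 * x))) * indicator {pi..<real (Suc N) * pi} (pi + 1 * x) \<partial>lborel)"
      by (rule nn_integral_real_affine) simp_all
    also have "\<dots> = (\<integral>\<^sup>+x. ennreal r * (?v x * indicator {0..<real N * pi} x) \<partial>lborel)"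
    proof (simp only: abs_one ennreal_1 mult_1_left, rule nn_integral_cong_AE)
      show "AE x in lborel. ennreal (w (pi + x) * exp (- k * (pi + x))) * indicator {pi..<real (Suc N) * pi} (pi + x)
         = ennreal r * (?v x * indicator {0..<real N * pi} x)"
        using per
      proof eventually_elim
        case (elim x)
        have "ennreal (w (pi + x) * exp (- k * (pi + x))) = ennreal (r * (w x * exp (- k * x)))"
        proof -
          have "w (pi + x) = w x" using elim by (simp add: add.commute)
          moreover have "exp (- k * (pi + x)) = r * exp (- k * x)"
            unfolding r_def exp_add[symmetric] by (simp add: algebra_simps)
          ultimately show ?thesis by (simp add: mult_ac)
        qed
        also have "\<dots> = ennreal r * ?v x" using r w0 by (simp add: ennreal_mult')
        finally show ?case by (auto simp: indicator_def algebra_simps)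
      qed
    qed
    also have "\<dots> = ennreal r * J N" unfolding J_def by (rule nn_integral_cmult) measurable
    finally have tail: "(\<integral>\<^sup>+x. ?v x * indicator {pi..<real (Suc N) * pi} x \<partial>lborel) = ennreal r * J N" .
    have "J (Suc N) \<le> (\<integral>\<^sup>+x. ennreal (w x) * indicator {0..pi} x + ?v x * indicator {pi..<real (Suc N) * pi} x \<partial>lborel)"
      unfolding J_def
    proof (rule nn_integral_mono)
      fix x
      have "w x * exp (- k * x) \<le> w x * 1" if "0 \<le> x" using that k w0 by (intro mult_left_mono) auto
      then show "?v x * indicator {0..<real (Suc N) * pi} x
          \<le> ennreal (w x) * indicator {0..pi} x + ?v x * indicator {pi..<real (Suc N) * pi} x"
        by (cases "x < pi") (auto simp: indicator_def intro: ennreal_leI)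
    qed
    also have "\<dots> = P + (\<integral>\<^sup>+x. ?v x * indicator {pi..<real (Suc N) * pi} x \<partial>lborel)"
      unfolding P_def by (rule nn_integral_add) measurable
    finally show ?thesis unfolding tail .
  qed
  obtain p where p: "0 \<le> p" "P = ennreal p" using P by (cases P) auto
  have J: "J N \<le> ennreal (p / (1 - r))" for N
  proof (induction N)
    case 0 then show ?case by (simp add: J_def)
  next
    case (Suc N)
    have "J (Suc N) \<le> P + ennreal r * ennreal (p / (1 - r))"
      by (rule order_trans[OF step]) (intro add_left_mono mult_left_mono Suc, simp)
    also have "\<dots> = ennreal (p + r * (p / (1 - r)))"
    proof -
      have "ennreal r * ennreal (p / (1 - r)) = ennreal (r * (p / (1 - r)))"
        by (rule ennreal_mult[symmetric]) (use p r in auto)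
      moreover have "0 \<le> r * (p / (1 - r))" using p r by simp
      ultimately show ?thesis unfolding p(2) using p by (simp only: ennreal_plus)
    qed
    also have "p + r * (p / (1 - r)) = p / (1 - r)" using r by (simp add: field_simps)
    finally show ?case .
  qed
  let ?c = "\<lambda>N x. ?v x * indicator {0..<real N * pi} x"
  have "(\<integral>\<^sup>+x. ?v x * indicator {0..} x \<partial>lborel)
     = (\<integral>\<^sup>+x. liminf (\<lambda>N. ?c N x) \<partial>lborel)"
  proof (rule nn_integral_cong)
    fix x :: real
    obtain M :: nat where M: "x / pi < real M" using reals_Archimedean2 by blast
    have "\<forall>\<^sub>F N in sequentially. ?c N x = ?v x * indicator {0..} x"
    proof (rule eventually_sequentiallyI[of M])
      fix N assume "M \<le> N"
      then have "x / pi < real N" using M by linarith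
      then have "x < real N * pi" by (simp add: divide_less_eq)
      then show "?c N x = ?v x * indicator {0..} x"
        by (auto simp: indicator_def)
    qed
    then have "(\<lambda>N. ?c N x) \<longlonglongrightarrow> ?v x * indicator {0..} x"
      by (rule tendsto_eventually)
    then show "?v x * indicator {0..} x = liminf (\<lambda>N. ?c N x)"
      by (rule lim_imp_Liminf[OF sequentially_bot, symmetric])
  qed
  also have "\<dots> \<le> liminf J"
    unfolding J_def by (rule nn_integral_liminf) measurable
  also have "\<dots> \<le> liminf (\<lambda>N. ennreal (p / (1 - r)))"
    by (rule Liminf_mono) (use J in simp)
  also have "\<dots> = ennreal (p / (1 - r))" by (simp add: Liminf_const)
  finally show ?thesis using order.strict_trans1 by fastforce
qed

text \<open>The integral is periodic in the centre \<open>t\<close>, and moving the centre from a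
  point of \<open>[0, pi]\<close> to 0 costs at most the factor \<open>exp (k * pi)\<close>. It
  remains to treat centre 0, where the line splits into two half lines, one of them
  reflected.\<close>

lemma periodic_exp_weight_bound:
  fixes w :: "real \<Rightarrow> real"
  assumes w[measurable]: "w \<in> borel_measurable borel" and w0: "\<And>x. 0 \<le> w x"
    and per: "AE x in lborel. w (x + pi) = w x" and i: "\<And>a b. set_integrable lborel {a..b} w" and k: "0 < k"
  obtains B where "0 \<le> B" "\<And>t. (\<integral>\<^sup>+x. ennreal (w x * exp (- k * \<bar>x - t\<bar>)) \<partial>lborel) \<le> ennreal B"
proof -
  let ?R = "\<integral>\<^sup>+x. ennreal (w x * exp (- k * x)) * indicator {0..} x \<partial>lborel"
  let ?L = "\<integral>\<^sup>+x. ennreal (w (- x) * exp (- k * x)) * indicator {0..} x \<partial>lborel"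
  let ?L' = "\<integral>\<^sup>+x. ennreal (w x * exp (k * x)) * indicator {..0} x \<partial>lborel"
  define F where "F t = (\<integral>\<^sup>+x. ennreal (w x * exp (- k * \<bar>x - t\<bar>)) \<partial>lborel)" for t
  have right: "?R < \<infinity>"
    by (rule periodic_exp_weight_half_line[OF w w0 per i k])
  have left: "?L < \<infinity>"
  proof (rule periodic_exp_weight_half_line)
    show "AE x in lborel. w (- (x + pi)) = w (- x)"
      \<comment> \<open>Substituting \<open>-pi - x\<close> for \<open>x\<close> turns the
        periodicity of \<open>w\<close> into that of its reflection.\<close>
      using AE_lborel_affine[OF per, of "-1" "-pi"] by (simp add: algebra_simps eq_commute)
    have "integrable lborel (\<lambda>x. indicator {-pi..0} (0 + (-1) * x) *\<^sub>R w (0 + (-1) * x))"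
      by (rule lborel_integrable_real_affine[of "\<lambda>x. indicator {-pi..0} x *\<^sub>R w x"]) (use i[of "-pi" 0] in \<open>auto simp: set_integrable_def\<close>)
    also have "(\<lambda>x. indicator {-pi..0} (0 + (-1) * x) *\<^sub>R w (0 + (-1) * x)) = (\<lambda>x. indicator {0..pi} x *\<^sub>R w (- x))"
      by (auto simp: indicator_def)
    finally show "set_integrable lborel {0..pi} (\<lambda>x. w (- x))" unfolding set_integrable_def .
  qed (use w0 k in auto)
  have "?L'
     = ennreal \<bar>-1\<bar> * (\<integral>\<^sup>+x. ennreal (w (0 + (-1) * x) * exp (k * (0 + (-1) * x))) * indicator {..0} (0 + (-1) * x) \<partial>lborel)"
    by (rule nn_integral_real_affine) simp_all
  also have "\<dots> = ?L"
    by (simp add: indicator_def)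
  finally have refl: "?L' = ?L" .
  have "F 0 \<le> (\<integral>\<^sup>+x. ennreal (w x * exp (- k * x)) * indicator {0..} x + ennreal (w x * exp (k * x)) * indicator {..0} x \<partial>lborel)"
    unfolding F_def by (rule nn_integral_mono) (auto simp: indicator_def abs_if)
  also have "\<dots> = ?R + ?L'"
    by (rule nn_integral_add) measurable
  finally have "F 0 \<le> ?R + ?L"
    unfolding refl .
  then have F0: "F 0 < \<infinity>" by (rule order.strict_trans1) (use left right in \<open>simp add: ennreal_add_less_top\<close>)
  have Fper: "F (t + pi) = F t" for t
  proof -
    have "F (t + pi) = ennreal \<bar>1\<bar> * (\<integral>\<^sup>+x. ennreal (w (pi + 1 * x) * exp (- k * \<bar>pi + 1 * x - (t + pi)\<bar>)) \<partial>lborel)"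
      unfolding F_def by (rule nn_integral_real_affine) simp_all
    also have "\<dots> = F t"
      unfolding F_def
    proof (simp only: abs_one ennreal_1 mult_1_left, rule nn_integral_cong_AE)
      show "AE x in lborel. ennreal (w (pi + x) * exp (- k * \<bar>pi + x - (t + pi)\<bar>)) = ennreal (w x * exp (- k * \<bar>x - t\<bar>))"
        using per
      proof eventually_elim
        case (elim x)
        have "pi + x - (t + pi) = x - t" "pi + x = x + pi" by simp_all
        then show ?case using elim by (simp only:)
      qed
    qed
    finally show ?thesis .
  qed
  have bound: "F t \<le> ennreal (exp (k * pi)) * F 0" for t
  proof -
    obtain s where s: "s \<in> {0..pi}" "F t = F s" by (rule periodic_reduce[of F t, OF Fper])
    have "F s \<le> (\<integral>\<^sup>+x. ennreal (exp (k * pi)) * ennreal (w x * exp (- k * \<bar>x - 0\<bar>)) \<partial>lborel)"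
      unfolding F_def
    proof (rule nn_integral_mono)
      fix x
      have "\<bar>x\<bar> \<le> \<bar>x - s\<bar> + pi" using s by auto
      then have "k * \<bar>x\<bar> \<le> k * (\<bar>x - s\<bar> + pi)" using k by (intro mult_left_mono) auto
      then have "exp (- k * \<bar>x - s\<bar>) \<le> exp (k * pi + - k * \<bar>x\<bar>)" by (simp add: algebra_simps)
      then have "w x * exp (- k * \<bar>x - s\<bar>) \<le> w x * (exp (k * pi) * exp (- k * \<bar>x\<bar>))"
        unfolding exp_add by (rule mult_left_mono) (rule w0)
      then have "ennreal (w x * exp (- k * \<bar>x - s\<bar>)) \<le> ennreal (exp (k * pi) * (w x * exp (- k * \<bar>x\<bar>)))"
        by (intro ennreal_leI) (simp add: mult_ac)
      then show "ennreal (w x * exp (- k * \<bar>x - s\<bar>)) \<le> ennreal (exp (k * pi)) * ennreal (w x * exp (- k * \<bar>x - 0\<bar>))"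
        using w0 by (simp add: ennreal_mult')
    qed
    also have "\<dots> = ennreal (exp (k * pi)) * F 0" unfolding F_def by (rule nn_integral_cmult) measurable
    finally show ?thesis using s by simp
  qed
  obtain b where b: "0 \<le> b" "F 0 = ennreal b" using F0 by (cases "F 0") auto
  have "F t \<le> ennreal (exp (k * pi) * b)" for t using bound[of t] b by (simp add: ennreal_mult')
  then show ?thesis using that[of "exp (k * pi) * b"] b unfolding F_def by simp
qed

text \<open>Cauchy-Schwarz after writing the kernel as the square of its square root, so that one
  factor of it stays with the square of \<open>f\<close>.\<close>

lemma exp_convolution_sq_bound:
  fixes f :: "real \<Rightarrow> complex"
  assumes [measurable]: "f \<in> borel_measurable borel"
    and B1: "(\<integral>\<^sup>+t. ennreal (exp (- k * \<bar>t - x\<bar>)) \<partial>lborel) \<le> ennreal B"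
  shows "(\<integral>\<^sup>+t. ennreal (exp (- k * \<bar>t - x\<bar>) * cmod (f t)) \<partial>lborel)\<^sup>2
    \<le> ennreal B * (\<integral>\<^sup>+t. ennreal (exp (- k * \<bar>t - x\<bar>) * (cmod (f t))\<^sup>2) \<partial>lborel)"
proof -
  let ?e = "\<lambda>t. exp (- (k / 2) * \<bar>t - x\<bar>)"
  have e: "exp (- k * \<bar>t - x\<bar>) = ?e t * ?e t" for t by (simp add: exp_add[symmetric] field_simps)
  have "(\<integral>\<^sup>+t. ennreal (exp (- k * \<bar>t - x\<bar>) * cmod (f t)) \<partial>lborel)\<^sup>2
     = (\<integral>\<^sup>+t. ennreal (?e t) * ennreal (?e t * cmod (f t)) \<partial>lborel)\<^sup>2"
    unfolding e by (simp add: ennreal_mult'[symmetric] mult_ac)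
  also have "\<dots> \<le> (\<integral>\<^sup>+t. (ennreal (?e t))\<^sup>2 \<partial>lborel) * (\<integral>\<^sup>+t. (ennreal (?e t * cmod (f t)))\<^sup>2 \<partial>lborel)"
    by (rule Cauchy_Schwarz_nn_integral) auto
  also have "(\<lambda>t. (ennreal (?e t))\<^sup>2) = (\<lambda>t. ennreal (exp (- k * \<bar>t - x\<bar>)))"
    unfolding e by (subst ennreal_power) (simp_all add: power2_eq_square)
  also have "(\<lambda>t. (ennreal (?e t * cmod (f t)))\<^sup>2) = (\<lambda>t. ennreal (exp (- k * \<bar>t - x\<bar>) * (cmod (f t))\<^sup>2))"
    unfolding e by (subst ennreal_power) (simp_all add: power2_eq_square mult_ac)
  finally show ?thesis by (rule order_trans) (rule mult_right_mono[OF B1], simp)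
qed

text \<open>A weighted Schur test: after the pointwise Cauchy-Schwarz bound, Tonelli moves the
  integration in \<open>x\<close> onto weight times kernel, which is bounded uniformly in
  \<open>t\<close>. For a weight \<open>1 + |Q|^2\<close> this controls \<open>g\<close> and
  \<open>Q g\<close> together.\<close>

lemma exp_convolution_weighted_bound:
  fixes f g :: "real \<Rightarrow> complex" and w :: "real \<Rightarrow> real"
  assumes fm[measurable]: "f \<in> borel_measurable borel" and gm: "g \<in> borel_measurable borel"
    and wm[measurable]: "w \<in> borel_measurable borel" and w0: "\<And>x. 0 \<le> w x"
    and B1: "\<And>x. (\<integral>\<^sup>+t. ennreal (exp (- k * \<bar>t - x\<bar>)) \<partial>lborel) \<le> ennreal B1" "0 \<le> B1"
    and Bw: "\<And>t. (\<integral>\<^sup>+x. ennreal (w x * exp (- k * \<bar>x - t\<bar>)) \<partial>lborel) \<le> ennreal Bw" "0 \<le> Bw"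
    and K: "0 \<le> K" "\<And>x. ennreal (cmod (g x)) \<le> ennreal K * (\<integral>\<^sup>+t. ennreal (exp (- k * \<bar>t - x\<bar>) * cmod (f t)) \<partial>lborel)"
  shows "(\<integral>\<^sup>+x. ennreal (w x * (cmod (g x))\<^sup>2) \<partial>lborel) \<le> ennreal (K\<^sup>2 * B1 * Bw) * (\<integral>\<^sup>+t. ennreal ((cmod (f t))\<^sup>2) \<partial>lborel)"
proof -
  let ?I = "\<lambda>x. \<integral>\<^sup>+t. ennreal (exp (- k * \<bar>t - x\<bar>) * (cmod (f t))\<^sup>2) \<partial>lborel"
  let ?J = "\<lambda>x. \<integral>\<^sup>+t. ennreal (w x) * ennreal (exp (- k * \<bar>t - x\<bar>) * (cmod (f t))\<^sup>2) \<partial>lborel"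
  let ?N = "\<integral>\<^sup>+t. ennreal ((cmod (f t))\<^sup>2) \<partial>lborel"
  have pt: "ennreal (w x * (cmod (g x))\<^sup>2) \<le> ennreal (K\<^sup>2 * B1) * ?J x" for x
  proof -
    have "ennreal ((cmod (g x))\<^sup>2) = (ennreal (cmod (g x)))\<^sup>2" by (simp add: ennreal_power)
    also have "\<dots> \<le> (ennreal K * (\<integral>\<^sup>+t. ennreal (exp (- k * \<bar>t - x\<bar>) * cmod (f t)) \<partial>lborel))\<^sup>2"
      by (rule power_mono[OF K(2)]) simp
    also have "\<dots> = ennreal (K\<^sup>2) * (\<integral>\<^sup>+t. ennreal (exp (- k * \<bar>t - x\<bar>) * cmod (f t)) \<partial>lborel)\<^sup>2"
      using K(1) by (simp add: power_mult_distrib ennreal_power)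
    also have "\<dots> \<le> ennreal (K\<^sup>2) * (ennreal B1 * ?I x)"
      by (intro mult_left_mono exp_convolution_sq_bound B1 fm) simp
    finally have "ennreal ((cmod (g x))\<^sup>2) \<le> ennreal (K\<^sup>2 * B1) * ?I x"
      using B1(2) by (simp add: ennreal_mult' mult.assoc)
    then have "ennreal (w x) * ennreal ((cmod (g x))\<^sup>2) \<le> ennreal (w x) * (ennreal (K\<^sup>2 * B1) * ?I x)"
      by (intro mult_left_mono) auto
    also have "\<dots> = ennreal (K\<^sup>2 * B1) * ?J x"
      by (subst nn_integral_cmult) (auto simp: mult_ac)
    finally show ?thesis using w0 by (simp add: ennreal_mult')
  qed
  have "(\<integral>\<^sup>+x. ennreal (w x * (cmod (g x))\<^sup>2) \<partial>lborel)
     \<le> (\<integral>\<^sup>+x. ennreal (K\<^sup>2 * B1) * ?J x \<partial>lborel)"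
    by (rule nn_integral_mono) (rule pt)
  also have "\<dots> = ennreal (K\<^sup>2 * B1) * (\<integral>\<^sup>+x. ?J x \<partial>lborel)"
    by (rule nn_integral_cmult) measurable
  also have "(\<integral>\<^sup>+x. ?J x \<partial>lborel)
    = (\<integral>\<^sup>+t. (\<integral>\<^sup>+x. ennreal (w x) * ennreal (exp (- k * \<bar>t - x\<bar>) * (cmod (f t))\<^sup>2) \<partial>lborel) \<partial>lborel)"
    by (rule lborel_pair.Fubini'[symmetric]) measurable
  also have "\<dots> = (\<integral>\<^sup>+t. ennreal ((cmod (f t))\<^sup>2) * (\<integral>\<^sup>+x. ennreal (w x * exp (- k * \<bar>x - t\<bar>)) \<partial>lborel) \<partial>lborel)"
  proof (rule nn_integral_cong)
    fix t
    show "(\<integral>\<^sup>+x. ennreal (w x) * ennreal (exp (- k * \<bar>t - x\<bar>) * (cmod (f t))\<^sup>2) \<partial>lborel)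
       = ennreal ((cmod (f t))\<^sup>2) * (\<integral>\<^sup>+x. ennreal (w x * exp (- k * \<bar>x - t\<bar>)) \<partial>lborel)"
      by (subst nn_integral_cmult[symmetric])
        (auto intro!: nn_integral_cong simp: abs_minus_commute w0 mult_ac ennreal_mult'[symmetric])
  qed
  also have "\<dots> \<le> (\<integral>\<^sup>+t. ennreal ((cmod (f t))\<^sup>2) * ennreal Bw \<partial>lborel)"
    by (intro nn_integral_mono mult_left_mono Bw) simp
  also have "\<dots> = ennreal Bw * ?N"
    by (subst nn_integral_cmult[symmetric]) (auto simp: mult.commute)
  finally have "(\<integral>\<^sup>+x. ennreal (w x * (cmod (g x))\<^sup>2) \<partial>lborel) \<le> ennreal (K\<^sup>2 * B1) * (ennreal Bw * ?N)"
    by (simp add: mult_left_mono)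
  then show ?thesis using B1 Bw by (simp add: ennreal_mult' mult.assoc)
qed

section \<open>Primitives anchored at infinity\<close>

lemma ac_deriv_integral_from_left:
  fixes h :: "real \<Rightarrow> 'a::{real_normed_field,euclidean_space}"
  assumes [measurable]: "h \<in> borel_measurable borel" and i: "\<And>x. set_integrable lborel {..x} h"
  shows "ac_deriv (\<lambda>x. LINT t:{..x}|lborel. h t) h"
proof (rule ac_derivI)
  fix a b :: real
  show "set_integrable lborel {a..b} h" by (rule set_integrable_subset[OF i[of b]]) auto
  assume "a \<le> b"
  then have S: "{..b} = {..a} \<union> {a<..b}" by auto
  have "(LINT t:{..b}|lborel. h t) = (LINT t:{..a}|lborel. h t) + (LINT t:{a<..b}|lborel. h t)"
    unfolding S by (rule set_integral_Un) (auto intro: set_integrable_subset[OF i[of b]] i)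
  moreover have "(LINT t:{a<..b}|lborel. h t) = (LINT t:{a..b}|lborel. h t)"
    unfolding set_lebesgue_integral_def
    by (rule integral_discrete_difference[where X="{a}"]) (auto simp: indicator_def)
  ultimately show "(LINT t:{..b}|lborel. h t) - (LINT t:{..a}|lborel. h t) = (LINT t:{a..b}|lborel. h t)" by simp
qed measurable

lemma ac_deriv_integral_to_right:
  fixes h :: "real \<Rightarrow> 'a::{real_normed_field,euclidean_space}"
  assumes [measurable]: "h \<in> borel_measurable borel" and i: "\<And>x. set_integrable lborel {x..} h"
  shows "ac_deriv (\<lambda>x. LINT t:{x..}|lborel. h t) (\<lambda>x. - h x)"
proof (rule ac_derivI)
  fix a b :: real
  have i': "set_integrable lborel {a..b} h" by (rule set_integrable_subset[OF i[of a]]) auto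
  then show "set_integrable lborel {a..b} (\<lambda>x. - h x)" using set_integrable_mult_right[of "-1" lborel _ h] by simp
  assume "a \<le> b"
  then have S: "{a..} = {a..<b} \<union> {b..}" by auto
  have "(LINT t:{a..}|lborel. h t) = (LINT t:{a..<b}|lborel. h t) + (LINT t:{b..}|lborel. h t)"
    unfolding S by (rule set_integral_Un) (auto intro: set_integrable_subset[OF i[of a]] i)
  then show "(LINT t:{b..}|lborel. h t) - (LINT t:{a..}|lborel. h t) = (LINT t:{a..b}|lborel. - h t)"
    unfolding set_integral_Ico_eq_Icc using set_integral_uminus[OF i'] by simp
qed measurable

section \<open>Green's function\<close>

lemma exp_abs_diff_split:
  fixes k x t :: real
  assumes "0 \<le> k"
  shows "t \<le> x \<Longrightarrow> exp (- k * x) * exp (k * t) = exp (- k * \<bar>t - x\<bar>)"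
    and "x \<le> t \<Longrightarrow> exp (k * x) * exp (- k * t) = exp (- k * \<bar>t - x\<bar>)"
  by (auto simp: exp_add[symmetric] abs_if algebra_simps)

context hill_potential begin

text \<open>Applied with Floquet solutions \<open>p\<close> and \<open>r\<close> that decay at \<open>+\<infinity>\<close> and \<open>-\<infinity>\<close> respectively.\<close>
lemma green_function_sol:
  assumes P: "homog_sol c p pu" and R: "homog_sol c r ru" and W: "p 0 * ru 0 - pu 0 * r 0 = W" "W \<noteq> 0"
    and f[measurable]: "f \<in> borel_measurable borel"
    and il: "\<And>x. set_integrable lborel {..x} (\<lambda>t. r t * f t)" and ir: "\<And>x. set_integrable lborel {x..} (\<lambda>t. p t * f t)"
  shows "hill_sol c f (\<lambda>x. (1 / W) * (p x * (LINT t:{..x}|lborel. r t * f t) + r x * (LINT t:{x..}|lborel. p t * f t)))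
    (\<lambda>x. (1 / W) * (pu x * (LINT t:{..x}|lborel. r t * f t) + ru x * (LINT t:{x..}|lborel. p t * f t)))"
proof -
  note [measurable] = hill_sol_borel[OF P] hill_sol_borel[OF R]
  define a where "a x = (LINT t:{..x}|lborel. r t * f t)" for x
  define b where "b x = (LINT t:{x..}|lborel. p t * f t)" for x
  have a: "ac_deriv a (\<lambda>x. r x * f x)" unfolding a_def by (rule ac_deriv_integral_from_left[OF _ il]) measurable
  have b: "ac_deriv b (\<lambda>x. - (p x * f x))" unfolding b_def by (rule ac_deriv_integral_to_right[OF _ ir]) measurable
  have p: "ac_deriv p (\<lambda>x. Q x * p x + pu x)" "ac_deriv pu (\<lambda>x. (c - (Q x)\<^sup>2) * p x - Q x * pu x - 0)"
    and r: "ac_deriv r (\<lambda>x. Q x * r x + ru x)" "ac_deriv ru (\<lambda>x. (c - (Q x)\<^sup>2) * r x - Q x * ru x - 0)"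
    using P R by (auto simp: hill_sol_def)
  have w: "p x * ru x - pu x * r x = W" for x using wronskian_const[OF P R, of x] W(1) by simp
  let ?y = "\<lambda>x. (1 / W) * (p x * a x + r x * b x)" and ?u = "\<lambda>x. (1 / W) * (pu x * a x + ru x * b x)"
  \<comment> \<open>The derivatives of the two integrals cancel in the first component. In the
    second they combine to \<open>f\<close> times the Wronskian, whence the factor
    \<open>1 / W\<close>.\<close>
  have y: "ac_deriv ?y (\<lambda>x. Q x * ?y x + ?u x)"
    by (rule ac_deriv_eqI[OF ac_deriv_cmult[OF ac_deriv_add[OF ac_deriv_mult[OF p(1) a] ac_deriv_mult[OF r(1) b]]]])
      (simp add: algebra_simps)
  have "ac_deriv ?u (\<lambda>x. (c - (Q x)\<^sup>2) * ?y x - Q x * ?u x - (1 / W) * ((p x * ru x - pu x * r x) * f x))"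
    by (rule ac_deriv_eqI[OF ac_deriv_cmult[OF ac_deriv_add[OF ac_deriv_mult[OF p(2) a] ac_deriv_mult[OF r(2) b]]]])
      (simp add: algebra_simps)
  then have u: "ac_deriv ?u (\<lambda>x. (c - (Q x)\<^sup>2) * ?y x - Q x * ?u x - f x)"
    unfolding w using W(2) by simp
  from y u show ?thesis unfolding hill_sol_def a_def b_def by simp
qed

text \<open>Otherwise the initial vectors are parallel, so \<open>r\<close> is a multiple of
  \<open>p\<close> and a nonzero function has both multipliers.\<close>

lemma floquet_wronskian_nonzero:
  assumes P: "homog_sol c p pu" "\<And>x. p (x + pi) = m * p x" "\<exists>x. p x \<noteq> 0"
    and R: "homog_sol c r ru" "\<And>x. r (x + pi) = n * r x" "\<exists>x. r x \<noteq> 0" and "m \<noteq> n"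
  shows "p 0 * ru 0 - pu 0 * r 0 \<noteq> 0"
proof
  assume w: "p 0 * ru 0 - pu 0 * r 0 = 0"
  have "p 0 \<noteq> 0 \<or> pu 0 \<noteq> 0" using hill_sol_zero[OF P(1), of 0] P(3) by blast
  then obtain k where k: "r 0 = k * p 0" "ru 0 = k * pu 0"
  proof
    assume "p 0 \<noteq> 0"
    then show ?thesis using that[of "r 0 / p 0"] w by (simp add: field_simps)
  next
    assume "pu 0 \<noteq> 0"
    then show ?thesis using that[of "ru 0 / pu 0"] w by (simp add: field_simps)
  qed
  have "r x - k * p x = 0 \<and> ru x - k * pu x = 0" for x
    by (rule hill_sol_zero[OF hill_sol_diff[OF R(1) hill_sol_cmult[OF P(1), of k], simplified], of 0]) (use k in auto)
  then have eq: "r x = k * p x" for x by simp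
  have "(n - m) * r x = 0" for x
  proof -
    have "n * r x = k * (m * p x)" using R(2)[of x] P(2)[of x] eq[of "x + pi"] by simp
    then show ?thesis using eq[of x] by (simp add: algebra_simps)
  qed
  then show False using R(3) \<open>m \<noteq> n\<close> by auto
qed

text \<open>One multiplier is inside and the other outside the unit circle, so Green's kernel is
  dominated by \<open>exp (- k * \<bar>t - x\<bar>)\<close>. Working with the weight
  \<open>1 + |Q|^2\<close> from the start gives \<open>y\<close>, \<open>u\<close> and
  \<open>Q y\<close> in L2 at once, as membership in the domain requires.\<close>

lemma resolvent_sol:
  assumes D: "\<And>t. t \<in> {0..<2*pi} \<Longrightarrow> discriminant c \<noteq> 2 * complex_of_real (cos t)"
  obtains M where "0 \<le> M" "\<And>f. L2 f \<Longrightarrow> \<exists>y u. hill_sol c f y u \<and> L2 y \<and> L2 u \<and> L2 (\<lambda>x. Q x * y x + u x) \<and> l2norm y \<le> M * l2norm f"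
proof -
  obtain m n where r0: "m * n = 1" "m + n = discriminant c" and m1: "cmod m < 1"
  proof -
    obtain m n where r: "m * n = 1" "m + n = discriminant c" by (rule reciprocal_roots)
    have "cmod m \<noteq> 1" using reciprocal_roots_unimodular[OF r(1)] r(2) D by metis
    moreover have "cmod m * cmod n = 1" using arg_cong[OF r(1), of cmod] by (simp add: norm_mult)
    ultimately have "cmod m < 1 \<or> cmod n < 1"
      by (metis less_1_mult less_irrefl linorder_neqE_linordered_idom mult.right_neutral)
    then show thesis using that[of m n] that[of n m] r by (auto simp: mult.commute add.commute)
  qed
  have m0: "m \<noteq> 0" using r0 by auto
  define k where "k = - ln (cmod m) / pi"
  have k: "0 < k" unfolding k_def using m1 m0 by (simp add: divide_neg_pos ln_less_zero)
  have mk: "cmod m = exp (- k * pi)" unfolding k_def using m0 by simp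
  have nk: "cmod n = exp (- (- k) * pi)"
  proof -
    have "cmod m * cmod n = 1" using arg_cong[OF r0(1), of cmod] by (simp add: norm_mult)
    then show ?thesis unfolding mk by (simp add: exp_minus field_simps)
  qed
  have mn: "m \<noteq> n"
  proof
    assume "m = n"
    then have "cmod m = cmod n" by simp
    then show False unfolding mk nk using k by simp
  qed
  obtain p pu where P: "homog_sol c p pu" "\<And>x. p (x + pi) = m * p x" "\<And>x. pu (x + pi) = m * pu x" "\<exists>x. p x \<noteq> 0"
    using floquet_sol_exists[OF r0] by blast
  have r0': "n * m = 1" "n + m = discriminant c" using r0 by (simp_all add: mult.commute add.commute)
  obtain r ru where R: "homog_sol c r ru" "\<And>x. r (x + pi) = n * r x" "\<And>x. ru (x + pi) = n * ru x" "\<exists>x. r x \<noteq> 0"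
    using floquet_sol_exists[OF r0'] by blast
  define W where "W = p 0 * ru 0 - pu 0 * r 0"
  have W: "W \<noteq> 0" unfolding W_def by (rule floquet_wronskian_nonzero[OF P(1,2,4) R(1,2,4) mn])
  obtain K1 where K1: "0 \<le> K1" "\<And>x. cmod (p x) \<le> K1 * exp (- k * x)"
    using multiplier_exp_bound[OF hill_sol_cont(1)[OF P(1)] P(2) mk] by blast
  obtain K2 where K2: "0 \<le> K2" "\<And>x. cmod (pu x) \<le> K2 * exp (- k * x)"
    using multiplier_exp_bound[OF hill_sol_cont(2)[OF P(1)] P(3) mk] by blast
  obtain K3 where K3: "0 \<le> K3" "\<And>x. cmod (r x) \<le> K3 * exp (k * x)"
    using multiplier_exp_bound[OF hill_sol_cont(1)[OF R(1)] R(2) nk] by auto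
  obtain K4 where K4: "0 \<le> K4" "\<And>x. cmod (ru x) \<le> K4 * exp (k * x)"
    using multiplier_exp_bound[OF hill_sol_cont(2)[OF R(1)] R(3) nk] by auto
  define K where "K = Max {K1, K2, K3, K4}"
  have KK: "K1 \<le> K" "K2 \<le> K" "K3 \<le> K" "K4 \<le> K" unfolding K_def by auto
  have K0: "0 \<le> K" using K1 KK by linarith
  have up: "Kj * exp z \<le> K * exp z" if "Kj \<le> K" for Kj z using that by simp
  have Kb: "cmod (p x) \<le> K * exp (- k * x)" "cmod (pu x) \<le> K * exp (- k * x)"
    "cmod (r x) \<le> K * exp (k * x)" "cmod (ru x) \<le> K * exp (k * x)" for x
    by (rule order_trans[OF K1(2) up] order_trans[OF K2(2) up] order_trans[OF K3(2) up] order_trans[OF K4(2) up]; fact)+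
  note [measurable] = hill_sol_borel[OF P(1)] hill_sol_borel[OF R(1)]
  obtain B1 where B1: "0 \<le> B1" "\<And>t. (\<integral>\<^sup>+x. ennreal (1 * exp (- k * \<bar>x - t\<bar>)) \<partial>lborel) \<le> ennreal B1"
    by (rule periodic_exp_weight_bound[of "\<lambda>x. 1", OF _ _ _ _ k]) (auto intro: set_integrable_Icc_const)
  obtain B2 where B2: "0 \<le> B2" "\<And>t. (\<integral>\<^sup>+x. ennreal ((1 + (cmod (Q x))\<^sup>2) * exp (- k * \<bar>x - t\<bar>)) \<partial>lborel) \<le> ennreal B2"
    by (rule periodic_exp_weight_bound[of "\<lambda>x. 1 + (cmod (Q x))\<^sup>2", OF _ _ _ _ k])
      (use Q_periodic in \<open>auto intro!: set_integral_add set_integrable_Icc_const Q_sq_integrable elim: eventually_mono\<close>)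
  \<comment> \<open>Each of the two half-line integrals contributes \<open>K^2\<close> times the
    convolution of the kernel with \<open>cmod f\<close>; \<open>W\<close> is the Wronskian in the
    denominator.\<close>
  define L where "L = 2 * K\<^sup>2 / cmod W"
  have L0: "0 \<le> L" unfolding L_def by simp
  have main: "\<exists>y u. hill_sol c f y u \<and> L2 y \<and> L2 u \<and> L2 (\<lambda>x. Q x * y x + u x) \<and> l2norm y \<le> sqrt (L\<^sup>2 * B1 * B2) * l2norm f"
    if f: "L2 f" for f
  proof -
    have fm[measurable]: "f \<in> borel_measurable borel" using f by (rule L2_measurable)
    let ?r = "\<lambda>x t. exp (- k * \<bar>t - x\<bar>) * cmod (f t)"
    let ?A = "\<lambda>x. LINT t:{..x}|lborel. r t * f t"
    let ?B = "\<lambda>x. LINT t:{x..}|lborel. p t * f t"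
    let ?R = "\<lambda>x. LINT t|lborel. ?r x t"
    have ri: "integrable lborel (?r x)" for x
    proof (rule integrableI_nonneg)
      have "(\<integral>\<^sup>+t. ennreal (?r x t) \<partial>lborel)\<^sup>2 \<le> ennreal B1 * (\<integral>\<^sup>+t. ennreal (exp (- k * \<bar>t - x\<bar>) * (cmod (f t))\<^sup>2) \<partial>lborel)"
        by (rule exp_convolution_sq_bound[OF fm]) (use B1(2)[of x] in simp)
      also have "\<dots> \<le> ennreal B1 * (\<integral>\<^sup>+t. ennreal ((cmod (f t))\<^sup>2) \<partial>lborel)"
      proof (intro mult_left_mono nn_integral_mono ennreal_leI)
        fix t
        have "exp (- k * \<bar>t - x\<bar>) * (cmod (f t))\<^sup>2 \<le> 1 * (cmod (f t))\<^sup>2"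
          using k by (intro mult_right_mono) auto
        then show "exp (- k * \<bar>t - x\<bar>) * (cmod (f t))\<^sup>2 \<le> (cmod (f t))\<^sup>2" by simp
      qed simp
      also have "\<dots> < \<infinity>"
        using nn_integral_eq_integral[OF L2_integrable[OF f]] by (simp add: ennreal_mult_less_top)
      finally show "(\<integral>\<^sup>+t. ennreal (?r x t) \<partial>lborel) < \<infinity>"
        by (simp add: power2_eq_square ennreal_mult_less_top less_top[symmetric] ennreal_mult_eq_top_iff)
    qed auto
    \<comment> \<open>One estimate for both half lines: \<open>e\<close> is the exponential size at
      \<open>x\<close> of the outer solution \<open>s\<close>, and its product with the inner
      solution \<open>g t\<close> is controlled by the kernel.\<close>
    have half: "set_integrable lborel S (\<lambda>t. g t * f t)"
        "cmod s \<le> K * e \<Longrightarrow> cmod (s * (LINT t:S|lborel. g t * f t)) \<le> K\<^sup>2 * ?R x"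
      if [measurable]: "g \<in> borel_measurable borel" "S \<in> sets borel" and e: "0 < e"
        and ge: "\<And>t. t \<in> S \<Longrightarrow> e * cmod (g t) \<le> K * exp (- k * \<bar>t - x\<bar>)" for g :: "real \<Rightarrow> complex" and S e x s
    proof -
      have pt: "e * norm (indicator S t *\<^sub>R (g t * f t)) \<le> K * ?r x t" for t
        using mult_right_mono[OF ge[of t], of "cmod (f t)"] K0 by (cases "t \<in> S") (simp_all add: norm_mult mult_ac)
      show i: "set_integrable lborel S (\<lambda>t. g t * f t)"
        unfolding set_integrable_def
      proof (rule Bochner_Integration.integrable_bound[OF integrable_mult_right[OF ri[of x], of "K / e"]])
        show "AE t in lborel. norm (indicator S t *\<^sub>R (g t * f t)) \<le> norm (K / e * ?r x t)"
        proof (rule AE_I2)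
          fix t
          have "norm (indicator S t *\<^sub>R (g t * f t)) \<le> K / e * ?r x t"
            using pt[of t] e by (simp add: field_simps)
          then show "norm (indicator S t *\<^sub>R (g t * f t)) \<le> norm (K / e * ?r x t)"
            unfolding real_norm_def by (rule order_trans[OF _ abs_ge_self])
        qed
      qed measurable
      assume s: "cmod s \<le> K * e"
      have "cmod (s * (LINT t:S|lborel. g t * f t)) \<le> K * e * (LINT t|lborel. norm (indicator S t *\<^sub>R (g t * f t)))"
        unfolding norm_mult set_lebesgue_integral_def
        by (intro mult_mono s integral_norm_bound) (use K0 e in auto)
      also have "\<dots> = K * (LINT t|lborel. e * norm (indicator S t *\<^sub>R (g t * f t)))" by simp
      also have "\<dots> \<le> K * (LINT t|lborel. K * ?r x t)"
        by (intro mult_left_mono integral_mono integrable_mult_right integrable_norm ri pt K0)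
          (use i in \<open>simp add: set_integrable_def\<close>)
      also have "\<dots> = K\<^sup>2 * ?R x" by (simp add: power2_eq_square)
      finally show "cmod (s * (LINT t:S|lborel. g t * f t)) \<le> K\<^sup>2 * ?R x" .
    qed
    have rl: "exp (- k * x) * cmod (r t) \<le> K * exp (- k * \<bar>t - x\<bar>)" if "t \<in> {..x}" for t x
    proof -
      have "exp (- k * x) * cmod (r t) \<le> exp (- k * x) * (K * exp (k * t))"
        by (rule mult_left_mono[OF Kb(3)]) simp
      also have "\<dots> = K * (exp (- k * x) * exp (k * t))" by simp
      also have "exp (- k * x) * exp (k * t) = exp (- k * \<bar>t - x\<bar>)"
        by (rule exp_abs_diff_split(1)) (use k that in auto)
      finally show ?thesis .
    qed
    have pr: "exp (k * x) * cmod (p t) \<le> K * exp (- k * \<bar>t - x\<bar>)" if "t \<in> {x..}" for t x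
    proof -
      have "exp (k * x) * cmod (p t) \<le> exp (k * x) * (K * exp (- k * t))"
        by (rule mult_left_mono[OF Kb(1)]) simp
      also have "\<dots> = K * (exp (k * x) * exp (- k * t))" by simp
      also have "exp (k * x) * exp (- k * t) = exp (- k * \<bar>t - x\<bar>)"
        by (rule exp_abs_diff_split(2)) (use k that in auto)
      finally show ?thesis .
    qed
    have il: "set_integrable lborel {..x} (\<lambda>t. r t * f t)" and ir: "set_integrable lborel {x..} (\<lambda>t. p t * f t)" for x
      by (rule half(1)[OF _ _ exp_gt_zero rl] half(1)[OF _ _ exp_gt_zero pr]; measurable)+
    have ilb: "cmod s \<le> K * exp (- k * x) \<Longrightarrow> cmod (s * ?A x) \<le> K\<^sup>2 * ?R x"
      and irb: "cmod s \<le> K * exp (k * x) \<Longrightarrow> cmod (s * ?B x) \<le> K\<^sup>2 * ?R x" for s x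
      by (rule half(2)[OF _ _ exp_gt_zero rl] half(2)[OF _ _ exp_gt_zero pr]; measurable)+
    define y where "y x = (1 / W) * (p x * ?A x + r x * ?B x)" for x
    define u where "u x = (1 / W) * (pu x * ?A x + ru x * ?B x)" for x
    have S: "hill_sol c f y u"
      unfolding y_def u_def by (rule green_function_sol[OF P(1) R(1) W_def[symmetric] W fm il ir])
    note [measurable] = hill_sol_borel[OF S]
    have comb: "cmod ((1 / W) * (s * ?A x + s' * ?B x)) \<le> L * ?R x"
      if "cmod s \<le> K * exp (- k * x)" "cmod s' \<le> K * exp (k * x)" for s s' x
    proof -
      have "cmod (s * ?A x + s' * ?B x) \<le> 2 * K\<^sup>2 * ?R x"
        using norm_triangle_le[OF add_mono[OF ilb[OF that(1)] irb[OF that(2)]]] by simp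
      then have "cmod (s * ?A x + s' * ?B x) / cmod W \<le> 2 * K\<^sup>2 * ?R x / cmod W"
        by (rule divide_right_mono) simp
      then show ?thesis unfolding L_def by (simp add: norm_mult norm_divide)
    qed
    have conv: "ennreal (cmod (g x)) \<le> ennreal L * (\<integral>\<^sup>+t. ennreal (?r x t) \<partial>lborel)"
      if "\<And>x. cmod (g x) \<le> L * ?R x" for x and g :: "real \<Rightarrow> complex"
    proof -
      have "(\<integral>\<^sup>+t. ennreal (?r x t) \<partial>lborel) = ennreal (?R x)"
        by (rule nn_integral_eq_integral[OF ri]) simp
      moreover have "ennreal (cmod (g x)) \<le> ennreal (L * ?R x)"
        by (rule ennreal_leI) (rule that)
      moreover have "0 \<le> ?R x" by (rule integral_nonneg_AE) simp
      ultimately show ?thesis using L0 by (simp only: ennreal_mult)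
    qed
    have wb: "(\<integral>\<^sup>+x. ennreal ((1 + (cmod (Q x))\<^sup>2) * (cmod (g x))\<^sup>2) \<partial>lborel) \<le> ennreal (L\<^sup>2 * B1 * B2) * (\<integral>\<^sup>+t. ennreal ((cmod (f t))\<^sup>2) \<partial>lborel)"
      if g: "g \<in> borel_measurable borel" "\<And>x. cmod (g x) \<le> L * ?R x" for g
      by (rule exp_convolution_weighted_bound[OF fm g(1) _ _ _ B1(1) B2(2,1) L0 conv[OF g(2)]])
        (use B1(2) in auto)
    have wi: "integrable lborel (\<lambda>x. (1 + (cmod (Q x))\<^sup>2) * (cmod (g x))\<^sup>2)"
      and wn: "(LINT x|lborel. (1 + (cmod (Q x))\<^sup>2) * (cmod (g x))\<^sup>2) \<le> L\<^sup>2 * B1 * B2 * (l2norm f)\<^sup>2"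
      if g[measurable]: "g \<in> borel_measurable borel" and gb: "\<And>x. cmod (g x) \<le> L * ?R x" for g
    proof -
      have eq: "(\<integral>\<^sup>+t. ennreal ((cmod (f t))\<^sup>2) \<partial>lborel) = ennreal ((l2norm f)\<^sup>2)"
        unfolding l2norm_sq by (rule nn_integral_eq_integral[OF L2_integrable[OF f]]) simp
      have b: "(\<integral>\<^sup>+x. ennreal ((1 + (cmod (Q x))\<^sup>2) * (cmod (g x))\<^sup>2) \<partial>lborel) \<le> ennreal (L\<^sup>2 * B1 * B2 * (l2norm f)\<^sup>2)"
        using wb[OF g gb] B1 B2 unfolding eq by (subst ennreal_mult) simp_all
      show i: "integrable lborel (\<lambda>x. (1 + (cmod (Q x))\<^sup>2) * (cmod (g x))\<^sup>2)"
        by (rule integrableI_nonneg) (use b in \<open>auto intro: order.strict_trans1\<close>)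
      show "(LINT x|lborel. (1 + (cmod (Q x))\<^sup>2) * (cmod (g x))\<^sup>2) \<le> L\<^sup>2 * B1 * B2 * (l2norm f)\<^sup>2"
        using b B1 B2 by (subst (asm) nn_integral_eq_integral[OF i]) (auto simp: ennreal_le_iff)
    qed
    have yb: "cmod (y x) \<le> L * ?R x" and ub: "cmod (u x) \<le> L * ?R x" for x
      unfolding y_def u_def by (rule comb[OF Kb(1,3)], rule comb[OF Kb(2,4)])
    have ym: "y \<in> borel_measurable borel" and um: "u \<in> borel_measurable borel" by measurable
    have le: "(cmod z)\<^sup>2 \<le> (1 + (cmod (Q x))\<^sup>2) * (cmod z)\<^sup>2" for z x
      by (simp add: distrib_right)
    have yL: "L2 y" by (rule L2_bound[OF ym wi[OF ym yb]]) (rule le)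
    have uL: "L2 u" by (rule L2_bound[OF um wi[OF um ub]]) (rule le)
    have QL: "L2 (\<lambda>x. Q x * y x)"
      by (rule L2_bound[OF _ wi[OF ym yb]]) (auto simp: norm_mult power_mult_distrib distrib_right)
    have "(l2norm y)\<^sup>2 \<le> (LINT x|lborel. (1 + (cmod (Q x))\<^sup>2) * (cmod (y x))\<^sup>2)"
      unfolding l2norm_sq by (rule integral_mono[OF L2_integrable[OF yL] wi[OF ym yb]]) (rule le)
    also have "\<dots> \<le> L\<^sup>2 * B1 * B2 * (l2norm f)\<^sup>2" by (rule wn[OF ym yb])
    also have "\<dots> = (sqrt (L\<^sup>2 * B1 * B2) * l2norm f)\<^sup>2" using B1 B2 by (simp add: power_mult_distrib)
    finally have "l2norm y \<le> sqrt (L\<^sup>2 * B1 * B2) * l2norm f"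
      by (rule power2_le_imp_le) (use B1 B2 in \<open>simp add: l2norm_nonneg\<close>)
    then show ?thesis using S yL uL L2_add[OF QL uL] by blast
  qed
  have "0 \<le> sqrt (L\<^sup>2 * B1 * B2)" using B1 B2 by simp
  then show ?thesis using that main by blast
qed

end

section \<open>The adjoint\<close>

lemma hill_potential_cnj:
  assumes "hill_potential Q"
  shows "hill_potential (\<lambda>x. cnj (Q x))"
proof -
  interpret hill_potential Q by fact
  show ?thesis
  proof
    show "(\<lambda>x. cnj (Q x)) \<in> borel_measurable borel"
      using Q_borel by (intro borel_measurable_continuous_on[of cnj] continuous_intros)
    show "set_integrable lborel {a..b} (\<lambda>x. (cmod (cnj (Q x)))\<^sup>2)" for a b
      using Q_sq_integrable by simp
    show "AE x in lborel. cnj (Q (x + pi)) = cnj (Q x)"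
      using Q_periodic by eventually_elim simp
  qed
qed

lemma hill_graph_cong_potential_subset:
  assumes "AE x in lborel. Q x = R x"
  shows "hill_graph C Q \<subseteq> hill_graph C R"
proof
  fix p assume "p \<in> hill_graph C Q"
  then obtain y f yr y' u u' where p: "p = (y, f)" and *: "L2 y" "L2 f" "AE x in lborel. yr x = y x" "loc_ac_deriv yr y'" "L2 y'"
    "loc_ac_deriv u u'" "AE x in lborel. u x = y' x - Q x * yr x" "L2 u"
    "AE x in lborel. f x = - u' x - Q x * y' x + C * yr x"
    unfolding hill_graph_def by auto
  have "AE x in lborel. u x = y' x - R x * yr x" using *(7) assms by eventually_elim simp
  moreover have "AE x in lborel. f x = - u' x - R x * y' x + C * yr x" using *(9) assms by eventually_elim simp
  ultimately show "p \<in> hill_graph C R" unfolding p hill_graph_def mem_Collect_eq prod.case using * by blast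
qed

lemma hill_graph_cong_potential:
  assumes "AE x in lborel. Q x = R x"
  shows "hill_graph C Q = hill_graph C R"
  by (rule antisym; rule hill_graph_cong_potential_subset) (use assms in \<open>auto elim: eventually_mono\<close>)

context hill_potential begin

lemma hill_sol_cnj:
  assumes "hill_sol c f y u"
  shows "hill_potential.hill_sol (\<lambda>x. cnj (Q x)) (cnj c) (\<lambda>x. cnj (f x)) (\<lambda>x. cnj (y x)) (\<lambda>x. cnj (u x))"
proof -
  interpret conj: hill_potential "\<lambda>x. cnj (Q x)" by (rule hill_potential_cnj) unfold_locales
  show ?thesis
    using assms ac_deriv_cnj[of y "\<lambda>x. Q x * y x + u x"] ac_deriv_cnj[of u "\<lambda>x. (c - (Q x)\<^sup>2) * y x - Q x * u x - f x"]
    unfolding hill_sol_def conj.hill_sol_def by simp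
qed

lemma discriminant_cnj: "hill_potential.discriminant (\<lambda>x. cnj (Q x)) (cnj c) = cnj (discriminant c)"
proof -
  interpret conj: hill_potential "\<lambda>x. cnj (Q x)" by (rule hill_potential_cnj) unfold_locales
  obtain y1 u1 y2 u2 where F: "fundamental c y1 u1 y2 u2" by (rule fundamental_exists)
  then have "conj.fundamental (cnj c) (\<lambda>x. cnj (y1 x)) (\<lambda>x. cnj (u1 x)) (\<lambda>x. cnj (y2 x)) (\<lambda>x. cnj (u2 x))"
    using hill_sol_cnj[of c "\<lambda>x. 0"] unfolding fundamental_def conj.fundamental_def by simp
  from conj.discriminant_eq[OF this] show ?thesis unfolding discriminant_eq[OF F] by simp
qed

lemma lyapunov_eq_discriminant: "lyapunov C Q lam = discriminant (C - lam)"
proof -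
  have "hill_solution C Q lam y u y0 u0 \<longleftrightarrow> homog_sol (C - lam) y u \<and> y 0 = y0 \<and> u 0 = u0" for y u y0 u0
  proof -
    have *: "(\<lambda>x. Q x * y x + u x) \<in> borel_measurable borel \<and> (\<lambda>x. (C - lam - (Q x)\<^sup>2) * y x - Q x * u x) \<in> borel_measurable borel"
      if "continuous_on UNIV y" "continuous_on UNIV u"
    proof -
      note [measurable] = borel_measurable_continuous_onI[OF that(1)] borel_measurable_continuous_onI[OF that(2)]
      show ?thesis by (intro conjI) measurable
    qed
    show ?thesis
    proof
      assume h: "hill_solution C Q lam y u y0 u0"
      then have "continuous_on UNIV y" "continuous_on UNIV u"
        by (auto simp: hill_solution_def intro: loc_ac_deriv_continuous)
      from *[OF this] h show "homog_sol (C - lam) y u \<and> y 0 = y0 \<and> u 0 = u0"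
        by (simp add: hill_solution_def hill_sol_def loc_ac_deriv_iff)
    next
      assume "homog_sol (C - lam) y u \<and> y 0 = y0 \<and> u 0 = u0"
      then show "hill_solution C Q lam y u y0 u0"
        by (auto simp: hill_solution_def hill_sol_def intro: ac_deriv_imp_loc_ac_deriv)
    qed
  qed
  then show ?thesis
    unfolding lyapunov_def discriminant_def fundamental_def
    by (intro arg_cong[where f=The]) (auto simp: fun_eq_iff)
qed

section \<open>Resolvent set and spectrum\<close>

lemma resolvent_surjective_bounded:
  assumes D: "\<And>t. t \<in> {0..<2*pi} \<Longrightarrow> discriminant (C - lam) \<noteq> 2 * complex_of_real (cos t)"
  shows "\<And>f. L2 f \<Longrightarrow> \<exists>(y, g)\<in>hill_graph C Q. L2 g \<and> (\<forall>x. g x - lam * y x = f x)"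
    and "\<exists>M. \<forall>(y, g)\<in>hill_graph C Q. l2norm y \<le> M * l2norm (\<lambda>x. g x - lam * y x)"
proof -
  obtain M where M: "0 \<le> M" "\<And>f. L2 f \<Longrightarrow> \<exists>y u. hill_sol (C - lam) f y u \<and> L2 y \<and> L2 u \<and> L2 (\<lambda>x. Q x * y x + u x) \<and> l2norm y \<le> M * l2norm f"
    using resolvent_sol[OF D] by blast
  show "\<exists>(y, g)\<in>hill_graph C Q. L2 g \<and> (\<forall>x. g x - lam * y x = f x)" if f: "L2 f" for f
  proof -
    obtain y u where *: "hill_sol (C - lam) f y u" "L2 y" "L2 u" "L2 (\<lambda>x. Q x * y x + u x)"
      using M(2)[OF f] by blast
    let ?g = "\<lambda>x. f x + lam * y x"
    have g: "L2 ?g" by (intro L2_add f L2_cmult *)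
    have "hill_sol C ?g y u" using hill_sol_spectral_shift[of C lam ?g y u] *(1) by simp
    then have "(y, ?g) \<in> hill_graph C Q"
      unfolding hill_graph_iff using * g by auto
    then show ?thesis using g by (intro bexI[of _ "(y, ?g)"]) auto
  qed
  have "l2norm y \<le> M * l2norm (\<lambda>x. g x - lam * y x)" if yg: "(y, g) \<in> hill_graph C Q" for y g
  proof -
    let ?f = "\<lambda>x. g x - lam * y x"
    have L: "L2 y" "L2 g" using yg unfolding hill_graph_iff by auto
    have f: "L2 ?f" by (intro L2_diff L2_cmult L)
    obtain yr u where r: "AE x in lborel. yr x = y x" "L2 yr" "hill_sol (C - lam) ?f yr u"
      by (rule hill_graph_resolvent_equation[OF yg AE_I2[OF refl] L2_measurable[OF f]])
    \<comment> \<open>The norm bound is known only for the solution built from Green's function.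
      Uniqueness among square integrable solutions identifies it with the given one.\<close>
    obtain z w where z: "hill_sol (C - lam) ?f z w" "L2 z" "l2norm z \<le> M * l2norm ?f"
      using M(2)[OF f] by blast
    have "homog_sol (C - lam) (\<lambda>x. yr x - z x) (\<lambda>x. u x - w x)"
      using hill_sol_diff[OF r(3) z(1)] by simp
    from L2_hill_sol_zero[OF this L2_diff[OF r(2) z(2)]] have "yr = z" by auto
    moreover have "l2norm y = l2norm yr"
      by (rule l2norm_cong_AE) (use r L2_measurable[OF L(1)] L2_measurable[OF r(2)] in \<open>auto elim: eventually_mono\<close>)
    ultimately show ?thesis using z(3) by simp
  qed
  then show "\<exists>M. \<forall>(y, g)\<in>hill_graph C Q. l2norm y \<le> M * l2norm (\<lambda>x. g x - lam * y x)" by blast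
qed

lemma op_spectrum_eq:
  "op_spectrum (hill_graph C Q) = {lam. \<exists>\<theta>\<in>{0..<2*pi}. discriminant (C - lam) = 2 * complex_of_real (cos \<theta>)}"
proof (rule set_eqI, rule iffI)
  fix lam assume l: "lam \<in> op_spectrum (hill_graph C Q)"
  show "lam \<in> {lam. \<exists>\<theta>\<in>{0..<2*pi}. discriminant (C - lam) = 2 * complex_of_real (cos \<theta>)}"
  proof (rule ccontr)
    assume "lam \<notin> {lam. \<exists>\<theta>\<in>{0..<2*pi}. discriminant (C - lam) = 2 * complex_of_real (cos \<theta>)}"
    then have D: "\<And>t. t \<in> {0..<2*pi} \<Longrightarrow> discriminant (C - lam) \<noteq> 2 * complex_of_real (cos t)" by auto
    have "\<exists>(y, g)\<in>hill_graph C Q. AE x in lborel. g x - lam * y x = f x" if "L2 f" for f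
      using resolvent_surjective_bounded(1)[OF D that] by fastforce
    with resolvent_surjective_bounded(2)[OF D] l show False unfolding op_spectrum_def by blast
  qed
next
  fix lam assume "lam \<in> {lam. \<exists>\<theta>\<in>{0..<2*pi}. discriminant (C - lam) = 2 * complex_of_real (cos \<theta>)}"
  then obtain t where "discriminant (C - lam) = 2 * complex_of_real (cos t)" by auto
  from not_surjective[OF this] show "lam \<in> op_spectrum (hill_graph C Q)" unfolding op_spectrum_def by blast
qed

abbreviation "conj_graph C \<equiv> hill_graph (cnj C) (\<lambda>x. cnj (Q x))"

text \<open>Conjugating the second pair gives a forced solution of the original system. The forced
  Wronskian is integrable because both components of each pair lie in L2, and its derivative is
  integrable too, so no boundary terms at infinity remain.\<close>

lemma lagrange_identity:
  assumes yf: "(y, f) \<in> hill_graph C Q" and zh: "(z, h) \<in> conj_graph C"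
  shows "l2inner f z = l2inner y h"
proof -
  interpret conj: hill_potential "\<lambda>x. cnj (Q x)" by (rule hill_potential_cnj) unfold_locales
  obtain yr u where y: "L2 y" "L2 f" "AE x in lborel. yr x = y x" "hill_sol C f yr u" "L2 u"
    using yf unfolding hill_graph_iff by auto
  obtain zr w where z: "L2 z" "L2 h" "AE x in lborel. zr x = z x" "conj.hill_sol (cnj C) h zr w" "L2 w"
    using zh unfolding conj.hill_graph_iff by auto
  have yr: "L2 yr" by (rule L2_cong_AE[OF y(1)]) (use y(3) hill_sol_borel[OF y(4)] in \<open>auto elim: eventually_mono\<close>)
  have zr: "L2 zr" by (rule L2_cong_AE[OF z(1)]) (use z(3) conj.hill_sol_borel[OF z(4)] in \<open>auto elim: eventually_mono\<close>)
  have "hill_sol C (\<lambda>x. cnj (h x)) (\<lambda>x. cnj (zr x)) (\<lambda>x. cnj (w x))"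
    using conj.hill_sol_cnj[OF z(4)] by simp
  note d = wronskian_deriv_forced[OF y(4) this]
  have "(LINT x|lborel. f x * cnj (zr x) - cnj (h x) * yr x) = 0"
  proof (rule integral_ac_deriv_eq_zero[OF d])
    show "integrable lborel (\<lambda>x. yr x * cnj (w x) - u x * cnj (zr x))"
      by (intro Bochner_Integration.integrable_diff L2_inner_integrable yr zr y z)
    show "integrable lborel (\<lambda>x. f x * cnj (zr x) - cnj (h x) * yr x)"
      by (intro Bochner_Integration.integrable_diff L2_inner_integrable L2_mult_integrable L2_cnj yr zr y z)
  qed
  then have "l2inner f zr = l2inner yr h"
    unfolding l2inner_def
    using L2_inner_integrable[OF y(2) zr] L2_inner_integrable[OF yr z(2)] by (simp add: mult.commute)
  moreover have "l2inner f zr = l2inner f z" by (rule l2inner_cong_AE) (use y z zr in auto)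
  moreover have "l2inner yr h = l2inner y h" by (rule l2inner_cong_AE) (use y z yr in auto)
  ultimately show ?thesis by simp
qed

text \<open>At a spectral parameter \<open>l\<close> outside the spectrum, both the operator minus \<open>l\<close> and the conjugate operator minus
  \<open>cnj l\<close> are onto. Hence the adjoint cannot properly extend the conjugate operator.\<close>
lemma adjoint_hill_graph:
  "adjoint_graph (hill_graph C Q) = conj_graph C"
proof (rule antisym)
  interpret conj: hill_potential "\<lambda>x. cnj (Q x)" by (rule hill_potential_cnj) unfold_locales
  show "conj_graph C \<subseteq> adjoint_graph (hill_graph C Q)"
    using lagrange_identity by (auto simp: adjoint_graph_def conj.hill_graph_iff)
  obtain K where K: "\<And>t. discriminant (of_real K) \<noteq> 2 * complex_of_real (cos t)"
    using discriminant_outside_exists by blast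
  define l where "l = C - of_real K"
  have D: "discriminant (C - l) \<noteq> 2 * complex_of_real (cos t)" for t using K by (simp add: l_def)
  have D': "conj.discriminant (cnj C - cnj l) \<noteq> 2 * complex_of_real (cos t)" for t
  proof
    assume "conj.discriminant (cnj C - cnj l) = 2 * complex_of_real (cos t)"
    then have "cnj (discriminant (C - l)) = 2 * complex_of_real (cos t)"
      using discriminant_cnj[of "C - l"] by (simp only: complex_cnj_diff)
    from arg_cong[OF this, of cnj] show False using D[of t] by simp
  qed
  show "adjoint_graph (hill_graph C Q) \<subseteq> conj_graph C"
  proof (rule subrelI)
    fix z h assume "(z, h) \<in> adjoint_graph (hill_graph C Q)"
    then have zh: "L2 z" "L2 h" and adj: "\<And>y f. (y, f) \<in> hill_graph C Q \<Longrightarrow> l2inner f z = l2inner y h"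
      by (auto simp: adjoint_graph_def)
    have k: "L2 (\<lambda>x. h x - cnj l * z x)" by (intro L2_diff L2_cmult zh)
    obtain w g where w: "(w, g) \<in> conj_graph C" "\<And>x. g x - cnj l * w x = h x - cnj l * z x"
      using conj.resolvent_surjective_bounded(1)[OF D' k] by auto
    have wg: "L2 w" "L2 g" using w(1) unfolding conj.hill_graph_iff by auto
    have zw: "L2 (\<lambda>x. z x - w x)" by (intro L2_diff zh wg)
    \<comment> \<open>The difference \<open>z - w\<close> is itself taken as right-hand side;
      pairing it with the adjoint relation then produces its own squared norm, which must
      vanish.\<close>
    obtain y f where y: "(y, f) \<in> hill_graph C Q" "\<And>x. f x - l * y x = z x - w x"
      using resolvent_surjective_bounded(1)[OF D zw] by auto
    have yf: "L2 y" "L2 f" using y(1) unfolding hill_graph_iff by auto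
    have hg: "(\<lambda>x. h x - g x) = (\<lambda>x. cnj l * (z x - w x))"
    proof
      fix x show "h x - g x = cnj l * (z x - w x)" using w(2)[of x] by (simp add: algebra_simps)
    qed
    have "l2inner f (\<lambda>x. z x - w x) = l2inner y h - l2inner y g"
      using l2inner_diff_right[OF zh(1) wg(1) yf(2)] adj[OF y(1)] lagrange_identity[OF y(1) w(1)] by simp
    also have "\<dots> = l2inner y (\<lambda>x. h x - g x)" by (rule l2inner_diff_right[OF zh(2) wg(2) yf(1), symmetric])
    also have "\<dots> = l * l2inner y (\<lambda>x. z x - w x)" unfolding hg l2inner_cmult_right by simp
    finally have "l2inner f (\<lambda>x. z x - w x) - l2inner (\<lambda>x. l * y x) (\<lambda>x. z x - w x) = 0"
      unfolding l2inner_cmult_left by simp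
    then have "l2inner (\<lambda>x. f x - l * y x) (\<lambda>x. z x - w x) = 0"
      using l2inner_diff_left[OF yf(2) L2_cmult[OF yf(1)] zw] by simp
    then have "l2inner (\<lambda>x. z x - w x) (\<lambda>x. z x - w x) = 0" unfolding y(2) .
    then have "l2norm (\<lambda>x. z x - w x) = 0" unfolding l2inner_self by simp
    from l2norm_eq_zero[OF zw this] have ae: "AE x in lborel. w x = z x" by eventually_elim simp
    have "AE x in lborel. g x = h x"
      using ae
    proof eventually_elim
      case (elim x)
      then show ?case using w(2)[of x] by simp
    qed
    from conj.hill_graph_cong_AE[OF w(1) ae this zh] show "(z, h) \<in> conj_graph C" .
  qed
qed

text \<open>Applying the adjoint theorem to the conjugate potential exhibits the graph as an adjoint
  graph, and adjoint relations pass to L2 limits by continuity of the inner product.\<close>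

lemma closed_hill_graph: "closed_op (hill_graph C Q)"
  unfolding closed_op_def
proof (intro allI impI, elim conjE)
  interpret conj: hill_potential "\<lambda>x. cnj (Q x)" by (rule hill_potential_cnj) unfold_locales
  fix ys fs y f
  assume G: "\<forall>n. (ys n, fs n) \<in> hill_graph C Q" and L: "L2 y" "L2 f"
    and ly: "(\<lambda>n. l2norm (\<lambda>x. ys n x - y x)) \<longlonglongrightarrow> 0" and lf: "(\<lambda>n. l2norm (\<lambda>x. fs n x - f x)) \<longlonglongrightarrow> 0"
  have Ln: "L2 (ys n)" "L2 (fs n)" for n using G unfolding hill_graph_iff by auto
  have "l2inner h y = l2inner z f" if zh: "(z, h) \<in> conj_graph C" for z h
  proof -
    have L': "L2 z" "L2 h" using zh unfolding conj.hill_graph_iff by auto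
    have "(\<lambda>n. l2inner (ys n) h) \<longlonglongrightarrow> l2inner y h" by (rule l2inner_tendsto[OF Ln(1) L(1) L'(2) ly])
    moreover have "(\<lambda>n. l2inner (fs n) z) \<longlonglongrightarrow> l2inner f z" by (rule l2inner_tendsto[OF Ln(2) L(2) L'(1) lf])
    moreover have "l2inner (fs n) z = l2inner (ys n) h" for n by (rule lagrange_identity[OF _ zh]) (use G in auto)
    ultimately have "l2inner f z = l2inner y h" by (auto intro: LIMSEQ_unique)
    then show ?thesis using l2inner_commute[of h y] l2inner_commute[of z f] by simp
  qed
  then have "(y, f) \<in> adjoint_graph (conj_graph C)"
    using L by (auto simp: adjoint_graph_def)
  then show "(y, f) \<in> hill_graph C Q" unfolding conj.adjoint_hill_graph by simp
qed

text \<open>If \<open>yr\<close> vanishes, \<open>u\<close> is a derivative of zero, so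
  \<open>u\<close> and then \<open>g\<close> vanish. The lemma serves density of the domain: a
  function \<open>g\<close> orthogonal to the domain puts \<open>(0, g)\<close> into the adjoint
  graph.\<close>

lemma hill_graph_single_valued_at_zero:
  assumes "((\<lambda>x. 0), g) \<in> hill_graph C Q"
  shows "AE x in lborel. g x = 0"
proof -
  obtain yr u where *: "AE x in lborel. yr x = 0" "hill_sol C g yr u"
    using assms unfolding hill_graph_iff by auto
  have yr: "yr = (\<lambda>x. 0)"
    by (rule ext, rule continuous_AE_eq_imp_eq[OF hill_sol_cont(1)[OF *(2)] continuous_on_const open_UNIV _ UNIV_I])
      (use *(1) in simp)
  have d: "ac_deriv (\<lambda>x. 0) u" "ac_deriv u (\<lambda>x. - (Q x * u x) - g x)"
    using *(2) unfolding hill_sol_def yr by auto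
  have "AE x in lborel. u x = 0" by (rule ac_deriv_const_imp_AE_zero[OF d(1)])
  then have u: "u = (\<lambda>x. 0)"
    by (intro ext continuous_AE_eq_imp_eq[OF hill_sol_cont(2)[OF *(2)] continuous_on_const open_UNIV _ UNIV_I]) simp
  have "ac_deriv (\<lambda>x. 0) (\<lambda>x. - g x)" using d(2) unfolding u by simp
  from ac_deriv_const_imp_AE_zero[OF this] show ?thesis by simp
qed

lemma dense_domain_hill_graph: "dense_domain (hill_graph C Q)"
  unfolding dense_domain_def
proof (intro allI impI)
  interpret conj: hill_potential "\<lambda>x. cnj (Q x)" by (rule hill_potential_cnj) unfold_locales
  fix f and e :: real assume f: "L2 f" and e: "0 < e"
  show "\<exists>y\<in>op_domain (hill_graph C Q). l2norm (\<lambda>x. y x - f x) < e"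
  proof (rule l2_dense_of_trivial_orthogonal[OF _ _ _ _ _ f e])
    show "L2 s" if "s \<in> op_domain (hill_graph C Q)" for s
      using that by (auto simp: op_domain_def hill_graph_iff)
    show "op_domain (hill_graph C Q) \<noteq> {}" using hill_graph_zero by (auto simp: op_domain_def)
    show "(\<lambda>x. s x + t x) \<in> op_domain (hill_graph C Q)" if "s \<in> op_domain (hill_graph C Q)" "t \<in> op_domain (hill_graph C Q)" for s t
      using that hill_graph_add unfolding op_domain_def by (force simp: image_iff)
    show "(\<lambda>x. k * s x) \<in> op_domain (hill_graph C Q)" if "s \<in> op_domain (hill_graph C Q)" for k s
      using that hill_graph_cmult unfolding op_domain_def by (force simp: image_iff)
    fix g assume g: "L2 g" and o: "\<And>s. s \<in> op_domain (hill_graph C Q) \<Longrightarrow> l2inner s g = 0"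
    have "((\<lambda>x. 0), g) \<in> adjoint_graph (hill_graph C Q)"
      unfolding adjoint_graph_def using g L2_zero o by (force simp: op_domain_def l2inner_def)
    then show "AE x in lborel. g x = 0"
      unfolding adjoint_hill_graph by (rule conj.hill_graph_single_valued_at_zero)
  qed
qed

text \<open>A function orthogonal to the range of the operator minus \<open>lam\<close> is an
  eigenfunction of the adjoint for \<open>cnj lam\<close>. The adjoint is again a Hill operator and
  has no eigenfunctions.\<close>

lemma continuous_spectrum_hill_graph: "continuous_spectrum (hill_graph C Q)"
  unfolding continuous_spectrum_def
proof (intro ballI conjI)
  interpret conj: hill_potential "\<lambda>x. cnj (Q x)" by (rule hill_potential_cnj) unfold_locales
  fix lam
  show "case p of (y, g) \<Rightarrow> (AE x in lborel. g x = lam * y x) \<longrightarrow> (AE x in lborel. y x = 0)" if "p \<in> hill_graph C Q" for p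
  proof (cases p)
    case (Pair y g)
    have "(y, g) \<in> hill_graph C Q" using that Pair by simp
    then have "(AE x in lborel. g x = lam * y x) \<longrightarrow> (AE x in lborel. y x = 0)"
      using hill_graph_kernel by blast
    then show ?thesis by (simp only: Pair prod.case)
  qed
  show "\<forall>f. L2 f \<longrightarrow> (\<forall>\<epsilon>>0. \<exists>(y, g)\<in>hill_graph C Q. l2norm (\<lambda>x. g x - lam * y x - f x) < \<epsilon>)"
  proof (intro allI impI)
    fix f and e :: real assume f: "L2 f" and e: "0 < e"
    let ?S = "{s. \<exists>y g. (y, g) \<in> hill_graph C Q \<and> s = (\<lambda>x. g x - lam * y x)}"
    have in_S: "s \<in> ?S" if "(y, g) \<in> hill_graph C Q" "\<And>x. s x = g x - lam * y x" for s y g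
      using that by (intro CollectI exI conjI) auto
    have "\<exists>s\<in>?S. l2norm (\<lambda>x. s x - f x) < e"
    proof (rule l2_dense_of_trivial_orthogonal[OF _ _ _ _ _ f e])
      show "L2 s" if "s \<in> ?S" for s
        using that by (auto simp: hill_graph_iff intro!: L2_diff L2_cmult)
      show "?S \<noteq> {}" using in_S[OF hill_graph_zero, of "\<lambda>x. 0"] by auto
      show "(\<lambda>x. s x + t x) \<in> ?S" if st: "s \<in> ?S" "t \<in> ?S" for s t
      proof -
        obtain y g z h where *: "(y, g) \<in> hill_graph C Q" "s = (\<lambda>x. g x - lam * y x)"
          "(z, h) \<in> hill_graph C Q" "t = (\<lambda>x. h x - lam * z x)" using st by blast
        show ?thesis by (rule in_S[OF hill_graph_add[OF *(1,3)]]) (simp add: * algebra_simps)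
      qed
      show "(\<lambda>x. k * s x) \<in> ?S" if s: "s \<in> ?S" for k s
      proof -
        obtain y g where *: "(y, g) \<in> hill_graph C Q" "s = (\<lambda>x. g x - lam * y x)" using s by blast
        show ?thesis by (rule in_S[OF hill_graph_cmult[OF *(1), of k]]) (simp add: * algebra_simps)
      qed
      fix k assume k: "L2 k" and o: "\<And>s. s \<in> ?S \<Longrightarrow> l2inner s k = 0"
      have "l2inner g k = l2inner y (\<lambda>x. cnj lam * k x)" if yg: "(y, g) \<in> hill_graph C Q" for y g
      proof -
        have L: "L2 y" "L2 g" using yg unfolding hill_graph_iff by auto
        have "l2inner (\<lambda>x. g x - lam * y x) k = 0" by (rule o[OF in_S[OF yg refl]])
        then show ?thesis
          using l2inner_diff_left[OF L(2) L2_cmult[OF L(1)] k] by (simp add: l2inner_cmult_left l2inner_cmult_right)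
      qed
      then have "(k, (\<lambda>x. cnj lam * k x)) \<in> adjoint_graph (hill_graph C Q)"
        using k L2_cmult[OF k] by (auto simp: adjoint_graph_def)
      then show "AE x in lborel. k x = 0"
        unfolding adjoint_hill_graph by (rule conj.hill_graph_kernel[OF _ AE_I2[OF refl]])
    qed
    then show "\<exists>(y, g)\<in>hill_graph C Q. l2norm (\<lambda>x. g x - lam * y x - f x) < e" by auto
  qed
qed

end

theorem theorem4:
  fixes C :: complex and Q :: "real \<Rightarrow> complex"
  assumes Q_meas: "Q \<in> borel_measurable lborel"
    and Q_L2loc: "\<And>a b. (\<lambda>x. (cmod (Q x))\<^sup>2) integrable_on {a..b}"
    and Q_per: "AE x in lborel. Q (x + pi) = Q x"
    and Q_mean: "(Q has_integral 0) {0..pi}"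
  shows "dense_domain (hill_graph C Q)
    \<and> closed_op (hill_graph C Q)
    \<and> adjoint_graph (hill_graph C Q) = hill_graph (cnj C) (\<lambda>x. cnj (Q x))
    \<and> ((Im C = 0 \<and> (AE x in lborel. Im (Q x) = 0)) \<longrightarrow>
          adjoint_graph (hill_graph C Q) = hill_graph C Q)
    \<and> continuous_spectrum (hill_graph C Q)
    \<and> op_spectrum (hill_graph C Q) =
        {lam. \<exists>\<theta>\<in>{0..<2*pi}. lyapunov C Q lam = 2 * complex_of_real (cos \<theta>)}"
proof -
  interpret hill_potential Q
  proof
    show [measurable]: "Q \<in> borel_measurable borel" using Q_meas by simp
    show "set_integrable lborel {a..b} (\<lambda>x. (cmod (Q x))\<^sup>2)" for a b
    proof -
      \<comment> \<open>For nonnegative functions gauge integrability is already absolute, and Borel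
        measurability brings it down from the completion to \<open>lborel\<close>.\<close>
      have "(\<lambda>x. (cmod (Q x))\<^sup>2) absolutely_integrable_on {a..b}"
        by (rule nonnegative_absolutely_integrable_1[OF Q_L2loc]) simp
      then show ?thesis
        unfolding set_integrable_def by (subst (asm) integrable_completion) simp_all
    qed
    show "AE x in lborel. Q (x + pi) = Q x" by (rule Q_per)
  qed
  have "adjoint_graph (hill_graph C Q) = hill_graph C Q" if "Im C = 0" "AE x in lborel. Im (Q x) = 0"
  proof -
    have "cnj C = C" using that(1) by (simp add: complex_eq_iff)
    moreover have "AE x in lborel. cnj (Q x) = Q x"
      using that(2) by eventually_elim (simp add: complex_eq_iff)
    \<comment> \<open>The potential is real only almost everywhere, so the two graphs are compared
      by their invariance under changing \<open>Q\<close> on a null set.\<close>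
    ultimately show ?thesis using adjoint_hill_graph hill_graph_cong_potential by metis
  qed
  then show ?thesis
    using dense_domain_hill_graph closed_hill_graph adjoint_hill_graph continuous_spectrum_hill_graph
      op_spectrum_eq lyapunov_eq_discriminant by simp
qed

end
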